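(* The function $F$ satisfies: $F(0)=0$, $F(1)=2$, $F(2)=4$, $5\le F(3)\le 74$, $16\le F(4)\le 13439$, and $256\le F(5)\le 1.08\cdot 10^{189}$.
   Context: All games are short normal-play two-player combinatorial games (Left and Right; a player unable to move loses), compared up to equality ($Y=Z$ iff $X+Y$ and $X+Z$ have the same outcome for every game $X$, $+$ being the disjunctive sum). The birthday of a game is the maximum length of a sequence of moves (not necessarily alternating) starting from it; a value is born by day $b$ if it equals some game of birthday at most $b$; $\mathbb{G}_b$ is the set of values born by day $b$. A Digraph placement game is played on a finite digraph with vertices coloured blue/red (not necessarily properly): Left chooses a remaining blue vertex and deletes it with all its out-neighbours, Right does the same with a red vertex; a player unable to move loses. For a game $X$, $f(X)$ is the least $n$ such that some Digraph placement game on $n$ vertices equals $X$, and $F(b)=\max_{X\in\mathbb{G}_b}f(X)$. *)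

theory Defs
  imports Complex_Main "HOL-Library.FSet" "Graph_Theory.Pair_Digraph"
begin

section \<open>Short normal-play games\<close>

text \<open>Elements of a datatype are well-founded and the option sets are finite, so the inhabitants
  of this type are exactly the short games.\<close>

datatype game = Game (left_opts: "game fset") (right_opts: "game fset")

datatype player = Left | Right

fun opponent :: "player \<Rightarrow> player" where
  "opponent Left = Right"
| "opponent Right = Left"

fun options :: "player \<Rightarrow> game \<Rightarrow> game fset" where
  "options Left G = left_opts G"
| "options Right G = right_opts G"

lemma fimage_fundef_cong [fundef_cong]:
  "A = B \<Longrightarrow> (\<And>x. x |\<in>| B \<Longrightarrow> f x = g x) \<Longrightarrow> f |`| A = g |`| B"
  by (rule fset.map_cong)

lemma size_left_option: "H |\<in>| left_opts G \<Longrightarrow> size H < size G"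
  by (cases G) (auto simp: size_fset_overloaded_simps intro!: le_imp_less_Suc trans_le_add1
    intro: order_trans[OF le_SucI[OF le_refl] member_le_sum[where f = "Suc \<circ> size", simplified o_def]])

lemma size_right_option: "H |\<in>| right_opts G \<Longrightarrow> size H < size G"
  by (cases G) (auto simp: size_fset_overloaded_simps intro!: le_imp_less_Suc trans_le_add2
    intro: order_trans[OF le_SucI[OF le_refl] member_le_sum[where f = "Suc \<circ> size", simplified o_def]])

lemma size_option: "H |\<in>| options p G \<Longrightarrow> size H < size G"
  by (cases p) (auto dest: size_left_option size_right_option)

text \<open>The winner under optimal play when \<open>p\<close> moves first. A player without options loses,
  as no option then satisfies the condition.\<close>

function winner :: "player \<Rightarrow> game \<Rightarrow> player" where
  "winner p G = (if \<exists>H |\<in>| options p G. winner (opponent p) H = p then p else opponent p)"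
  by auto
termination
  by (relation "measure (\<lambda>(p, G). size G)") (auto simp: size_option)

declare winner.simps [simp del]

text \<open>The four possible pairs of winners are the four outcome classes.\<close>

definition outcome :: "game \<Rightarrow> player \<times> player" where
  "outcome G = (winner Left G, winner Right G)"

function game_sum :: "game \<Rightarrow> game \<Rightarrow> game" where
  "game_sum G H = Game
     ((\<lambda>G'. game_sum G' H) |`| left_opts G |\<union>| (\<lambda>H'. game_sum G H') |`| left_opts H)
     ((\<lambda>G'. game_sum G' H) |`| right_opts G |\<union>| (\<lambda>H'. game_sum G H') |`| right_opts H)"
  by auto
termination
  by (relation "measure (\<lambda>(G, H). size G + size H)")
    (auto simp: size_left_option size_right_option)

declare game_sum.simps [simp del]

definition game_eq :: "game \<Rightarrow> game \<Rightarrow> bool" where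
  "game_eq Y Z \<longleftrightarrow> (\<forall>X. outcome (game_sum X Y) = outcome (game_sum X Z))"

quotient_type game_value = game / game_eq
  morphisms rep_game_value value_of
  by (rule equivpI) (auto simp: game_eq_def reflp_def symp_def transp_def)

section \<open>Birthdays\<close>

definition move :: "game \<Rightarrow> game \<Rightarrow> bool" where
  "move G H \<longleftrightarrow> (\<exists>p. H |\<in>| options p G)"

definition birthday :: "game \<Rightarrow> nat" where
  "birthday G = Max {n. \<exists>H. (move ^^ n) G H}"

text \<open>The maximum is taken over a finite nonempty set.\<close>

lemma move_sequence_length_le: "(move ^^ n) G H \<Longrightarrow> n + size H \<le> size G"
  by (induction n arbitrary: H) (force simp: move_def dest: size_option)+

lemma finite_move_sequence_lengths: "finite {n. \<exists>H. (move ^^ n) G H}"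
  by (rule finite_subset[of _ "{..size G}"]) (auto dest: move_sequence_length_le)

lemma move_sequence_lengths_nonempty: "{n. \<exists>H. (move ^^ n) G H} \<noteq> {}"
proof -
  have "(move ^^ 0) G G" by simp
  then show ?thesis by blast
qed

definition values_born_by :: "nat \<Rightarrow> game_value set" where
  "values_born_by b = {X. \<exists>G. value_of G = X \<and> birthday G \<le> b}"

section \<open>Digraph placement games\<close>

datatype colour = Blue | Red

text \<open>A position is given by the set \<open>S\<close> of remaining vertices; \<open>after_deletion D S v\<close> removes
  \<open>v\<close> and its out-neighbours.\<close>

definition after_deletion :: "'a pair_pre_digraph \<Rightarrow> 'a fset \<Rightarrow> 'a \<Rightarrow> 'a fset" where
  "after_deletion D S v = ffilter (\<lambda>w. w \<noteq> v \<and> (v, w) \<notin> parcs D) S"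

lemma fcard_after_deletion: "v |\<in>| S \<Longrightarrow> fcard (after_deletion D S v) < fcard S"
  by (rule pfsubset_fcard_mono) (auto simp: after_deletion_def)

function placement_position ::
  "'a pair_pre_digraph \<Rightarrow> ('a \<Rightarrow> colour) \<Rightarrow> 'a fset \<Rightarrow> game" where
  "placement_position D c S = Game
     ((\<lambda>v. placement_position D c (after_deletion D S v)) |`| ffilter (\<lambda>v. c v = Blue) S)
     ((\<lambda>v. placement_position D c (after_deletion D S v)) |`| ffilter (\<lambda>v. c v = Red) S)"
  by auto
termination
  by (relation "measure (\<lambda>(D, c, S). fcard S)") (auto simp: fcard_after_deletion)

declare placement_position.simps [simp del]

text \<open>Intended for digraphs with finite vertex set, as \<open>Abs_fset\<close> is unspecified on infinite sets.\<close>

definition digraph_placement :: "'a pair_pre_digraph \<Rightarrow> ('a \<Rightarrow> colour) \<Rightarrow> game" where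
  "digraph_placement D c = placement_position D c (Abs_fset (pverts D))"

text \<open>Every finite digraph has an isomorphic copy on natural numbers, and \<open>pair_digraph\<close>
  requires finiteness. It also excludes loops, which could not affect the game since a chosen
  vertex is deleted anyway.\<close>

definition placement_f :: "game_value \<Rightarrow> nat" where
  "placement_f X = (LEAST n. \<exists>(D :: nat pair_pre_digraph) c.
     pair_digraph D \<and> card (pverts D) = n \<and> value_of (digraph_placement D c) = X)"

definition placement_F :: "nat \<Rightarrow> nat" where
  "placement_F b = Max (placement_f ` values_born_by b)"

end

theory Submission
  imports Defs
begin

text \<open>Upper bounds. A digraph for \<open>{A | B}\<close> is built from positions of a common pool of
  vertices with the values of \<open>A\<close> and \<open>B\<close>, one selector vertex per option, which deletes everything but the
  position it selects, and a gadget of four groups of vertices refuting one another cyclically, which punishes every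
  move that is not a selector. Since the pool is shared, the cost of a game is essentially its number of options.
  Games born by day \<open>n + 1\<close> correspond to the pairs of a downset and an upset of the games born by
  day \<open>n\<close> satisfying a closure condition, ordered by inclusion; this makes the 22 games of day 2 and the 1474 games of day 3
  explicit. A cover of the latter by 224 chains leaves at most \<open>2 ^ 622\<close> essentially different option sets
  of games born by day 4. For day 5 Left selects an option in two moves, first its left and then its right options, with a forced
  reply in between, so that \<open>2 ^ 622\<close> selectors per move suffice.

  Lower bounds. For days 1 to 3 take the switch \<open>{n | -n}\<close>. For day 4 take \<open>G = {A | -3}\<close> where \<open>A\<close> is an antichain of
  66 games born by day 3, none of which is the value of a position with fewer than 3 blue vertices.
  In a digraph of value \<open>G\<close>, each element of \<open>A\<close> is reached by a sequence of moves of Left with reversing replies of Right.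
  As \<open>a \<le> G\<close> fails for all \<open>a\<close> in \<open>A\<close>, every such move deletes a red vertex and every reply a blue one,
  while -3 keeps four red vertices alive; with 15 vertices at most 63 elements can be reached. For day 5,
  there are more subsets of an antichain of 92378 games than digraphs on at most 255 vertices.\<close>

section \<open>The order of games\<close>

text \<open>A digraph cannot forbid a move, so the obstacle to every upper bound is the vertices
  other than the intended ones. The gadget answers a move at such a vertex with an integer at least
  as extreme as any game of the birthday in question; hence its size follows the birthday, and the
  remaining options matter only up to domination. Option sets are replaced by the largest ones that
  leave the value unchanged (the gift horse principle). Comparison then becomes inclusion of boolean
  lists, and the tables can be checked by evaluation without canonical forms. An option of a game
  born by day 5 is given by two independent choices of selectors, one per player. Choosing both at
  once would square the number of selectors; choosing one after the other and intersecting the two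
  resulting positions only doubles it. As \<open>placement_f\<close> is a least number, a lower
  bound also needs some realization to exist; the construction for day 5 supplies it.\<close>

function game_le :: "game \<Rightarrow> game \<Rightarrow> bool" (infix "\<preceq>" 50) where
  "G \<preceq> H \<longleftrightarrow> (\<forall>G' |\<in>| left_opts G. \<not> H \<preceq> G') \<and> (\<forall>H' |\<in>| right_opts H. \<not> H' \<preceq> G)"
  by auto
termination
  by (relation "measure (\<lambda>(G, H). size G + size H)")
    (auto dest: size_left_option size_right_option)

declare game_le.simps [simp del]

lemma game_leI:
  assumes "\<And>G'. G' |\<in>| left_opts G \<Longrightarrow> \<not> H \<preceq> G'" "\<And>H'. H' |\<in>| right_opts H \<Longrightarrow> \<not> H' \<preceq> G"
  shows "G \<preceq> H"
  using assms by (subst game_le.simps) blast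

lemma game_le_left: "G \<preceq> H \<Longrightarrow> G' |\<in>| left_opts G \<Longrightarrow> \<not> H \<preceq> G'"
  and game_le_right: "G \<preceq> H \<Longrightarrow> H' |\<in>| right_opts H \<Longrightarrow> \<not> H' \<preceq> G"
  by (subst (asm) game_le.simps, blast)+

lemma not_game_leE:
  assumes "\<not> G \<preceq> H"
  obtains G' where "G' |\<in>| left_opts G" "H \<preceq> G'" | H' where "H' |\<in>| right_opts H" "H' \<preceq> G"
  using assms by (subst (asm) game_le.simps) blast

lemma not_Right_iff: "p \<noteq> Right \<longleftrightarrow> p = Left"
  by (cases p) simp_all

lemma winner_Left_Left: "winner Left G = Left \<longleftrightarrow> (\<exists>H |\<in>| left_opts G. winner Right H = Left)"
  and winner_Right_Left: "winner Right G = Left \<longleftrightarrow> (\<forall>H |\<in>| right_opts G. winner Left H = Left)"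
  by (subst winner.simps, simp flip: not_Right_iff)+

lemma left_opts_game_sum: "left_opts (game_sum G H) =
    (\<lambda>G'. game_sum G' H) |`| left_opts G |\<union>| (\<lambda>H'. game_sum G H') |`| left_opts H"
  and right_opts_game_sum: "right_opts (game_sum G H) =
    (\<lambda>G'. game_sum G' H) |`| right_opts G |\<union>| (\<lambda>H'. game_sum G H') |`| right_opts H"
  by (subst game_sum.simps, simp)+

text \<open>Left copies her play on X + Y to X + Z. A move in Y, or of Right in Z, is translated
  through the witness that the order fails after it: either a matching move in the other component,
  or an imagined counter-move after which the two components are ordered again.\<close>

lemma winner_game_sum_mono:
  assumes "Y \<preceq> Z" "winner p (game_sum X Y) = Left"
  shows "winner p (game_sum X Z) = Left"
  using assms
proof (induction "size X + size Y + size Z" arbitrary: X Y Z p rule: less_induct)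
  case less
  show ?case
  proof (cases p)
    case Left
    then obtain W where W: "W |\<in>| left_opts (game_sum X Y)" "winner Right W = player.Left"
      using less.prems(2) winner_Left_Left by auto
    then consider X' where "X' |\<in>| left_opts X" "W = game_sum X' Y"
      | Y' where "Y' |\<in>| left_opts Y" "W = game_sum X Y'"
      by (auto simp: left_opts_game_sum)
    then have "winner player.Left (game_sum X Z) = player.Left"
    proof cases
      case 1
      then have "winner Right (game_sum X' Z) = player.Left"
        using less.hyps[of X' Y Z] less.prems(1) W size_left_option by fastforce
      then show ?thesis using 1 by (auto simp: winner_Left_Left left_opts_game_sum)
    next
      case 2
      then have "\<not> Z \<preceq> Y'" using less.prems(1) game_le_left by blast
      then show ?thesis
      proof (cases rule: not_game_leE)
        case (1 Z')
        then have "winner Right (game_sum X Z') = player.Left"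
          using less.hyps[of X Y' Z'] 2 W size_left_option[OF 1(1)] size_left_option[OF 2(1)] by fastforce
        then show ?thesis using 1 by (auto simp: winner_Left_Left left_opts_game_sum)
      next
        case (2 Y'')
        have "winner player.Left (game_sum X Y'') = player.Left"
          using W(2) 2(1) \<open>W = game_sum X Y'\<close> by (auto simp: winner_Right_Left right_opts_game_sum)
        then show ?thesis
          using less.hyps[of X Y'' Z] 2 \<open>Y' |\<in>| left_opts Y\<close> size_right_option size_left_option by fastforce
      qed
    qed
    then show ?thesis using Left by simp
  next
    case Right
    have "winner player.Left W = player.Left" if W: "W |\<in>| right_opts (game_sum X Z)" for W
    proof -
      have *: "\<And>W. W |\<in>| right_opts (game_sum X Y) \<Longrightarrow> winner player.Left W = player.Left"
        using less.prems(2) Right winner_Right_Left by auto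
      consider X' where "X' |\<in>| right_opts X" "W = game_sum X' Z"
        | Z' where "Z' |\<in>| right_opts Z" "W = game_sum X Z'"
        using W by (auto simp: right_opts_game_sum)
      then show ?thesis
      proof cases
        case 1
        then show ?thesis
          using less.hyps[of X' Y Z] less.prems(1) *[of "game_sum X' Y"] size_right_option[OF 1(1)]
          by (simp add: right_opts_game_sum)
      next
        case 2
        then have "\<not> Z' \<preceq> Y" using less.prems(1) game_le_right by blast
        then show ?thesis
        proof (cases rule: not_game_leE)
          case (1 Z'')
          then have "winner Right (game_sum X Z'') = player.Left"
            using less.hyps[of X Y Z''] less.prems(2) Right size_left_option[OF 1(1)] size_right_option[OF 2(1)]
            by simp
          then show ?thesis using 1 2 by (auto simp: winner_Left_Left left_opts_game_sum)
        next
          case (2 Y')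
          have "winner player.Left (game_sum X Y') = player.Left"
            using * 2 by (simp add: right_opts_game_sum)
          then show ?thesis
            using less.hyps[of X Y' Z'] 2 \<open>W = game_sum X Z'\<close> size_right_option[OF 2(1)]
              size_right_option[OF \<open>Z' |\<in>| right_opts Z\<close>] by simp
        qed
      qed
    qed
    then show ?thesis using Right winner_Right_Left by simp
  qed
qed

section \<open>Negatives and the outcome of a difference\<close>

function game_neg :: "game \<Rightarrow> game" where
  "game_neg G = Game (game_neg |`| right_opts G) (game_neg |`| left_opts G)"
  by auto
termination
  by (relation "measure size") (auto dest: size_left_option size_right_option)

declare game_neg.simps [simp del]

lemma left_opts_game_neg: "left_opts (game_neg G) = game_neg |`| right_opts G"
  and right_opts_game_neg: "right_opts (game_neg G) = game_neg |`| left_opts G"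
  by (subst game_neg.simps, simp)+

text \<open>Every move passes the turn and shrinks one component, so the two halves, for Right and
  for Left moving first, prove each other. They identify the recursive order with the outcome of a
  difference.\<close>

lemma winner_game_neg_sum:
  "(winner Right (game_sum (game_neg Y) Z) = Left \<longleftrightarrow> Y \<preceq> Z) \<and>
   (winner Left (game_sum (game_neg Y) Z) = Left \<longleftrightarrow> \<not> Z \<preceq> Y)"
proof (induction "size Y + size Z" arbitrary: Y Z rule: less_induct)
  case less
  have 1: "winner Left (game_sum (game_neg Y') Z) = Left \<longleftrightarrow> \<not> Z \<preceq> Y'" if "Y' |\<in>| left_opts Y" for Y'
    using less[of Y' Z] size_left_option[OF that] by simp
  have 2: "winner Left (game_sum (game_neg Y) Z') = Left \<longleftrightarrow> \<not> Z' \<preceq> Y" if "Z' |\<in>| right_opts Z" for Z'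
    using less[of Y Z'] size_right_option[OF that] by simp
  have 3: "winner Right (game_sum (game_neg Y') Z) = Left \<longleftrightarrow> Y' \<preceq> Z" if "Y' |\<in>| right_opts Y" for Y'
    using less[of Y' Z] size_right_option[OF that] by simp
  have 4: "winner Right (game_sum (game_neg Y) Z') = Left \<longleftrightarrow> Y \<preceq> Z'" if "Z' |\<in>| left_opts Z" for Z'
    using less[of Y Z'] size_left_option[OF that] by simp
  have "winner Right (game_sum (game_neg Y) Z) = Left \<longleftrightarrow>
      (\<forall>Y' |\<in>| left_opts Y. winner Left (game_sum (game_neg Y') Z) = Left) \<and>
      (\<forall>Z' |\<in>| right_opts Z. winner Left (game_sum (game_neg Y) Z') = Left)"
    unfolding winner_Right_Left right_opts_game_sum right_opts_game_neg by (simp add: ball_Un)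
  also have "\<dots> \<longleftrightarrow> Y \<preceq> Z"
    unfolding game_le.simps[of Y Z] using 1 2 by simp
  finally have A: "winner Right (game_sum (game_neg Y) Z) = Left \<longleftrightarrow> Y \<preceq> Z" .
  have "winner Left (game_sum (game_neg Y) Z) = Left \<longleftrightarrow>
      (\<exists>Y' |\<in>| right_opts Y. winner Right (game_sum (game_neg Y') Z) = Left) \<or>
      (\<exists>Z' |\<in>| left_opts Z. winner Right (game_sum (game_neg Y) Z') = Left)"
    unfolding winner_Left_Left left_opts_game_sum left_opts_game_neg by (simp add: bex_Un)
  also have "\<dots> \<longleftrightarrow> \<not> Z \<preceq> Y"
    unfolding game_le.simps[of Z Y] using 3 4 by auto
  finally show ?case using A by blast
qed

lemma game_le_refl [simp]: "G \<preceq> G"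
proof (induction "size G" arbitrary: G rule: less_induct)
  case less
  show ?case
  proof (rule game_leI)
    show "\<not> G \<preceq> G'" if "G' |\<in>| left_opts G" for G'
      using less[OF size_left_option[OF that]] game_le_left that by blast
    show "\<not> G' \<preceq> G" if "G' |\<in>| right_opts G" for G'
      using less[OF size_right_option[OF that]] game_le_right that by blast
  qed
qed

text \<open>No induction on three games is made: X \<preceq> Y says that Left wins -X + Y moving
  second, and monotonicity carries this win over to -X + Z.\<close>

lemma game_le_trans [trans]: "X \<preceq> Y \<Longrightarrow> Y \<preceq> Z \<Longrightarrow> X \<preceq> Z"
  using winner_game_neg_sum winner_game_sum_mono by metis

lemma left_option_not_ge: "G' |\<in>| left_opts G \<Longrightarrow> \<not> G \<preceq> G'"
  and right_option_not_le: "G' |\<in>| right_opts G \<Longrightarrow> \<not> G' \<preceq> G"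
  using game_le_left game_le_right game_le_refl by blast+

section \<open>Equality of games as mutual comparison\<close>

definition game_equiv :: "game \<Rightarrow> game \<Rightarrow> bool" (infix "\<approx>" 50) where
  "G \<approx> H \<longleftrightarrow> G \<preceq> H \<and> H \<preceq> G"

lemma game_equivI: "G \<preceq> H \<Longrightarrow> H \<preceq> G \<Longrightarrow> G \<approx> H"
  and game_equiv_le: "G \<approx> H \<Longrightarrow> G \<preceq> H"
  and game_equiv_ge: "G \<approx> H \<Longrightarrow> H \<preceq> G"
  and game_equiv_refl [simp]: "G \<approx> G"
  and game_equiv_sym: "G \<approx> H \<Longrightarrow> H \<approx> G"
  by (auto simp: game_equiv_def)

lemma game_equiv_trans [trans]: "G \<approx> H \<Longrightarrow> H \<approx> K \<Longrightarrow> G \<approx> K"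
  unfolding game_equiv_def using game_le_trans by blast

text \<open>Adding \<open>game_neg X\<close> turns equal outcomes into equal comparisons with X, in
  particular for X = G and X = H. The converse is monotonicity of the outcome in both
  directions.\<close>

lemma game_eq_iff_equiv: "game_eq G H \<longleftrightarrow> G \<approx> H"
proof
  assume eq: "game_eq G H"
  have "game_sum (game_neg X) Y = game_sum (game_neg X) Y \<and> winner Right (game_sum (game_neg X) G) = winner Right (game_sum (game_neg X) H)" for X Y
    using eq by (auto simp: game_eq_def outcome_def)
  then show "G \<approx> H" by (metis game_le_refl winner_game_neg_sum game_equiv_def)
next
  assume "G \<approx> H"
  then have "winner p (game_sum X G) = Left \<longleftrightarrow> winner p (game_sum X H) = Left" for p X
    using winner_game_sum_mono by (metis game_equiv_def)
  then have "winner p (game_sum X G) = winner p (game_sum X H)" for p X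
    by (metis player.exhaust)
  then show "game_eq G H" by (simp add: game_eq_def outcome_def)
qed

lemma value_of_eq_iff: "value_of G = value_of H \<longleftrightarrow> G \<approx> H"
  using game_value.abs_eq_iff game_eq_iff_equiv by simp

section \<open>Birthdays\<close>

lemma birthday_le_iff: "birthday G \<le> n \<longleftrightarrow> (\<forall>k H. (move ^^ k) G H \<longrightarrow> k \<le> n)"
  unfolding birthday_def
  using Max_le_iff[OF finite_move_sequence_lengths move_sequence_lengths_nonempty] by auto

lemma move_iff: "move G H \<longleftrightarrow> H |\<in>| left_opts G \<or> H |\<in>| right_opts G"
  unfolding move_def by (metis options.simps player.exhaust)

lemma birthday_le_Suc_iff:
  "birthday G \<le> Suc n \<longleftrightarrow> (\<forall>H. H |\<in>| left_opts G \<or> H |\<in>| right_opts G \<longrightarrow> birthday H \<le> n)"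
proof -
  have "(\<forall>k H. (move ^^ k) G H \<longrightarrow> k \<le> Suc n) \<longleftrightarrow> (\<forall>H. move G H \<longrightarrow> (\<forall>k H'. (move ^^ k) H H' \<longrightarrow> k \<le> n))"
    (is "?l \<longleftrightarrow> ?r")
  proof
    assume ?l
    then show ?r by (metis Suc_le_mono relpowp_Suc_I2)
  next
    assume r: ?r
    show ?l
    proof (intro allI impI)
      fix k H assume *: "(move ^^ k) G H"
      show "k \<le> Suc n"
      proof (cases k)
        case (Suc k')
        then obtain G' where "move G G'" "(move ^^ k') G' H" using * relpowp_Suc_D2 by metis
        then show ?thesis using r Suc by blast
      qed simp
    qed
  qed
  then show ?thesis by (simp add: birthday_le_iff move_iff)
qed

lemma birthday_le_0_iff: "birthday G \<le> 0 \<longleftrightarrow> left_opts G = {||} \<and> right_opts G = {||}"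
proof
  assume 0: "birthday G \<le> 0"
  have "\<not> move G H" for H
    using 0 unfolding birthday_le_iff by (metis not_one_le_zero relpowp_1)
  then show "left_opts G = {||} \<and> right_opts G = {||}" by (auto simp: move_iff)
next
  assume "left_opts G = {||} \<and> right_opts G = {||}"
  then have "\<not> move G H" for H by (auto simp: move_iff)
  then have "k = 0" if "(move ^^ k) G H" for k H
    using that by (metis not0_implies_Suc relpowp_Suc_D2)
  then show "birthday G \<le> 0" unfolding birthday_le_iff by blast
qed

lemma birthday_left_option: "birthday G \<le> Suc n \<Longrightarrow> H |\<in>| left_opts G \<Longrightarrow> birthday H \<le> n"
  and birthday_right_option: "birthday G \<le> Suc n \<Longrightarrow> H |\<in>| right_opts G \<Longrightarrow> birthday H \<le> n"
  by (auto simp: birthday_le_Suc_iff)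

lemma birthday_option_less:
  assumes "H |\<in>| left_opts G \<or> H |\<in>| right_opts G" "birthday G \<le> n"
  shows "birthday H < n"
  using assms by (cases n) (auto simp: birthday_le_0_iff[simplified] birthday_le_Suc_iff less_Suc_eq_le)

lemma finite_birthday_le: "finite {G. birthday G \<le> n}"
proof (induction n)
  case 0
  have "G = Game {||} {||}" if "birthday G \<le> 0" for G
    using that unfolding birthday_le_0_iff by (cases G) simp
  then have "{G. birthday G \<le> 0} \<subseteq> {Game {||} {||}}" by blast
  then show ?case using finite_subset by blast
next
  case (Suc n)
  let ?A = "{G. birthday G \<le> n}"
  have "finite {S. fset S \<subseteq> ?A}"
  proof (rule finite_imageD[of fset])
    show "finite (fset ` {S. fset S \<subseteq> ?A})"
      by (rule finite_subset[of _ "Pow ?A"]) (use Suc in auto)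
  qed (simp add: inj_on_def fset_inject)
  moreover have "{G. birthday G \<le> Suc n} \<subseteq> (\<lambda>(A, B). Game A B) ` ({S. fset S \<subseteq> ?A} \<times> {S. fset S \<subseteq> ?A})"
  proof
    fix G assume "G \<in> {G. birthday G \<le> Suc n}"
    then have "(left_opts G, right_opts G) \<in> {S. fset S \<subseteq> ?A} \<times> {S. fset S \<subseteq> ?A}"
      by (auto simp: birthday_le_Suc_iff)
    moreover have "G = (\<lambda>(A, B). Game A B) (left_opts G, right_opts G)" by simp
    ultimately show "G \<in> (\<lambda>(A, B). Game A B) ` ({S. fset S \<subseteq> ?A} \<times> {S. fset S \<subseteq> ?A})"
      by (rule rev_image_eqI)
  qed
  ultimately show ?case by (meson finite_SigmaI finite_imageI finite_subset)
qed

lemma finite_values_born_by: "finite (values_born_by b)"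
proof -
  have "values_born_by b = value_of ` {G. birthday G \<le> b}"
    by (auto simp: values_born_by_def)
  then show ?thesis using finite_birthday_le by simp
qed

section \<open>Positions\<close>

definition remaining :: "('a \<times> 'a) set \<Rightarrow> 'a set \<Rightarrow> 'a \<Rightarrow> 'a set" where
  "remaining E S v = {w \<in> S. w \<noteq> v \<and> (v, w) \<notin> E}"

text \<open>Play depends only on the arcs and the remaining vertices, so the vertex field of the
  record can stay empty. A plain set as argument makes induction on cardinality convenient.\<close>

definition pos :: "('a \<times> 'a) set \<Rightarrow> ('a \<Rightarrow> colour) \<Rightarrow> 'a set \<Rightarrow> game" where
  "pos E c S = placement_position \<lparr>pverts = {}, parcs = E\<rparr> c (Abs_fset S)"

lemma remaining_subset: "remaining E S v \<subseteq> S"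
  by (auto simp: remaining_def)

lemma finite_remaining [simp]: "finite S \<Longrightarrow> finite (remaining E S v)"
  using remaining_subset finite_subset by metis

lemma card_remaining_less: "finite S \<Longrightarrow> v \<in> S \<Longrightarrow> card (remaining E S v) < card S"
  by (rule psubset_card_mono) (auto simp: remaining_def)

lemma placement_position_eq_pos:
  "placement_position D c S = pos (parcs D) c (fset S)"
proof (induction D c S rule: placement_position.induct)
  case (1 D c S)
  let ?D = "\<lparr>pverts = {}, parcs = parcs D\<rparr>"
  have del: "after_deletion ?D S v = after_deletion D S v" for v
    by (simp add: after_deletion_def)
  have *: "placement_position D c (after_deletion D S v) = placement_position ?D c (after_deletion D S v)"
    if "v |\<in>| S" for v
    using 1[of v] that by (cases "c v") (auto simp: pos_def fset_inverse)
  show ?case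
    unfolding pos_def fset_inverse
    by (subst (1 2) placement_position.simps) (auto simp: del * intro!: fimage_fundef_cong)
qed

lemma fset_after_deletion: "fset (after_deletion D S v) = remaining (parcs D) (fset S) v"
  by (auto simp: after_deletion_def remaining_def)

lemma left_opts_pos: "finite S \<Longrightarrow>
    H |\<in>| left_opts (pos E c S) \<longleftrightarrow> (\<exists>v\<in>S. c v = Blue \<and> H = pos E c (remaining E S v))"
  and right_opts_pos: "finite S \<Longrightarrow>
    H |\<in>| right_opts (pos E c S) \<longleftrightarrow> (\<exists>v\<in>S. c v = Red \<and> H = pos E c (remaining E S v))"
  by (subst pos_def, subst placement_position.simps,
      force simp: placement_position_eq_pos fset_after_deletion Abs_fset_inverse)+

lemma pos_left_option: "finite S \<Longrightarrow> v \<in> S \<Longrightarrow> c v = Blue \<Longrightarrow> pos E c (remaining E S v) |\<in>| left_opts (pos E c S)"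
  and pos_right_option: "finite S \<Longrightarrow> v \<in> S \<Longrightarrow> c v = Red \<Longrightarrow> pos E c (remaining E S v) |\<in>| right_opts (pos E c S)"
  by (auto simp: left_opts_pos right_opts_pos)

lemma digraph_placement_eq_pos:
  "finite (pverts D) \<Longrightarrow> digraph_placement D c = pos (parcs D) c (pverts D)"
  by (simp add: digraph_placement_def placement_position_eq_pos Abs_fset_inverse)

text \<open>Arcs are compared between distinct vertices only, since a chosen vertex disappears
  anyway. This freedom later allows loops in the relation, and even colours stored on its
  diagonal.\<close>

lemma pos_map:
  assumes "finite S" "inj_on f S"
    and "\<And>v. v \<in> S \<Longrightarrow> c' (f v) = c v"
    and "\<And>v w. v \<in> S \<Longrightarrow> w \<in> S \<Longrightarrow> v \<noteq> w \<Longrightarrow> (f v, f w) \<in> E' \<longleftrightarrow> (v, w) \<in> E"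
  shows "pos E' c' (f ` S) = pos E c S"
  using assms
proof (induction "card S" arbitrary: S rule: less_induct)
  case less
  have rem: "remaining E' (f ` S) (f v) = f ` remaining E S v" if "v \<in> S" for v
    using less.prems that by (auto simp: remaining_def inj_on_eq_iff)
  have IH: "pos E' c' (remaining E' (f ` S) (f v)) = pos E c (remaining E S v)" if "v \<in> S" for v
    unfolding rem[OF that]
    by (rule less.hyps[OF card_remaining_less[OF \<open>finite S\<close> that]])
      (use less.prems remaining_subset[of E S v] in \<open>auto intro: inj_on_subset\<close>)
  have "left_opts (pos E' c' (f ` S)) = left_opts (pos E c S)"
    by (rule fset_eqI) (use less.prems IH in \<open>auto simp: left_opts_pos\<close>)
  moreover have "right_opts (pos E' c' (f ` S)) = right_opts (pos E c S)"
    by (rule fset_eqI) (use less.prems IH in \<open>auto simp: right_opts_pos\<close>)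
  ultimately show ?case by (rule game.expand[OF conjI])
qed

lemma pos_cong:
  assumes "finite S" "\<And>v. v \<in> S \<Longrightarrow> c' v = c v"
    and "\<And>v w. v \<in> S \<Longrightarrow> w \<in> S \<Longrightarrow> v \<noteq> w \<Longrightarrow> (v, w) \<in> E' \<longleftrightarrow> (v, w) \<in> E"
  shows "pos E' c' S = pos E c S"
  using pos_map[of S id c' c E' E] assms by simp

section \<open>Colour classes of a position\<close>

definition blues :: "('a \<Rightarrow> colour) \<Rightarrow> 'a set \<Rightarrow> 'a set" where
  "blues c S = {v \<in> S. c v = Blue}"

definition reds :: "('a \<Rightarrow> colour) \<Rightarrow> 'a set \<Rightarrow> 'a set" where
  "reds c S = {v \<in> S. c v = Red}"

lemma finite_blues [simp]: "finite S \<Longrightarrow> finite (blues c S)"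
  and finite_reds [simp]: "finite S \<Longrightarrow> finite (reds c S)"
  by (simp_all add: blues_def reds_def)

lemma card_blues_reds: "finite S \<Longrightarrow> card (blues c S) + card (reds c S) = card S"
proof -
  assume "finite S"
  moreover have "blues c S \<union> reds c S = S" using colour.exhaust by (auto simp: blues_def reds_def)
  moreover have "blues c S \<inter> reds c S = {}" by (auto simp: blues_def reds_def)
  ultimately show ?thesis by (metis card_Un_disjoint finite_Un)
qed

lemma card_blues_remaining: "finite S \<Longrightarrow> v \<in> S \<Longrightarrow> c v = Blue \<Longrightarrow> card (blues c (remaining E S v)) < card (blues c S)"
  and card_reds_remaining: "finite S \<Longrightarrow> v \<in> S \<Longrightarrow> c v = Red \<Longrightarrow> card (reds c (remaining E S v)) < card (reds c S)"
  by (rule psubset_card_mono; auto simp: remaining_def blues_def reds_def)+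

lemma blues_remaining_subset: "blues c (remaining E S v) \<subseteq> blues c S"
  and reds_remaining_subset: "reds c (remaining E S v) \<subseteq> reds c S"
  by (auto simp: remaining_def blues_def reds_def)

text \<open>A vertex chosen in both positions deletes the same vertices, so the inclusions persist;
  extra blue vertices offer only Left, and extra red ones only Right, further choices.\<close>

lemma pos_mono:
  assumes "finite S" "finite T" "blues c S \<subseteq> blues c T" "reds c T \<subseteq> reds c S"
  shows "pos E c S \<preceq> pos E c T"
  using assms
proof (induction "card S + card T" arbitrary: S T rule: less_induct)
  case less
  show ?case
  proof (rule game_leI)
    fix G assume "G |\<in>| left_opts (pos E c S)"
    then obtain v where v: "v \<in> S" "c v = Blue" "G = pos E c (remaining E S v)"
      using less.prems by (auto simp: left_opts_pos)
    then have vT: "v \<in> T" using less.prems by (auto simp: blues_def)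
    have "pos E c (remaining E S v) \<preceq> pos E c (remaining E T v)"
      using less.prems card_remaining_less[of S v E] card_remaining_less[of T v E] v vT
      by (intro less.hyps) (auto simp: blues_def reds_def remaining_def)
    then show "\<not> pos E c T \<preceq> G"
      using pos_left_option[of T v c E] less.prems vT v left_option_not_ge game_le_trans by blast
  next
    fix H assume "H |\<in>| right_opts (pos E c T)"
    then obtain v where v: "v \<in> T" "c v = Red" "H = pos E c (remaining E T v)"
      using less.prems by (auto simp: right_opts_pos)
    then have vS: "v \<in> S" using less.prems by (auto simp: reds_def)
    have "pos E c (remaining E S v) \<preceq> pos E c (remaining E T v)"
      using less.prems card_remaining_less[of S v E] card_remaining_less[of T v E] v vS
      by (intro less.hyps) (auto simp: blues_def reds_def remaining_def)
    then show "\<not> H \<preceq> pos E c S"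
      using pos_right_option[of S v c E] less.prems vS v right_option_not_le game_le_trans by blast
  qed
qed

section \<open>Comparison with integers\<close>

fun pos_int neg_int :: "nat \<Rightarrow> game" where
  "pos_int 0 = Game {||} {||}"
| "pos_int (Suc n) = Game {|pos_int n|} {||}"
| "neg_int 0 = Game {||} {||}"
| "neg_int (Suc n) = Game {||} {|neg_int n|}"

lemma right_opts_pos_int [simp]: "right_opts (pos_int n) = {||}"
  and left_opts_neg_int [simp]: "left_opts (neg_int n) = {||}"
  by (cases n; simp)+

lemma birthday_pos_int: "birthday (pos_int n) \<le> n" and birthday_neg_int: "birthday (neg_int n) \<le> n"
  by (induction n) (auto simp: birthday_le_Suc_iff birthday_le_0_iff[simplified])

text \<open>In the difference Left has n free moves, and G offers Right at most n.\<close>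

lemma neg_int_le: "birthday G \<le> n \<Longrightarrow> neg_int n \<preceq> G"
proof (induction n arbitrary: G)
  case 0
  then show ?case by (intro game_leI) (auto simp: birthday_le_0_iff[simplified])
next
  case (Suc n)
  show ?case
  proof (rule game_leI)
    fix H assume "H |\<in>| right_opts G"
    then have "neg_int n \<preceq> H" using Suc birthday_right_option by blast
    then show "\<not> H \<preceq> neg_int (Suc n)" using game_le_right by fastforce
  qed simp
qed

lemma le_pos_int: "birthday G \<le> n \<Longrightarrow> G \<preceq> pos_int n"
proof (induction n arbitrary: G)
  case 0
  then show ?case by (intro game_leI) (auto simp: birthday_le_0_iff[simplified])
next
  case (Suc n)
  show ?case
  proof (rule game_leI)
    fix H assume "H |\<in>| left_opts G"
    then have "H \<preceq> pos_int n" using Suc birthday_left_option by blast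
    then show "\<not> pos_int (Suc n) \<preceq> H" using game_le_left by fastforce
  qed simp
qed

text \<open>As \<open>pos_int\<close> has no right options, each descent to the next smaller integer
  must be witnessed by a move of Left, and this spends a blue vertex.\<close>

lemma pos_int_le_pos: "finite S \<Longrightarrow> pos_int n \<preceq> pos E c S \<Longrightarrow> n \<le> card (blues c S)"
proof (induction n arbitrary: S)
  case (Suc n)
  then have "\<not> pos E c S \<preceq> pos_int n" using game_le_left by fastforce
  then show ?case
  proof (cases rule: not_game_leE)
    case (1 G)
    then obtain v where "v \<in> S" "c v = Blue" "G = pos E c (remaining E S v)"
      using Suc.prems by (auto simp: left_opts_pos)
    then show ?thesis
      using Suc.IH[of "remaining E S v"] 1 Suc.prems(1) card_blues_remaining[of S v c E] by simp
  qed simp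
qed simp

lemma pos_le_neg_int: "finite S \<Longrightarrow> pos E c S \<preceq> neg_int n \<Longrightarrow> n \<le> card (reds c S)"
proof (induction n arbitrary: S)
  case (Suc n)
  then have "\<not> neg_int n \<preceq> pos E c S" using game_le_right by fastforce
  then show ?case
  proof (cases rule: not_game_leE)
    case (2 G)
    then obtain v where "v \<in> S" "c v = Red" "G = pos E c (remaining E S v)"
      using Suc.prems by (auto simp: right_opts_pos)
    then show ?thesis
      using Suc.IH[of "remaining E S v"] 2 Suc.prems(1) card_reds_remaining[of S v c E] by simp
  qed simp
qed simp

lemma pos_independent_reds_le:
  assumes "finite S" "\<And>v. v \<in> S \<Longrightarrow> c v = Red" "\<And>v w. v \<in> S \<Longrightarrow> w \<in> S \<Longrightarrow> (v, w) \<notin> E" "n \<le> card S"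
  shows "pos E c S \<preceq> neg_int n"
  using assms
proof (induction n arbitrary: S)
  case 0
  show ?case by (rule game_leI) (use 0 in \<open>auto simp: left_opts_pos\<close>)
next
  case (Suc n)
  then obtain v where v: "v \<in> S" by fastforce
  have "remaining E S v = S - {v}" using Suc.prems v by (auto simp: remaining_def)
  then have "pos E c (remaining E S v) \<preceq> neg_int n" using Suc v by (intro Suc.IH) auto
  then have "\<not> neg_int n \<preceq> pos E c S"
    using game_le_right pos_right_option[of S v c E] Suc.prems v by blast
  then show ?case by (intro game_leI) (use Suc.prems in \<open>auto simp: left_opts_pos\<close>)
qed

lemma pos_independent_blues_ge:
  assumes "finite S" "\<And>v. v \<in> S \<Longrightarrow> c v = Blue" "\<And>v w. v \<in> S \<Longrightarrow> w \<in> S \<Longrightarrow> (v, w) \<notin> E" "n \<le> card S"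
  shows "pos_int n \<preceq> pos E c S"
  using assms
proof (induction n arbitrary: S)
  case 0
  show ?case by (rule game_leI) (use 0 in \<open>auto simp: right_opts_pos\<close>)
next
  case (Suc n)
  then obtain v where v: "v \<in> S" by fastforce
  have "remaining E S v = S - {v}" using Suc.prems v by (auto simp: remaining_def)
  then have "pos_int n \<preceq> pos E c (remaining E S v)" using Suc v by (intro Suc.IH) auto
  then have "\<not> pos E c S \<preceq> pos_int n"
    using game_le_left pos_left_option[of S v c E] Suc.prems v by blast
  then show ?case by (intro game_leI) (use Suc.prems in \<open>auto simp: right_opts_pos\<close>)
qed

text \<open>Loops and arcs outside S are tolerated here, which spares all constructions the side
  conditions of \<open>pair_digraph\<close>; \<open>placement_f_eq\<close> restores them.\<close>

definition realized_by :: "game \<Rightarrow> nat \<Rightarrow> bool" where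
  "realized_by G n \<longleftrightarrow> (\<exists>(E :: (nat \<times> nat) set) c S. finite S \<and> card S = n \<and> pos E c S \<approx> G)"

lemma realized_byI:
  fixes S :: "'a set"
  assumes "finite S" "pos E c S \<approx> G"
  shows "realized_by G (card S)"
proof -
  obtain f :: "'a \<Rightarrow> nat" where f: "inj_on f S" using finite_imp_inj_to_nat_seg[OF assms(1)] by auto
  let ?g = "inv_into S f"
  have "pos ((\<lambda>(v, w). (f v, f w)) ` (E \<inter> S \<times> S)) (c \<circ> ?g) (f ` S) = pos E c S"
    by (rule pos_map) (use assms f in \<open>auto simp: inj_on_eq_iff\<close>)
  then show ?thesis
    unfolding realized_by_def using assms card_image[OF f]
    by (intro exI[of _ "(\<lambda>(v, w). (f v, f w)) ` (E \<inter> S \<times> S)"] exI[of _ "c \<circ> ?g"] exI[of _ "f ` S"]) simp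
qed

lemma placement_f_eq: "placement_f (value_of G) = (LEAST n. realized_by G n)"
proof -
  have "(\<exists>(D :: nat pair_pre_digraph) c. pair_digraph D \<and> card (pverts D) = n \<and> value_of (digraph_placement D c) = value_of G)
      \<longleftrightarrow> realized_by G n" for n
  proof
    assume "\<exists>(D :: nat pair_pre_digraph) c. pair_digraph D \<and> card (pverts D) = n \<and> value_of (digraph_placement D c) = value_of G"
    then obtain D :: "nat pair_pre_digraph" and c
      where D: "pair_digraph D" "card (pverts D) = n" "value_of (digraph_placement D c) = value_of G"
      by blast
    then have "finite (pverts D)" by (simp add: pair_digraph_def pair_fin_digraph_def pair_fin_digraph_axioms_def)
    then show "realized_by G n"
      using D unfolding realized_by_def by (metis digraph_placement_eq_pos value_of_eq_iff)
  next
    assume "realized_by G n"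
    then obtain E :: "(nat \<times> nat) set" and c S where S: "finite S" "card S = n" "pos E c S \<approx> G"
      unfolding realized_by_def by blast
    \<comment> \<open>A proper digraph needs arcs between its own vertices and no loops; neither
      restriction changes the position.\<close>
    let ?A = "{(v, w). (v, w) \<in> E \<and> v \<in> S \<and> w \<in> S \<and> v \<noteq> w}"
    let ?D = "\<lparr>pverts = S, parcs = ?A\<rparr>"
    have "finite ?A" by (rule finite_subset[of _ "S \<times> S"]) (use S in auto)
    then have "pair_digraph ?D"
      using S by unfold_locales auto
    moreover have "digraph_placement ?D c = pos E c S"
      using S by (auto simp: digraph_placement_eq_pos intro!: pos_cong)
    ultimately show "\<exists>(D :: nat pair_pre_digraph) c. pair_digraph D \<and> card (pverts D) = n \<and> value_of (digraph_placement D c) = value_of G"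
      using S by (intro exI[of _ ?D] exI[of _ c]) (simp add: value_of_eq_iff)
  qed
  then show ?thesis by (simp add: placement_f_def)
qed

lemma placement_F_le:
  assumes "\<And>G. birthday G \<le> b \<Longrightarrow> \<exists>n \<le> N. realized_by G n"
  shows "placement_F b \<le> N"
proof -
  have "placement_f X \<le> N" if X: "X \<in> values_born_by b" for X
  proof -
    obtain G where G: "X = value_of G" "birthday G \<le> b" using X by (auto simp: values_born_by_def)
    then obtain n where "n \<le> N" "realized_by G n" using assms by blast
    then show ?thesis using G Least_le[of "realized_by G" n] by (simp add: placement_f_eq)
  qed
  moreover have "value_of (Game {||} {||}) \<in> values_born_by b"
    unfolding values_born_by_def
    using birthday_le_0_iff[of "Game {||} {||}"] by (intro CollectI exI[of _ "Game {||} {||}"]) simp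
  ultimately show ?thesis
    unfolding placement_F_def using finite_values_born_by by (subst Max_le_iff) auto
qed

text \<open>A realization of some size has to be given, because \<open>LEAST\<close> is unspecified
  for an empty predicate.\<close>

lemma placement_F_ge:
  assumes "birthday G \<le> b" "realized_by G m" "\<And>n. realized_by G n \<Longrightarrow> N \<le> n"
  shows "N \<le> placement_F b"
proof -
  have "N \<le> placement_f (value_of G)"
    unfolding placement_f_eq using assms(2,3) LeastI by metis
  also have "\<dots> \<le> placement_F b"
    unfolding placement_F_def using assms(1) finite_values_born_by
    by (intro Max_ge) (auto simp: values_born_by_def)
  finally show ?thesis .
qed

text \<open>Left needs a blue move to a position worth at least k, hence k + 1 blue vertices. Right
  symmetrically needs k + 1 red ones, and the two counts add up.\<close>

lemma realized_by_switch_ge: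
  assumes "realized_by (Game {|pos_int k|} {|neg_int k|}) n"
  shows "2 * Suc k \<le> n"
proof -
  obtain E :: "(nat \<times> nat) set" and c S
    where S: "finite S" "card S = n" "pos E c S \<approx> Game {|pos_int k|} {|neg_int k|}" (is "_ \<approx> ?G")
    using assms unfolding realized_by_def by blast
  have "\<not> pos E c S \<preceq> pos_int k"
    using game_le_left[OF game_equiv_ge[OF S(3)], of "pos_int k"] by simp
  then obtain v where "v \<in> S" "c v = Blue" "pos_int k \<preceq> pos E c (remaining E S v)"
    by (rule not_game_leE) (use S(1) in \<open>auto simp: left_opts_pos\<close>)
  then have "k < card (blues c S)"
    using pos_int_le_pos[of "remaining E S v" k E c] card_blues_remaining[of S v c E] S(1) by simp
  moreover have "\<not> neg_int k \<preceq> pos E c S"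
    using game_le_right[OF game_equiv_le[OF S(3)], of "neg_int k"] by simp
  then obtain w where "w \<in> S" "c w = Red" "pos E c (remaining E S w) \<preceq> neg_int k"
    by (rule not_game_leE) (use S(1) in \<open>auto simp: right_opts_pos\<close>)
  then have "k < card (reds c S)"
    using pos_le_neg_int[of "remaining E S w" E c k] card_reds_remaining[of S w c E] S(1) by simp
  ultimately show ?thesis using card_blues_reds[OF S(1), of c] S(2) by simp
qed

section \<open>Hot games with many left options\<close>

text \<open>A right option \<open>neg_int n\<close> is such a threat that no left option of birthday at most \<open>n\<close> is reversible.\<close>

locale hot_game =
  fixes n :: nat and A :: "game fset"
  assumes birthday_A: "\<And>a. a |\<in>| A \<Longrightarrow> birthday a \<le> n"
begin

definition hot :: game where "hot = Game A {|neg_int n|}"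

lemma left_opts_hot [simp]: "left_opts hot = A" and right_opts_hot [simp]: "right_opts hot = {|neg_int n|}"
  by (simp_all add: hot_def)

lemma birthday_hot: "birthday hot \<le> Suc n"
  using birthday_A birthday_neg_int by (auto simp: birthday_le_Suc_iff)

lemma not_le_hot: "birthday x \<le> n \<Longrightarrow> \<not> x \<preceq> hot"
  using neg_int_le game_le_right by fastforce

lemma not_hot_le_iff:
  assumes "birthday x \<le> n"
  shows "\<not> hot \<preceq> x \<longleftrightarrow> (\<exists>a |\<in>| A. x \<preceq> a)"
proof
  assume "\<not> hot \<preceq> x"
  then show "\<exists>a |\<in>| A. x \<preceq> a"
  proof (cases rule: not_game_leE)
    \<comment> \<open>A right option of x is also born by day n and so never lies below
      \<open>hot\<close>; only domination by a left option remains.\<close>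
    case (2 y)
    then show ?thesis using birthday_option_less[of y x n] assms not_le_hot[of y] by auto
  qed auto
next
  assume "\<exists>a |\<in>| A. x \<preceq> a"
  then show "\<not> hot \<preceq> x" using left_option_not_ge[of _ hot] game_le_trans by auto
qed

end

text \<open>Bounds how many elements of A Left can reach from a position below \<open>hot\<close>
  with b blue and r red vertices. Each of her b moves either settles a single element, whence the 1,
  or is answered by a return below \<open>hot\<close> with at least two fewer vertices of each
  colour. With fewer than four vertices of some colour nothing is reachable.\<close>

fun leaf_bound :: "nat \<Rightarrow> nat \<Rightarrow> nat" where
  "leaf_bound b r = (if b < 4 \<or> r < 4 then 0 else b * max 1 (leaf_bound (b - 2) (r - 2)))"

declare leaf_bound.simps [simp del]

lemma leaf_bound_mono: "b \<le> b' \<Longrightarrow> r \<le> r' \<Longrightarrow> leaf_bound b r \<le> leaf_bound b' r'"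
proof (induction b r arbitrary: b' r' rule: leaf_bound.induct)
  case (1 b r)
  show ?case
  proof (cases "b < 4 \<or> r < 4")
    case False
    then have "leaf_bound (b - 2) (r - 2) \<le> leaf_bound (b' - 2) (r' - 2)"
      using 1 by (intro "1.IH") auto
    then show ?thesis
      using False "1.prems"
      by (subst (1 2) leaf_bound.simps) (auto intro!: mult_le_mono)
  qed (simp add: leaf_bound.simps[of b r])
qed

text \<open>Monotonicity reduces this to b + r = 15. The maximum 63 = 9 * 7 occurs at nine blue and
  six red vertices, where two rounds are possible.\<close>

lemma leaf_bound_le_63:
  assumes "b + r \<le> 15"
  shows "leaf_bound b r \<le> 63"
proof -
  have "b < 4 \<or> b \<in> {4, 5, 6, 7, 8, 9, 10, 11} \<or> 15 - b < 4" by auto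
  then have "leaf_bound b (15 - b) \<le> 63"
    by (elim disjE insertE emptyE) (simp_all add: leaf_bound.simps)
  moreover have "leaf_bound b r \<le> leaf_bound b (15 - b)"
    using assms by (intro leaf_bound_mono) auto
  ultimately show ?thesis by simp
qed

locale hot_antichain = hot_game 3 A for A +
  assumes antichain: "\<And>a a'. a |\<in>| A \<Longrightarrow> a' |\<in>| A \<Longrightarrow> a \<preceq> a' \<Longrightarrow> a = a'"
begin

context
  fixes E :: "('v \<times> 'v) set" and c :: "'v \<Rightarrow> colour"
  assumes three_blues: "\<And>a T. a |\<in>| A \<Longrightarrow> finite T \<Longrightarrow> pos E c T \<approx> a \<Longrightarrow> 3 \<le> card (blues c T)"
begin

definition below :: "'v set \<Rightarrow> game set" where
  "below S = {a. a |\<in>| A \<and> a \<preceq> pos E c S}"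

definition covered :: "'v set \<Rightarrow> game set" where
  "covered S = (\<Union>v \<in> blues c S. below (remaining E S v))"

lemma finite_below [simp]: "finite (below S)"
  by (rule finite_subset[of _ "fset A"]) (auto simp: below_def)

text \<open>\<open>hot\<close> threatens -3, so a position below it must offer Right a move to at
  most -3, and that position still contains three red vertices.\<close>

lemma four_reds:
  assumes "finite S" "pos E c S \<preceq> hot"
  shows "4 \<le> card (reds c S)"
proof -
  have "\<not> neg_int 3 \<preceq> pos E c S" using game_le_right[OF assms(2)] by simp
  then obtain w where "w \<in> S" "c w = Red" "pos E c (remaining E S w) \<preceq> neg_int 3"
    by (rule not_game_leE) (use assms(1) in \<open>auto simp: right_opts_pos\<close>)
  then show ?thesis
    using pos_le_neg_int[of "remaining E S w" E c 3] card_reds_remaining[of S w c E] assms(1) by simp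
qed

text \<open>After Right's reply from T to S, a comparison with an element \<open>a\<close> below T
  survives only through a move of Left in S. The alternative, a right option of \<open>a\<close>
  below S, is barred: nothing born by day 3 lies below \<open>hot\<close>.\<close>

lemma below_subset_covered:
  assumes "finite S" "finite T" "pos E c S |\<in>| right_opts (pos E c T)" "pos E c S \<preceq> hot"
  shows "below T \<subseteq> covered S"
proof
  fix a assume a: "a \<in> below T"
  then have "\<not> pos E c S \<preceq> a"
    using assms(3) game_le_right by (auto simp: below_def)
  then show "a \<in> covered S"
  proof (cases rule: not_game_leE)
    case (1 G)
    then show ?thesis
      using a assms(1) by (auto simp: left_opts_pos covered_def blues_def below_def)
  next
    case (2 x)
    then have "x \<preceq> hot" using assms(4) game_le_trans by blast
    moreover have "birthday x \<le> 3"
      using birthday_option_less[of x a 3] 2 a birthday_A by (auto simp: below_def)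
    ultimately show ?thesis using not_le_hot by blast
  qed
qed

text \<open>As \<open>a \<preceq> hot\<close> fails, a move to a position above \<open>a\<close> must delete a red vertex, and a reply
  that brings the position below \<open>hot\<close> again must delete a blue one.\<close>

lemma card_covered_le:
  assumes "finite S" "pos E c S \<preceq> hot"
  shows "card (covered S) \<le> leaf_bound (card (blues c S)) (card (reds c S))"
  using assms
proof (induction "card S" arbitrary: S rule: less_induct)
  case less
  let ?b = "card (blues c S)" and ?r = "card (reds c S)"
  have r4: "4 \<le> ?r" using four_reds less.prems by blast
  have step: "card (below (remaining E S v)) \<le> max 1 (leaf_bound (?b - 2) (?r - 2)) \<and> 4 \<le> ?b"
    if v: "v \<in> blues c S" and ne: "below (remaining E S v) \<noteq> {}" for v
  proof -
    let ?T = "remaining E S v"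
    have vS: "v \<in> S" "c v = Blue" using v by (auto simp: blues_def)
    have finT: "finite ?T" using less.prems by simp
    obtain a where a: "a |\<in>| A" "a \<preceq> pos E c ?T" using ne by (auto simp: below_def)
    have not_le: "\<not> pos E c ?T \<preceq> pos E c S" "\<not> pos E c ?T \<preceq> hot"
      using a not_le_hot[of a] birthday_A game_le_trans less.prems by blast+
    have bT: "card (blues c ?T) < ?b" by (rule card_blues_remaining) (use less.prems vS in auto)
    have "\<not> reds c S \<subseteq> reds c ?T"
    proof
      assume "reds c S \<subseteq> reds c ?T"
      then have "pos E c ?T \<preceq> pos E c S"
        using less.prems by (intro pos_mono) (simp_all add: blues_remaining_subset)
      then show False using not_le by blast
    qed
    then have rT: "card (reds c ?T) < ?r"
      using less.prems reds_remaining_subset[of c E S v] by (intro psubset_card_mono) auto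
    \<comment> \<open>S is below \<open>hot\<close>, so no move of Left reaches a position above
      \<open>hot\<close>. Hence ?T lies below an element of A, or Right has a reply below
      \<open>hot\<close>.\<close>
    have "\<not> hot \<preceq> pos E c ?T"
      using game_le_left[OF less.prems(2) pos_left_option] less.prems vS by blast
    then show ?thesis
    proof (cases rule: not_game_leE)
      \<comment> \<open>Everything of A below ?T is now also below a', so by the antichain property
        a' is the only such element and equals ?T. This branch ends with one element.\<close>
      case (1 a')
      then have single: "a'' = a'" if "a'' \<in> below ?T" for a''
        using that antichain game_le_trans by (fastforce simp: below_def)
      then have "a = a'" using a by (auto simp: below_def)
      then have "pos E c ?T \<approx> a" using 1 a by (auto intro: game_equivI)
      then have "3 \<le> card (blues c ?T)" using three_blues a finT by blast
      moreover have "card (below ?T) \<le> card {a'}" by (rule card_mono) (use single in auto)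
      ultimately show ?thesis using bT by simp
    next
      case (2 H)
      then obtain w where w: "w \<in> ?T" "c w = Red" "pos E c (remaining E ?T w) \<preceq> hot"
        using finT by (auto simp: right_opts_pos)
      let ?U = "remaining E ?T w"
      have "\<not> blues c ?T \<subseteq> blues c ?U"
      proof
        assume "blues c ?T \<subseteq> blues c ?U"
        then have "pos E c ?T \<preceq> pos E c ?U"
          using finT by (intro pos_mono) (simp_all add: reds_remaining_subset)
        then show False using not_le w game_le_trans by blast
      qed
      then have bU: "card (blues c ?U) < card (blues c ?T)"
        using finT blues_remaining_subset[of c E ?T w] by (intro psubset_card_mono) auto
      have rU: "card (reds c ?U) < card (reds c ?T)"
        by (rule card_reds_remaining) (use finT w in auto)
      have finU: "finite ?U" using finT by simp
      have "below ?T \<subseteq> covered ?U"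
        using finT finU w pos_right_option[of ?T w c E] by (intro below_subset_covered) auto
      moreover have "finite (covered ?U)" using finU by (simp add: covered_def)
      ultimately have "card (below ?T) \<le> card (covered ?U)" by (rule card_mono[rotated])
      also have "\<dots> \<le> leaf_bound (card (blues c ?U)) (card (reds c ?U))"
        using card_remaining_less[of S v E] card_remaining_less[of ?T w E] finT finU w vS less.prems
        by (intro less.hyps) auto
      finally have *: "card (below ?T) \<le> leaf_bound (card (blues c ?U)) (card (reds c ?U))" .
      have "card (below ?T) > 0" using ne by (simp add: card_gt_0_iff)
      then have "4 \<le> card (blues c ?U)"
        using * by (subst (asm) leaf_bound.simps) (auto split: if_splits)
      \<comment> \<open>The move and the reply each spend their own vertex and one of the other
        colour, so both counts drop by two.\<close>
      moreover have "leaf_bound (card (blues c ?U)) (card (reds c ?U)) \<le> leaf_bound (?b - 2) (?r - 2)"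
        using bT bU rT rU by (intro leaf_bound_mono) auto
      ultimately show ?thesis using * bT bU by simp
    qed
  qed
  show ?case
  proof (cases "covered S = {}")
    case False
    then have b4: "4 \<le> ?b" using step by (auto simp: covered_def)
    have "card (covered S) \<le> (\<Sum>v \<in> blues c S. card (below (remaining E S v)))"
      unfolding covered_def using less.prems by (intro card_UN_le) simp
    also have "\<dots> \<le> (\<Sum>v \<in> blues c S. max 1 (leaf_bound (?b - 2) (?r - 2)))"
      using step by (intro sum_mono) (metis card.empty zero_le)
    also have "\<dots> = leaf_bound ?b ?r"
      using b4 r4 by (simp add: leaf_bound.simps[of ?b ?r])
    finally show ?thesis .
  qed simp
qed

lemma card_le_if_equiv_hot:
  assumes "finite S" "card S \<le> 15" "pos E c S \<approx> hot"
  shows "fcard A \<le> 63"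
proof -
  \<comment> \<open>A left option of \<open>hot\<close> cannot be reversed, so the digraph has to
    match it by a blue move.\<close>
  have "a \<in> covered S" if a: "a |\<in>| A" for a
  proof -
    have "\<not> pos E c S \<preceq> a"
      using a game_le_left[OF game_equiv_ge[OF assms(3)]] by simp
    then show ?thesis
    proof (cases rule: not_game_leE)
      case (1 G)
      then show ?thesis using a assms by (auto simp: left_opts_pos covered_def blues_def below_def)
    next
      case (2 x)
      then have "x \<preceq> hot" using assms(3) game_le_trans game_equiv_le by blast
      then show ?thesis
        using birthday_option_less[of x a 3] 2 a birthday_A not_le_hot by auto
    qed
  qed
  then have "card (fset A) \<le> card (covered S)"
    using assms by (intro card_mono) (auto simp: covered_def)
  also have "\<dots> \<le> 63"
    using card_covered_le[OF assms(1) game_equiv_le[OF assms(3)]]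
      leaf_bound_le_63[of "card (blues c S)" "card (reds c S)"] card_blues_reds[OF assms(1), of c] assms(2)
    by simp
  finally show ?thesis by (simp add: fcard.rep_eq)
qed

end

end

section \<open>Selectors and the gadget\<close>

text \<open>One layer around a pool of old vertices: selectors for both players, and four gadget
  groups named by colour and a flag. Iterating the type nests the layers.\<close>

datatype 'a ext = Old 'a | Sel colour nat | Gad colour bool nat

fun ext_colour :: "('a \<Rightarrow> colour) \<Rightarrow> 'a ext \<Rightarrow> colour" where
  "ext_colour c (Old v) = c v"
| "ext_colour c (Sel p i) = p"
| "ext_colour c (Gad p b k) = p"

text \<open>A gadget vertex spares only its own group and the group that refutes it. The catch-all
  clause makes selectors remove all selectors and gadgets, and gadgets remove all old vertices and
  selectors.\<close>

fun deletes :: "('a \<times> 'a) set \<Rightarrow> ('a \<Rightarrow> colour) \<Rightarrow> (colour \<Rightarrow> nat \<Rightarrow> 'a set) \<Rightarrow> 'a ext \<Rightarrow> 'a ext \<Rightarrow> bool" where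
  "deletes E c tg (Old v) (Old w) \<longleftrightarrow> (v, w) \<in> E"
| "deletes E c tg (Old v) (Sel p i) \<longleftrightarrow> False"
| "deletes E c tg (Old v) (Gad p b k) \<longleftrightarrow> p = c v \<and> b = (p = Blue)"
| "deletes E c tg (Sel p i) (Old v) \<longleftrightarrow> v \<notin> tg p i"
| "deletes E c tg (Gad p b k) (Gad p' b' k') \<longleftrightarrow> (b = b') = (p = Red \<and> p' = Blue)"
| "deletes E c tg _ _ \<longleftrightarrow> True"

definition ext_arcs :: "('a \<times> 'a) set \<Rightarrow> ('a \<Rightarrow> colour) \<Rightarrow> (colour \<Rightarrow> nat \<Rightarrow> 'a set) \<Rightarrow> ('a ext \<times> 'a ext) set" where
  "ext_arcs E c tg = {(x, y). deletes E c tg x y}"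

lemma UNIV_colour: "UNIV = {Blue, Red}"
  using colour.exhaust by blast

lemma not_Blue_iff: "p \<noteq> Blue \<longleftrightarrow> p = Red" and not_Red_iff: "p \<noteq> Red \<longleftrightarrow> p = Blue"
  by (cases p; simp)+

definition gadgets :: "nat \<Rightarrow> 'a ext set" where
  "gadgets k = (\<lambda>(p, b, i). Gad p b i) ` (UNIV \<times> UNIV \<times> {..<k})"

definition ext_set :: "'a set \<Rightarrow> nat set \<Rightarrow> nat set \<Rightarrow> nat \<Rightarrow> 'a ext set" where
  "ext_set T I J k = Old ` T \<union> Sel Blue ` I \<union> Sel Red ` J \<union> gadgets k"

lemma in_gadgets_iff: "x \<in> gadgets k \<longleftrightarrow> (\<exists>p b i. x = Gad p b i \<and> i < k)"
  by (force simp: gadgets_def)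

lemma in_ext_set_iff [simp]:
  "Old v \<in> ext_set T I J k \<longleftrightarrow> v \<in> T"
  "Sel p i \<in> ext_set T I J k \<longleftrightarrow> i \<in> (case p of Blue \<Rightarrow> I | Red \<Rightarrow> J)"
  "Gad p b i \<in> ext_set T I J k \<longleftrightarrow> i < k"
  by (auto simp: ext_set_def in_gadgets_iff split: colour.splits)

lemma finite_ext_set: "finite T \<Longrightarrow> finite I \<Longrightarrow> finite J \<Longrightarrow> finite (ext_set T I J k)"
  by (simp add: ext_set_def gadgets_def UNIV_colour)

lemma card_ext_set_le:
  assumes "finite T" "finite I" "finite J"
  shows "card (ext_set T I J k) \<le> card T + card I + card J + 4 * k"
proof -
  have "card (gadgets k :: 'a ext set) \<le> card ((UNIV :: colour set) \<times> (UNIV :: bool set) \<times> {..<k})"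
    unfolding gadgets_def by (rule card_image_le) (simp add: UNIV_colour)
  also have "\<dots> = 4 * k" by (simp add: card_cartesian_product UNIV_colour)
  finally have "card (gadgets k :: 'a ext set) \<le> 4 * k" .
  moreover have "card (ext_set T I J k) \<le> card (Old ` T) + card (Sel Blue ` I :: 'a ext set) + card (Sel Red ` J :: 'a ext set) + card (gadgets k :: 'a ext set)"
    unfolding ext_set_def by (intro order_trans[OF card_Un_le] add_mono order_refl)
  moreover have "card (Old ` T) \<le> card T" "card (Sel Blue ` I :: 'a ext set) \<le> card I" "card (Sel Red ` J :: 'a ext set) \<le> card J"
    using assms by (simp_all add: card_image_le)
  ultimately show ?thesis by linarith
qed

lemma ext_set_Int: "ext_set T I J k \<inter> ext_set T' I' J' k = ext_set (T \<inter> T') (I \<inter> I') (J \<inter> J') k"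
  by (auto simp: ext_set_def in_gadgets_iff)

lemma ext_set_mono: "T \<subseteq> T' \<Longrightarrow> I \<subseteq> I' \<Longrightarrow> J \<subseteq> J' \<Longrightarrow> ext_set T I J k \<subseteq> ext_set T' I' J' k"
  by (auto simp: ext_set_def)

lemma pos_Old: "finite T \<Longrightarrow> pos (ext_arcs E c tg) (ext_colour c) (Old ` T) = pos E c T"
  by (rule pos_map) (auto simp: ext_arcs_def inj_on_def)

lemma remaining_Sel:
  "remaining (ext_arcs E c tg) (ext_set T I J k) (Sel p i) = Old ` (T \<inter> tg p i)"
proof (rule set_eqI)
  fix x show "x \<in> remaining (ext_arcs E c tg) (ext_set T I J k) (Sel p i) \<longleftrightarrow> x \<in> Old ` (T \<inter> tg p i)"
    by (cases x) (auto simp: remaining_def ext_arcs_def)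
qed

text \<open>The refuting reply spends vertex j of its own group, so groups of size Suc k leave k
  independent vertices, that is, an integer of absolute value at least k on the replying
  side.\<close>

lemma pos_gadget_group:
  assumes "\<And>x. x \<in> S \<longleftrightarrow> (\<exists>i. x = Gad p b i \<and> i < Suc k \<and> i \<noteq> j)" "j < Suc k"
  shows "p = Red \<Longrightarrow> pos (ext_arcs E c tg) (ext_colour c) S \<preceq> neg_int k"
    and "p = Blue \<Longrightarrow> pos_int k \<preceq> pos (ext_arcs E c tg) (ext_colour c) S"
proof -
  have S: "S = Gad p b ` ({..<Suc k} - {j})"
    using assms(1) by blast
  have "card S = k" unfolding S using assms(2) by (subst card_image) (auto simp: inj_on_def)
  moreover have "finite S" unfolding S by simp
  moreover have "ext_colour c x = p" if "x \<in> S" for x using that by (auto simp: S)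
  moreover have "(x, y) \<notin> ext_arcs E c tg" if "x \<in> S" "y \<in> S" for x y
    using that by (cases p) (auto simp: S ext_arcs_def)
  ultimately show "p = Red \<Longrightarrow> pos (ext_arcs E c tg) (ext_colour c) S \<preceq> neg_int k"
    and "p = Blue \<Longrightarrow> pos_int k \<preceq> pos (ext_arcs E c tg) (ext_colour c) S"
    by (auto intro: pos_independent_reds_le pos_independent_blues_ge)
qed

text \<open>The four gadget groups refute each other in the cycle blue-False, red-False, blue-True, red-True
  (each group is refuted by its successor), and a vertex of \<open>Old\<close> removes the only group that could
  refute the reply to it. So every move other than a selector loses to a reply
  after which only vertices of the replying player remain.\<close>

lemma ext_blue_refuted:
  fixes E :: "('a \<times> 'a) set" and tg :: "colour \<Rightarrow> nat \<Rightarrow> 'a set"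
  assumes "x \<in> ext_set T I J (Suc k)" "ext_colour c x = Blue" "\<And>p i. x \<noteq> Sel p i"
  defines "E' \<equiv> ext_arcs E c tg" and "c' \<equiv> ext_colour c" and "V \<equiv> ext_set T I J (Suc k)"
  shows "\<exists>y \<in> remaining E' V x. c' y = Red \<and> pos E' c' (remaining E' (remaining E' V x) y) \<preceq> neg_int k"
proof -
  \<comment> \<open>A blue gadget vertex is refuted by the red group of the same flag. A blue old
    vertex has removed blue-True, the only group that refutes red-False.\<close>
  define b where "b = (case x of Gad p b i \<Rightarrow> b | _ \<Rightarrow> False)"
  let ?y = "Gad Red b 0 :: 'a ext"
  have "?y \<in> remaining E' V x"
    using assms(1-3) by (cases x) (auto simp: remaining_def E'_def V_def ext_arcs_def b_def)
  moreover have "pos E' c' (remaining E' (remaining E' V x) ?y) \<preceq> neg_int k"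
    unfolding E'_def c'_def
  proof (rule pos_gadget_group(1)[where p = Red and b = b and j = 0])
    fix z show "z \<in> remaining (ext_arcs E c tg) (remaining (ext_arcs E c tg) V x) ?y \<longleftrightarrow>
        (\<exists>i. z = Gad Red b i \<and> i < Suc k \<and> i \<noteq> 0)"
      using assms(1-3)
      by (cases x; cases z) (auto simp: remaining_def V_def ext_arcs_def b_def not_Blue_iff not_Red_iff)
  qed simp_all
  ultimately show ?thesis by (intro bexI[of _ ?y]) (simp_all add: c'_def)
qed

lemma ext_red_refuted:
  fixes E :: "('a \<times> 'a) set" and tg :: "colour \<Rightarrow> nat \<Rightarrow> 'a set"
  assumes "x \<in> ext_set T I J (Suc k)" "ext_colour c x = Red" "\<And>p i. x \<noteq> Sel p i"
  defines "E' \<equiv> ext_arcs E c tg" and "c' \<equiv> ext_colour c" and "V \<equiv> ext_set T I J (Suc k)"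
  shows "\<exists>y \<in> remaining E' V x. c' y = Blue \<and> pos_int k \<preceq> pos E' c' (remaining E' (remaining E' V x) y)"
proof -
  \<comment> \<open>From red to blue the cycle flips the flag. A red old vertex has removed
    red-False, the only group that refutes blue-False.\<close>
  define b where "b = (case x of Gad p b i \<Rightarrow> \<not> b | _ \<Rightarrow> False)"
  let ?y = "Gad Blue b 0 :: 'a ext"
  have "?y \<in> remaining E' V x"
    using assms(1-3) by (cases x) (auto simp: remaining_def E'_def V_def ext_arcs_def b_def)
  moreover have "pos_int k \<preceq> pos E' c' (remaining E' (remaining E' V x) ?y)"
    unfolding E'_def c'_def
  proof (rule pos_gadget_group(2)[where p = Blue and b = b and j = 0])
    fix z show "z \<in> remaining (ext_arcs E c tg) (remaining (ext_arcs E c tg) V x) ?y \<longleftrightarrow>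
        (\<exists>i. z = Gad Blue b i \<and> i < Suc k \<and> i \<noteq> 0)"
      using assms(1-3)
      by (cases x; cases z) (auto simp: remaining_def V_def ext_arcs_def b_def not_Blue_iff not_Red_iff)
  qed simp_all
  ultimately show ?thesis by (intro bexI[of _ ?y]) (simp_all add: c'_def)
qed

text \<open>With all other moves refuted, only the selectors count, and it suffices that they and
  the options of G dominate one another. The bounds by k make the refuting integers decisive against
  G.\<close>

lemma pos_ext_set:
  assumes fin: "finite T" "finite I" "finite J"
    and bound: "neg_int k \<preceq> G" "G \<preceq> pos_int k"
    and left1: "\<And>i. i \<in> I \<Longrightarrow> \<exists>x |\<in>| left_opts G. pos E c (T \<inter> tg Blue i) \<preceq> x"
    and left2: "\<And>x. x |\<in>| left_opts G \<Longrightarrow> \<exists>i\<in>I. x \<preceq> pos E c (T \<inter> tg Blue i)"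
    and right1: "\<And>j. j \<in> J \<Longrightarrow> \<exists>x |\<in>| right_opts G. x \<preceq> pos E c (T \<inter> tg Red j)"
    and right2: "\<And>x. x |\<in>| right_opts G \<Longrightarrow> \<exists>j\<in>J. pos E c (T \<inter> tg Red j) \<preceq> x"
  shows "pos (ext_arcs E c tg) (ext_colour c) (ext_set T I J (Suc k)) \<approx> G"
proof -
  let ?E = "ext_arcs E c tg" and ?c = "ext_colour c" and ?V = "ext_set T I J (Suc k)"
  have finV: "finite ?V" using fin by (rule finite_ext_set)
  have sel: "pos ?E ?c (remaining ?E ?V (Sel p i)) = pos E c (T \<inter> tg p i)" for p i
    unfolding remaining_Sel using fin by (intro pos_Old) simp
  show ?thesis
  proof (rule game_equivI)
    show "pos ?E ?c ?V \<preceq> G"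
    proof (rule game_leI)
      fix H assume "H |\<in>| left_opts (pos ?E ?c ?V)"
      then obtain x where x: "x \<in> ?V" "?c x = Blue" "H = pos ?E ?c (remaining ?E ?V x)"
        using finV by (auto simp: left_opts_pos)
      show "\<not> G \<preceq> H"
      proof (cases "\<exists>p i. x = Sel p i")
        case True
        then obtain i where "x = Sel Blue i" "i \<in> I" using x by auto
        then show ?thesis
          using left1[of i] x sel left_option_not_ge game_le_trans by metis
      next
        case False
        then obtain y where "y \<in> remaining ?E ?V x" "?c y = Red"
          "pos ?E ?c (remaining ?E (remaining ?E ?V x) y) \<preceq> neg_int k"
          using ext_blue_refuted[of x T I J k c E tg] x by auto
        then show ?thesis
          using game_le_right[of G H] x finV pos_right_option[of "remaining ?E ?V x" y ?c ?E]
            game_le_trans[OF _ bound(1)] by auto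
      qed
    next
      fix x assume "x |\<in>| right_opts G"
      then obtain j where j: "j \<in> J" "pos E c (T \<inter> tg Red j) \<preceq> x" using right2 by blast
      then have "pos E c (T \<inter> tg Red j) |\<in>| right_opts (pos ?E ?c ?V)"
        using pos_right_option[OF finV, of "Sel Red j" ?c ?E] sel by simp
      then show "\<not> x \<preceq> pos ?E ?c ?V" using j right_option_not_le game_le_trans by blast
    qed
    show "G \<preceq> pos ?E ?c ?V"
    proof (rule game_leI)
      fix H assume "H |\<in>| right_opts (pos ?E ?c ?V)"
      then obtain x where x: "x \<in> ?V" "?c x = Red" "H = pos ?E ?c (remaining ?E ?V x)"
        using finV by (auto simp: right_opts_pos)
      show "\<not> H \<preceq> G"
      proof (cases "\<exists>p i. x = Sel p i")
        case True
        then obtain i where "x = Sel Red i" "i \<in> J" using x by auto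
        then show ?thesis
          using right1[of i] x sel right_option_not_le game_le_trans by metis
      next
        case False
        then obtain y where "y \<in> remaining ?E ?V x" "?c y = Blue"
          "pos_int k \<preceq> pos ?E ?c (remaining ?E (remaining ?E ?V x) y)"
          using ext_red_refuted[of x T I J k c E tg] x by auto
        then show ?thesis
          using game_le_left[of H G] x finV pos_left_option[of "remaining ?E ?V x" y ?c ?E]
            game_le_trans[OF bound(2)] by auto
      qed
    next
      fix x assume "x |\<in>| left_opts G"
      then obtain j where j: "j \<in> I" "x \<preceq> pos E c (T \<inter> tg Blue j)" using left2 by blast
      then have "pos E c (T \<inter> tg Blue j) |\<in>| left_opts (pos ?E ?c ?V)"
        using pos_left_option[OF finV, of "Sel Blue j" ?c ?E] sel by simp
      then show "\<not> pos ?E ?c ?V \<preceq> x" using j left_option_not_ge game_le_trans by blast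
    qed
  qed
qed

section \<open>Games born by a given day\<close>

definition implies_list :: "bool list \<Rightarrow> bool list \<Rightarrow> bool" (infix "\<sqsubseteq>" 50) where
  "p \<sqsubseteq> q \<longleftrightarrow> list_all2 (\<longrightarrow>) p q"

lemma implies_list_iff: "p \<sqsubseteq> q \<longleftrightarrow> length p = length q \<and> (\<forall>i<length p. p ! i \<longrightarrow> q ! i)"
  by (simp add: implies_list_def list_all2_conv_all_nth)

text \<open>The game described is below every x outside p, so no right option of x may be below it,
  which puts those options into q; dually for the left options of elements outside q. Together with
  closure under the order this is all that the recursion for the order demands of largest option
  sets.\<close>

definition closed_pair ::
  "bool list list \<Rightarrow> bool list list \<Rightarrow> bool list list \<Rightarrow> bool list list \<Rightarrow> bool list \<Rightarrow> bool list \<Rightarrow> bool" where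
  "closed_pair dn up lo ro p q \<longleftrightarrow>
     list_all2 (\<lambda>b r. b \<longrightarrow> r \<sqsubseteq> p) p dn \<and> list_all2 (\<lambda>b r. b \<longrightarrow> r \<sqsubseteq> q) q up \<and>
     list_all2 (\<lambda>b r. b \<or> r \<sqsubseteq> q) p ro \<and> list_all2 (\<lambda>b r. b \<or> r \<sqsubseteq> p) q lo"

text \<open>The rows are meant to follow a linear extension of the order, so that an element may
  join exactly if the prefix chosen so far contains everything below it.\<close>

fun downsets :: "bool list list \<Rightarrow> bool list list" where
  "downsets rows = foldl (\<lambda>ds r. concat (map (\<lambda>d. (d @ [False]) # (if take (length d) r \<sqsubseteq> d then [d @ [True]] else [])) ds)) [[]] rows"

declare downsets.simps [simp del]

lemma downsets_Nil: "downsets [] = [[]]"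
  and downsets_snoc: "downsets (rows @ [r]) =
    concat (map (\<lambda>d. (d @ [False]) # (if take (length d) r \<sqsubseteq> d then [d @ [True]] else [])) (downsets rows))"
  by (simp_all add: downsets.simps)

lemma in_downsets:
  assumes "length p = length rows" "\<And>r. r \<in> set rows \<Longrightarrow> length r \<ge> length rows"
    and "\<And>i j. i < length rows \<Longrightarrow> j < length rows \<Longrightarrow> p ! i \<Longrightarrow> rows ! i ! j \<Longrightarrow> j \<le> i \<and> p ! j"
  shows "p \<in> set (downsets rows)"
  using assms
proof (induction rows arbitrary: p rule: rev_induct)
  case (snoc r rows)
  define d where "d = butlast p"
  define b where "b = last p"
  have p: "p = d @ [b]" "length d = length rows"
    using snoc.prems(1) by (auto simp: d_def b_def) (metis append_butlast_last_id length_0_conv length_append_singleton nat.distinct(1))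
  have "d \<in> set (downsets rows)"
  proof (rule snoc.IH)
    show "length rows \<le> length r'" if "r' \<in> set rows" for r'
      using snoc.prems(2)[of r'] that by simp
    show "j \<le> i \<and> d ! j" if "i < length rows" "j < length rows" "d ! i" "rows ! i ! j" for i j
      using snoc.prems(3)[of i j] that p by (auto simp: nth_append)
  qed (use p in simp)
  moreover have "take (length d) r \<sqsubseteq> d" if b
    using snoc.prems(3)[of "length rows"] snoc.prems(2)[of r] p that
    by (auto simp: implies_list_iff nth_append)
  ultimately show ?case
    using p(1) by (cases b) (auto simp: downsets_snoc intro!: bexI[of _ d])
qed (simp add: downsets_Nil)

text \<open>These are the profiles of the old representatives, read off the comparison tables; they
  tell which new pair has the value of an old game.\<close>

definition embedded :: "bool list list \<Rightarrow> bool list list \<Rightarrow> (bool list \<times> bool list) list" where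
  "embedded up dn = zip (map (map Not) up) (map (map Not) dn)"

definition next_dn :: "(bool list \<times> bool list) list \<Rightarrow> bool list list" where
  "next_dn ps = map (\<lambda>(p, q). map (\<lambda>(p', q'). p' \<sqsubseteq> p \<and> q \<sqsubseteq> q') ps) ps"

definition next_up :: "(bool list \<times> bool list) list \<Rightarrow> bool list list" where
  "next_up ps = map (\<lambda>(p, q). map (\<lambda>(p', q'). p \<sqsubseteq> p' \<and> q' \<sqsubseteq> q) ps) ps"

definition next_lo :: "(bool list \<times> bool list) list \<Rightarrow> (bool list \<times> bool list) list \<Rightarrow> bool list list" where
  "next_lo es ps = map (\<lambda>(p, q). map (\<lambda>s. s \<in> set (map snd (filter fst (zip p es)))) ps) ps"

definition next_ro :: "(bool list \<times> bool list) list \<Rightarrow> (bool list \<times> bool list) list \<Rightarrow> bool list list" where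
  "next_ro es ps = map (\<lambda>(p, q). map (\<lambda>s. s \<in> set (map snd (filter fst (zip q es)))) ps) ps"

text \<open>\<open>dn ! i\<close> and \<open>up ! i\<close> list the representatives below and above \<open>gs ! i\<close>, and
  \<open>lo ! i\<close> and \<open>ro ! i\<close> those equal to one of its left and right options.\<close>

locale day_system =
  fixes n :: nat and gs :: "game list" and dn up lo ro :: "bool list list"
  assumes length_rows: "length dn = length gs" "length up = length gs" "length lo = length gs" "length ro = length gs"
    and length_row: "\<And>r. r \<in> set dn \<union> set up \<union> set lo \<union> set ro \<Longrightarrow> length r = length gs"
    and dn: "\<And>i j. i < length gs \<Longrightarrow> j < length gs \<Longrightarrow> dn ! i ! j \<longleftrightarrow> gs ! j \<preceq> gs ! i"
    and up: "\<And>i j. i < length gs \<Longrightarrow> j < length gs \<Longrightarrow> up ! i ! j \<longleftrightarrow> gs ! i \<preceq> gs ! j"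
    and lo: "\<And>i k. i < length gs \<Longrightarrow> k < length gs \<Longrightarrow> lo ! i ! k \<longleftrightarrow> (\<exists>x |\<in>| left_opts (gs ! i). x \<approx> gs ! k)"
    and ro: "\<And>i k. i < length gs \<Longrightarrow> k < length gs \<Longrightarrow> ro ! i ! k \<longleftrightarrow> (\<exists>x |\<in>| right_opts (gs ! i). x \<approx> gs ! k)"
    and birthday_gs: "\<And>i. i < length gs \<Longrightarrow> birthday (gs ! i) \<le> n"
    and complete: "\<And>G. birthday G \<le> n \<Longrightarrow> \<exists>i < length gs. G \<approx> gs ! i"
begin

abbreviation "m \<equiv> length gs"

lemma length_nth_row: "i < m \<Longrightarrow> length (dn ! i) = m \<and> length (up ! i) = m \<and> length (lo ! i) = m \<and> length (ro ! i) = m"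
  using length_row length_rows nth_mem by (metis UnCI)

abbreviation "is_profile \<equiv> closed_pair dn up lo ro"

lemma is_profile_iff:
  "is_profile p q \<longleftrightarrow> length p = m \<and> length q = m \<and>
     (\<forall>i<m. \<forall>j<m. p ! i \<longrightarrow> gs ! j \<preceq> gs ! i \<longrightarrow> p ! j) \<and>
     (\<forall>i<m. \<forall>j<m. q ! i \<longrightarrow> gs ! i \<preceq> gs ! j \<longrightarrow> q ! j) \<and>
     (\<forall>i<m. \<forall>j<m. \<not> p ! i \<longrightarrow> ro ! i ! j \<longrightarrow> q ! j) \<and>
     (\<forall>i<m. \<forall>j<m. \<not> q ! i \<longrightarrow> lo ! i ! j \<longrightarrow> p ! j)"
proof (cases "length p = m \<and> length q = m")
  case True
  then have "list_all2 (\<lambda>b r. b \<longrightarrow> r \<sqsubseteq> p) p dn \<longleftrightarrow> (\<forall>i<m. p ! i \<longrightarrow> (\<forall>j<m. dn ! i ! j \<longrightarrow> p ! j))"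
    "list_all2 (\<lambda>b r. b \<longrightarrow> r \<sqsubseteq> q) q up \<longleftrightarrow> (\<forall>i<m. q ! i \<longrightarrow> (\<forall>j<m. up ! i ! j \<longrightarrow> q ! j))"
    "list_all2 (\<lambda>b r. b \<or> r \<sqsubseteq> q) p ro \<longleftrightarrow> (\<forall>i<m. p ! i \<or> (\<forall>j<m. ro ! i ! j \<longrightarrow> q ! j))"
    "list_all2 (\<lambda>b r. b \<or> r \<sqsubseteq> p) q lo \<longleftrightarrow> (\<forall>i<m. q ! i \<or> (\<forall>j<m. lo ! i ! j \<longrightarrow> p ! j))"
    by (simp_all add: list_all2_conv_all_nth implies_list_iff length_rows length_nth_row)
  then show ?thesis
    unfolding closed_pair_def using True dn up by simp meson
next
  case False
  then show ?thesis
    unfolding closed_pair_def using length_rows by (auto dest: list_all2_lengthD)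
qed

lemma is_profile_length: "is_profile p q \<Longrightarrow> length p = m \<and> length q = m"
  and is_profile_down: "is_profile p q \<Longrightarrow> i < m \<Longrightarrow> j < m \<Longrightarrow> p ! i \<Longrightarrow> gs ! j \<preceq> gs ! i \<Longrightarrow> p ! j"
  and is_profile_up: "is_profile p q \<Longrightarrow> i < m \<Longrightarrow> j < m \<Longrightarrow> q ! i \<Longrightarrow> gs ! i \<preceq> gs ! j \<Longrightarrow> q ! j"
  and is_profile_ro: "is_profile p q \<Longrightarrow> i < m \<Longrightarrow> j < m \<Longrightarrow> \<not> p ! i \<Longrightarrow> ro ! i ! j \<Longrightarrow> q ! j"
  and is_profile_lo: "is_profile p q \<Longrightarrow> i < m \<Longrightarrow> j < m \<Longrightarrow> \<not> q ! i \<Longrightarrow> lo ! i ! j \<Longrightarrow> p ! j"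
  unfolding is_profile_iff by metis+

definition opts :: "bool list \<Rightarrow> game fset" where
  "opts p = fset_of_list (map fst (filter snd (zip gs p)))"

lemma in_opts_iff: "length p = m \<Longrightarrow> x |\<in>| opts p \<longleftrightarrow> (\<exists>i<m. p ! i \<and> x = gs ! i)"
  by (force simp: opts_def fset_of_list_elem set_zip image_iff)

definition pair_game :: "bool list \<times> bool list \<Rightarrow> game" where
  "pair_game pq = Game (opts (fst pq)) (opts (snd pq))"

lemma birthday_pair_game: "length p = m \<Longrightarrow> length q = m \<Longrightarrow> birthday (pair_game (p, q)) \<le> Suc n"
  by (auto simp: birthday_le_Suc_iff pair_game_def in_opts_iff birthday_gs)

text \<open>The largest option sets that G admits: Left may be given any game that is not above or
  equal to G, and Right any that is not below or equal, without a change of value.\<close>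

definition profile :: "game \<Rightarrow> bool list \<times> bool list" where
  "profile G = (map (\<lambda>x. \<not> G \<preceq> x) gs, map (\<lambda>x. \<not> x \<preceq> G) gs)"

lemma nth_profile:
  "i < m \<Longrightarrow> fst (profile G) ! i \<longleftrightarrow> \<not> G \<preceq> gs ! i" "i < m \<Longrightarrow> snd (profile G) ! i \<longleftrightarrow> \<not> gs ! i \<preceq> G"
  by (simp_all add: profile_def)

lemma profile_cong: "G \<approx> H \<Longrightarrow> profile G = profile H"
  unfolding profile_def using game_le_trans by (auto simp: game_equiv_def)

lemma option_rep:
  assumes "i < m" "x |\<in>| left_opts (gs ! i) \<or> x |\<in>| right_opts (gs ! i)"
  obtains k where "k < m" "x \<approx> gs ! k"
proof -
  have "birthday x \<le> n"
    using birthday_option_less[of x "gs ! i" n] assms birthday_gs by simp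
  then show ?thesis using complete that by blast
qed

text \<open>For i outside p, a comparison with \<open>gs ! i\<close> could fail by a left option
  above \<open>gs ! i\<close>, which a downset excludes, or by a right option of
  \<open>gs ! i\<close> below the game, but the closure condition puts it into q, where nothing is
  below the game.\<close>

lemma profile_pair_game:
  assumes "is_profile p q"
  shows "profile (pair_game (p, q)) = (p, q)"
proof -
  let ?G = "pair_game (p, q)"
  have len: "length p = m" "length q = m" using assms is_profile_length by auto
  have "\<not> ?G \<preceq> gs ! i \<longleftrightarrow> p ! i" if i: "i < m" for i
  proof
    assume "p ! i"
    then show "\<not> ?G \<preceq> gs ! i"
      using left_option_not_ge[of "gs ! i" ?G] i len by (auto simp: pair_game_def in_opts_iff)
  next
    assume *: "\<not> ?G \<preceq> gs ! i"
    show "p ! i"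
    proof (rule ccontr)
      assume np: "\<not> p ! i"
      have "?G \<preceq> gs ! i"
      proof (rule game_leI)
        fix x assume "x |\<in>| left_opts ?G"
        then obtain j where "j < m" "p ! j" "x = gs ! j"
          using len by (auto simp: pair_game_def in_opts_iff)
        then show "\<not> gs ! i \<preceq> x" using is_profile_down[OF assms] np i by blast
      next
        fix x assume x: "x |\<in>| right_opts (gs ! i)"
        obtain k where k: "k < m" "x \<approx> gs ! k"
          by (rule option_rep[OF i]) (use x in auto)
        then have "q ! k" using is_profile_ro[OF assms] np i ro[of i k] x by blast
        then have "\<not> gs ! k \<preceq> ?G"
          using right_option_not_le[of "gs ! k" ?G] k len by (auto simp: pair_game_def in_opts_iff)
        then show "\<not> x \<preceq> ?G" using k game_le_trans game_equiv_ge by blast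
      qed
      then show False using * by blast
    qed
  qed
  moreover have "\<not> gs ! i \<preceq> ?G \<longleftrightarrow> q ! i" if i: "i < m" for i
  proof
    assume "q ! i"
    then show "\<not> gs ! i \<preceq> ?G"
      using right_option_not_le[of "gs ! i" ?G] i len by (auto simp: pair_game_def in_opts_iff)
  next
    assume *: "\<not> gs ! i \<preceq> ?G"
    show "q ! i"
    proof (rule ccontr)
      assume nq: "\<not> q ! i"
      have "gs ! i \<preceq> ?G"
      proof (rule game_leI)
        fix x assume "x |\<in>| right_opts ?G"
        then obtain j where "j < m" "q ! j" "x = gs ! j"
          using len by (auto simp: pair_game_def in_opts_iff)
        then show "\<not> x \<preceq> gs ! i" using is_profile_up[OF assms] nq i by blast
      next
        fix x assume x: "x |\<in>| left_opts (gs ! i)"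
        obtain k where k: "k < m" "x \<approx> gs ! k"
          by (rule option_rep[OF i]) (use x in auto)
        then have "p ! k" using is_profile_lo[OF assms] nq i lo[of i k] x by blast
        then have "\<not> ?G \<preceq> gs ! k"
          using left_option_not_ge[of "gs ! k" ?G] k len by (auto simp: pair_game_def in_opts_iff)
        then show "\<not> ?G \<preceq> x" using k game_le_trans game_equiv_le by blast
      qed
      then show False using * by blast
    qed
  qed
  ultimately show ?thesis
    using len by (auto simp: profile_def intro!: nth_equalityI)
qed

text \<open>The components record all failures of comparison with representatives: transitivity
  makes them monotone, and conversely inclusion leaves no option as a witness against the
  comparison.\<close>

lemma pair_game_le_iff:
  assumes "is_profile p q" "is_profile p' q'"
  shows "pair_game (p, q) \<preceq> pair_game (p', q') \<longleftrightarrow> p \<sqsubseteq> p' \<and> q' \<sqsubseteq> q"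
proof
  let ?G = "pair_game (p, q)" and ?H = "pair_game (p', q')"
  have len: "length p = m" "length q = m" "length p' = m" "length q' = m"
    using assms is_profile_length by auto
  have nth: "p ! i \<longleftrightarrow> \<not> ?G \<preceq> gs ! i" "q ! i \<longleftrightarrow> \<not> gs ! i \<preceq> ?G"
      "p' ! i \<longleftrightarrow> \<not> ?H \<preceq> gs ! i" "q' ! i \<longleftrightarrow> \<not> gs ! i \<preceq> ?H" if "i < m" for i
    using nth_profile[OF that, of ?G] nth_profile[OF that, of ?H] profile_pair_game assms by simp_all
  show "p \<sqsubseteq> p' \<and> q' \<sqsubseteq> q" if "?G \<preceq> ?H"
    using that nth game_le_trans by (auto simp: implies_list_iff len)
  show "?G \<preceq> ?H" if sub: "p \<sqsubseteq> p' \<and> q' \<sqsubseteq> q"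
  proof (rule game_leI)
    fix x assume "x |\<in>| left_opts ?G"
    then show "\<not> ?H \<preceq> x" using sub nth len by (auto simp: pair_game_def in_opts_iff implies_list_iff)
  next
    fix x assume "x |\<in>| right_opts ?H"
    then show "\<not> x \<preceq> ?G" using sub nth len by (auto simp: pair_game_def in_opts_iff implies_list_iff)
  qed
qed

lemma is_profile_profile:
  assumes "birthday G \<le> Suc n"
  shows "is_profile (fst (profile G)) (snd (profile G))"
  unfolding is_profile_iff
proof (intro conjI allI impI)
  show "length (fst (profile G)) = m" "length (snd (profile G)) = m"
    by (simp_all add: profile_def)
next
  fix i j assume ij: "i < m" "j < m" and *: "fst (profile G) ! i" "gs ! j \<preceq> gs ! i"
  then show "fst (profile G) ! j" using game_le_trans by (auto simp: nth_profile)
next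
  fix i j assume ij: "i < m" "j < m" and *: "snd (profile G) ! i" "gs ! i \<preceq> gs ! j"
  then show "snd (profile G) ! j" using game_le_trans by (auto simp: nth_profile)
next
  fix i j assume ij: "i < m" "j < m" and *: "\<not> fst (profile G) ! i" "ro ! i ! j"
  then obtain x where x: "x |\<in>| right_opts (gs ! i)" "x \<approx> gs ! j" using ro by blast
  have "G \<preceq> gs ! i" using * ij by (simp add: nth_profile)
  then have "\<not> x \<preceq> G" using x game_le_right by blast
  then have "\<not> gs ! j \<preceq> G" using x game_le_trans game_equiv_le by blast
  then show "snd (profile G) ! j" using ij by (simp add: nth_profile)
next
  fix i j assume ij: "i < m" "j < m" and *: "\<not> snd (profile G) ! i" "lo ! i ! j"
  then obtain x where x: "x |\<in>| left_opts (gs ! i)" "x \<approx> gs ! j" using lo by blast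
  have "gs ! i \<preceq> G" using * ij by (simp add: nth_profile)
  then have "\<not> G \<preceq> x" using x game_le_left by blast
  then have "\<not> G \<preceq> gs ! j" using x game_le_trans game_equiv_ge by blast
  then show "fst (profile G) ! j" using ij by (simp add: nth_profile)
qed

lemma equiv_pair_game_profile:
  assumes "birthday G \<le> Suc n"
  shows "G \<approx> pair_game (profile G)"
proof (rule game_equivI)
  have opts: "x |\<in>| left_opts (pair_game (profile G)) \<longleftrightarrow> (\<exists>i<m. \<not> G \<preceq> gs ! i \<and> x = gs ! i)"
    "x |\<in>| right_opts (pair_game (profile G)) \<longleftrightarrow> (\<exists>i<m. \<not> gs ! i \<preceq> G \<and> x = gs ! i)" for x
    by (auto simp: pair_game_def profile_def in_opts_iff)
  have rep: "\<exists>i<m. x \<approx> gs ! i" if "x |\<in>| left_opts G \<or> x |\<in>| right_opts G" for x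
    using that assms by (intro complete) (auto simp: birthday_le_Suc_iff)
  show "G \<preceq> pair_game (profile G)"
  proof (rule game_leI)
    fix x assume x: "x |\<in>| left_opts G"
    then obtain i where i: "i < m" "x \<approx> gs ! i" using rep by blast
    then have "\<not> G \<preceq> gs ! i" using x left_option_not_ge game_le_trans game_equiv_ge by blast
    then have "gs ! i |\<in>| left_opts (pair_game (profile G))" using opts i by blast
    then show "\<not> pair_game (profile G) \<preceq> x"
      using left_option_not_ge game_le_trans i game_equiv_le by blast
  qed (auto simp: opts)
  show "pair_game (profile G) \<preceq> G"
  proof (rule game_leI)
    fix x assume x: "x |\<in>| right_opts G"
    then obtain i where i: "i < m" "x \<approx> gs ! i" using rep by blast
    then have "\<not> gs ! i \<preceq> G" using x right_option_not_le game_le_trans game_equiv_le by blast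
    then have "gs ! i |\<in>| right_opts (pair_game (profile G))" using opts i by blast
    then show "\<not> x \<preceq> pair_game (profile G)"
      using right_option_not_le game_le_trans i game_equiv_ge by blast
  qed (auto simp: opts)
qed

lemma embedded_eq: "k < m \<Longrightarrow> embedded up dn ! k = profile (gs ! k)"
  using length_rows length_nth_row
  by (auto simp: embedded_def profile_def dn up intro!: nth_equalityI)

text \<open>The complement of an upset is a downset, so a single enumeration serves both
  components.\<close>

lemma is_profile_in_downsets:
  assumes "\<And>i j. i < m \<Longrightarrow> j < m \<Longrightarrow> dn ! i ! j \<Longrightarrow> j \<le> i" "is_profile p q"
  shows "p \<in> set (downsets dn)" "map Not q \<in> set (downsets dn)"
proof -
  have len: "length p = m" "length q = m" using assms(2) is_profile_length by auto
  have row: "length dn \<le> length r" if "r \<in> set dn" for r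
    using length_row[of r] length_rows that by simp
  show "p \<in> set (downsets dn)"
  proof (rule in_downsets[OF _ row])
    show "j \<le> i \<and> p ! j" if "i < length dn" "j < length dn" "p ! i" "dn ! i ! j" for i j
      using that assms(1)[of i j] is_profile_down[OF assms(2), of i j] length_rows by (simp add: dn)
  qed (use len length_rows in auto)
  show "map Not q \<in> set (downsets dn)"
  proof (rule in_downsets[OF _ row])
    show "j \<le> i \<and> map Not q ! j" if "i < length dn" "j < length dn" "map Not q ! i" "dn ! i ! j" for i j
      using that assms(1)[of i j] is_profile_up[OF assms(2), of j i] length_rows len by (auto simp: dn)
  qed (use len length_rows in auto)
qed

text \<open>An exhaustive list of profiles is the next day: the order is inclusion, and an option
  \<open>gs ! k\<close> is recognized among the new representatives by its profile. Hence all tables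
  are computable from the preceding ones.\<close>

lemma day_system_Suc:
  assumes "\<And>p q. (p, q) \<in> set ps \<longleftrightarrow> is_profile p q"
  shows "day_system (Suc n) (map pair_game ps) (next_dn ps) (next_up ps)
     (next_lo (embedded up dn) ps) (next_ro (embedded up dn) ps)"
  unfolding next_dn_def next_up_def next_lo_def next_ro_def
proof
  have cl: "is_profile (fst (ps ! i)) (snd (ps ! i))" if "i < length ps" for i
    using assms[of "fst (ps ! i)" "snd (ps ! i)"] that by simp
  have emb: "s \<in> set (map snd (filter fst (zip p (embedded up dn)))) \<longleftrightarrow> (\<exists>k<m. p ! k \<and> s = profile (gs ! k))"
    if "length p = m" for p s
    using that embedded_eq length_rows
    by (force simp: set_zip embedded_def[THEN arg_cong[of _ _ length]])
  have equiv: "x \<approx> pair_game s \<longleftrightarrow> s = profile x"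
    if "birthday x \<le> Suc n" "is_profile (fst s) (snd s)" for x s
    using profile_cong[of x "pair_game s"] profile_pair_game[of "fst s" "snd s"]
      equiv_pair_game_profile[OF that(1)] that by auto
  have lenp: "length (fst (ps ! i)) = m \<and> length (snd (ps ! i)) = m" if "i < length ps" for i
    using cl[OF that] is_profile_length by blast
  have birth: "birthday (gs ! k) \<le> Suc n" if "k < m" for k
    using birthday_gs[OF that] by simp
  have mem: "ps ! k \<in> set (map snd (filter fst (zip p (embedded up dn)))) \<longleftrightarrow> (\<exists>x |\<in>| opts p. x \<approx> pair_game (ps ! k))"
    if p: "length p = m" and k: "k < length ps" for p k
  proof -
    have "(\<exists>x |\<in>| opts p. x \<approx> pair_game (ps ! k)) \<longleftrightarrow> (\<exists>j<m. p ! j \<and> gs ! j \<approx> pair_game (ps ! k))"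
      using in_opts_iff[OF p] by metis
    then show ?thesis unfolding emb[OF p] using equiv[OF birth cl[OF k]] by blast
  qed
  let ?gs = "map pair_game ps"
  show "birthday (?gs ! i) \<le> Suc n" if "i < length ?gs" for i
    using birthday_pair_game[of "fst (ps ! i)" "snd (ps ! i)"] lenp[of i] that by simp
  show "\<exists>i<length ?gs. G \<approx> ?gs ! i" if "birthday G \<le> Suc n" for G
    using is_profile_profile[OF that] equiv_pair_game_profile[OF that]
      assms[of "fst (profile G)" "snd (profile G)"] by (auto simp: in_set_conv_nth)
  show "(map (\<lambda>(p, q). map (\<lambda>s. s \<in> set (map snd (filter fst (zip p (embedded up dn))))) ps) ps) ! i ! k \<longleftrightarrow>
      (\<exists>x |\<in>| left_opts (?gs ! i). x \<approx> ?gs ! k)" if "i < length ?gs" "k < length ?gs" for i k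
    using that mem[of "fst (ps ! i)" k] lenp[of i]
    by (simp add: case_prod_beta pair_game_def[of "ps ! i"])
  show "(map (\<lambda>(p, q). map (\<lambda>s. s \<in> set (map snd (filter fst (zip q (embedded up dn))))) ps) ps) ! i ! k \<longleftrightarrow>
      (\<exists>x |\<in>| right_opts (?gs ! i). x \<approx> ?gs ! k)" if "i < length ?gs" "k < length ?gs" for i k
    using that mem[of "snd (ps ! i)" k] lenp[of i]
    by (simp add: case_prod_beta pair_game_def[of "ps ! i"])
  show "(map (\<lambda>(p, q). map (\<lambda>(p', q'). p' \<sqsubseteq> p \<and> q \<sqsubseteq> q') ps) ps) ! i ! j \<longleftrightarrow> ?gs ! j \<preceq> ?gs ! i"
    if "i < length ?gs" "j < length ?gs" for i j
    using that pair_game_le_iff[OF cl cl, of j i] by (simp add: case_prod_beta)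
  show "(map (\<lambda>(p, q). map (\<lambda>(p', q'). p \<sqsubseteq> p' \<and> q' \<sqsubseteq> q) ps) ps) ! i ! j \<longleftrightarrow> ?gs ! i \<preceq> ?gs ! j"
    if "i < length ?gs" "j < length ?gs" for i j
    using that pair_game_le_iff[OF cl cl, of i j] by (simp add: case_prod_beta)
qed auto

end

section \<open>Tables for days 1 and 2\<close>

definition pairs1 :: "(bool list \<times> bool list) list" where
  "pairs1 = [([False], [True]), ([False], [False]), ([True], [True]), ([True], [False])]"

definition pairs2 :: "(bool list \<times> bool list) list" where
  "pairs2 = [
    ([False, False, False, False], [True, True, True, True]),
    ([False, False, False, False], [False, True, True, True]),
    ([True, False, False, False], [True, True, True, True]),
    ([True, False, False, False], [False, True, True, True]),
    ([True, False, True, False], [True, True, True, True]),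
    ([True, True, False, False], [True, True, True, True]),
    ([True, False, True, False], [False, True, True, True]),
    ([True, True, False, False], [False, True, True, True]),
    ([True, True, True, False], [True, True, True, True]),
    ([True, False, True, False], [False, False, True, True]),
    ([True, True, False, False], [False, True, False, True]),
    ([True, True, True, False], [False, True, True, True]),
    ([True, True, True, True], [True, True, True, True]),
    ([True, True, True, False], [False, False, True, True]),
    ([True, True, True, False], [False, True, False, True]),
    ([True, True, True, True], [False, True, True, True]),
    ([True, True, True, False], [False, False, False, True]),
    ([True, True, True, True], [False, False, True, True]),
    ([True, True, True, True], [False, True, False, True]),
    ([True, True, True, False], [False, False, False, False]),
    ([True, True, True, True], [False, False, False, True]),
    ([True, True, True, True], [False, False, False, False])]"

definition "dn1 = next_dn pairs1"
definition "up1 = next_up pairs1"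
definition "lo1 = next_lo (embedded [[True]] [[True]]) pairs1"
definition "ro1 = next_ro (embedded [[True]] [[True]]) pairs1"
definition "dn2 = next_dn pairs2"
definition "up2 = next_up pairs2"
definition "lo2 = next_lo (embedded up1 dn1) pairs2"
definition "ro2 = next_ro (embedded up1 dn1) pairs2"

definition "gs0 = [Game {||} {||}]"

interpretation day0: day_system 0 gs0 "[[True]]" "[[True]]" "[[False]]" "[[False]]"
proof
  show "\<exists>i<length gs0. G \<approx> gs0 ! i" if "birthday G \<le> 0" for G
    using that unfolding birthday_le_0_iff gs0_def by (cases G) (auto intro: game_equiv_refl)
  show "birthday (gs0 ! i) \<le> 0" if "i < length gs0" for i
    using that birthday_le_0_iff[of "Game {||} {||}"] by (simp add: gs0_def)
qed (auto simp: gs0_def)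

definition "gs1 = map day0.pair_game pairs1"

definition lower_triangular :: "bool list list \<Rightarrow> bool" where
  "lower_triangular rows \<longleftrightarrow> list_all2 (\<lambda>i r. list_all Not (drop (Suc i) r)) [0..<length rows] rows"

lemma lower_triangularD:
  "lower_triangular rows \<Longrightarrow> i < length rows \<Longrightarrow> j < length (rows ! i) \<Longrightarrow> rows ! i ! j \<Longrightarrow> j \<le> i"
proof (rule ccontr)
  assume *: "lower_triangular rows" "i < length rows" "j < length (rows ! i)" "rows ! i ! j" "\<not> j \<le> i"
  then have "list_all Not (drop (Suc i) (rows ! i))"
    by (auto simp: lower_triangular_def list_all2_conv_all_nth)
  then have "\<not> drop (Suc i) (rows ! i) ! (j - Suc i)"
    unfolding list_all_length using * by (simp del: nth_drop)
  then show False using * by simp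
qed

definition all_pairs_in where
  "all_pairs_in dn up lo ro ps \<longleftrightarrow> lower_triangular dn \<and> list_all (\<lambda>(p, q). closed_pair dn up lo ro p q) ps \<and>
     (let ds = downsets dn in list_all (\<lambda>p. list_all (\<lambda>d. closed_pair dn up lo ro p (map Not d) \<longrightarrow> (p, map Not d) \<in> set ps) ds) ds)"

lemma (in day_system) in_pairs_iff:
  assumes "all_pairs_in dn up lo ro ps"
  shows "(p, q) \<in> set ps \<longleftrightarrow> is_profile p q"
proof
  assume "(p, q) \<in> set ps"
  then show "is_profile p q" using assms by (auto simp: all_pairs_in_def list_all_iff)
next
  assume pq: "is_profile p q"
  have "j \<le> i" if "i < m" "j < m" "dn ! i ! j" for i j
    using assms that lower_triangularD[of dn i j] length_rows length_nth_row by (simp add: all_pairs_in_def)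
  then have "p \<in> set (downsets dn)" "map Not q \<in> set (downsets dn)"
    using is_profile_in_downsets pq by blast+
  then have "is_profile p (map Not (map Not q)) \<longrightarrow> (p, map Not (map Not q)) \<in> set ps"
    using assms unfolding all_pairs_in_def list_all_iff Let_def by blast
  moreover have "map Not (map Not q) = q" by (simp add: comp_def)
  ultimately show "(p, q) \<in> set ps" using pq by simp
qed

lemma all_pairs_in_pairs1: "all_pairs_in [[True]] [[True]] [[False]] [[False]] pairs1"
  by code_simp

interpretation day1: day_system 1 gs1 dn1 up1 lo1 ro1
  unfolding gs1_def dn1_def up1_def lo1_def ro1_def
  using day0.day_system_Suc[OF day0.in_pairs_iff[OF all_pairs_in_pairs1]] by simp

lemma all_pairs_in_pairs2: "all_pairs_in dn1 up1 lo1 ro1 pairs2"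
  by code_simp

definition "gs2 = map day1.pair_game pairs2"

interpretation day2: day_system 2 gs2 dn2 up2 lo2 ro2
  unfolding gs2_def dn2_def up2_def lo2_def ro2_def
  using day1.day_system_Suc[OF day1.in_pairs_iff[OF all_pairs_in_pairs2]] by (simp add: numeral_2_eq_2)

section \<open>Realizing options through a chain cover\<close>

text \<open>The partial transversals of a chain cover, with at most one entry from each chain. Their
  number bounds the number of option sets up to domination.\<close>

fun choices :: "'a list list \<Rightarrow> 'a set set" where
  "choices [] = {{}}"
| "choices (c # cs) = choices cs \<union> (\<Union>x\<in>set c. insert x ` choices cs)"

lemma finite_choices [simp]: "finite (choices cs)"
  by (induction cs) auto

lemma finite_in_choices: "I \<in> choices cs \<Longrightarrow> finite I"
  by (induction cs arbitrary: I) auto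

lemma card_choices_le: "card (choices cs) \<le> prod_list (map (\<lambda>c. Suc (length c)) cs)"
proof (induction cs)
  case (Cons c cs)
  have "card (\<Union>x\<in>set c. insert x ` choices cs) \<le> (\<Sum>x\<in>set c. card (insert x ` choices cs))"
    by (rule card_UN_le) simp
  also have "\<dots> \<le> (\<Sum>x\<in>set c. card (choices cs))"
    by (intro sum_mono card_image_le) simp
  also have "\<dots> \<le> length c * card (choices cs)"
    by (simp add: card_length)
  finally have "card (choices (c # cs)) \<le> card (choices cs) + length c * card (choices cs)"
    using card_Un_le[of "choices cs" "\<Union>x\<in>set c. insert x ` choices cs"] by simp
  also have "\<dots> = Suc (length c) * card (choices cs)" by simp
  also have "\<dots> \<le> Suc (length c) * prod_list (map (\<lambda>c. Suc (length c)) cs)"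
    by (intro mult_le_mono2 Cons.IH)
  finally show ?case by simp
qed simp

lemma card_in_choices_le: "I \<in> choices cs \<Longrightarrow> card I \<le> length cs"
proof (induction cs arbitrary: I)
  case (Cons c cs)
  then consider "I \<in> choices cs" | x J where "J \<in> choices cs" "I = insert x J" by auto
  then show ?case
  proof cases
    case 1
    then show ?thesis using Cons.IH[of I] by simp
  next
    case 2
    then show ?thesis
      using Cons.IH[of J] card_insert_le_m1[of "length (c # cs)" J x] by simp
  qed
qed simp

lemma choices_map_rev: "choices (map rev cs) = choices cs"
  by (induction cs) auto

lemma sorted_wrt_last:
  "sorted_wrt le xs \<Longrightarrow> (\<And>x. le x x) \<Longrightarrow> x \<in> set xs \<Longrightarrow> le x (last xs)"
  by (induction xs) auto

text \<open>On each chain only the last member of P matters. The current chain is removed from P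
  before the recursion, so chains may overlap; I stays inside P so that every selector leads to a
  genuine option.\<close>

lemma chain_maxima:
  assumes "\<And>c. c \<in> set cs \<Longrightarrow> sorted_wrt le c" "\<And>x. le x x" "P \<subseteq> \<Union> (set ` set cs)"
  shows "\<exists>I \<in> choices cs. I \<subseteq> P \<and> (\<forall>x\<in>P. \<exists>y\<in>I. le x y)"
  using assms
proof (induction cs arbitrary: P)
  case (Cons c cs)
  have "\<exists>I \<in> choices cs. I \<subseteq> P - set c \<and> (\<forall>x\<in>P - set c. \<exists>y\<in>I. le x y)"
  proof (rule Cons.IH)
    show "sorted_wrt le c'" if "c' \<in> set cs" for c' using Cons.prems(1)[of c'] that by simp
    show "le x x" for x by (rule Cons.prems(2))
    show "P - set c \<subseteq> \<Union> (set ` set cs)" using Cons.prems(3) by auto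
  qed
  then obtain I where I: "I \<in> choices cs" "I \<subseteq> P - set c" "\<forall>x\<in>P - set c. \<exists>y\<in>I. le x y" by blast
  let ?c = "filter (\<lambda>x. x \<in> P) c"
  show ?case
  proof (cases "?c = []")
    case True
    then have "P - set c = P" by (auto simp: filter_empty_conv)
    then show ?thesis using I by auto
  next
    case False
    have "le x (last ?c)" if "x \<in> P" "x \<in> set c" for x
      using that sorted_wrt_last[of le ?c x, OF _ Cons.prems(2)] Cons.prems(1)[of c]
      by (simp add: sorted_wrt_filter)
    moreover have "last ?c \<in> set ?c" using False last_in_set by blast
    ultimately show ?thesis
      using I by (intro bexI[of _ "insert (last ?c) I"]) auto
  qed
qed auto

lemma chain_minima:
  assumes "\<And>c. c \<in> set cs \<Longrightarrow> sorted_wrt le c" "\<And>x. le x x" "P \<subseteq> \<Union> (set ` set cs)"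
  shows "\<exists>I \<in> choices cs. I \<subseteq> P \<and> (\<forall>x\<in>P. \<exists>y\<in>I. le y x)"
proof -
  have "sorted_wrt (\<lambda>x y. le y x) c" if "c \<in> set (map rev cs)" for c
    using that assms(1) by (auto simp: sorted_wrt_rev)
  then show ?thesis
    using chain_maxima[of "map rev cs" "\<lambda>x y. le y x" P] assms(2,3) by (simp add: choices_map_rev)
qed

lemma pos_ext_set_values:
  assumes "finite T" "finite I" "finite J" "birthday G \<le> k"
    and "\<And>i. i \<in> I \<Longrightarrow> \<exists>x |\<in>| left_opts G. pos E c (T \<inter> tg Blue i) \<approx> x"
    and "\<And>x. x |\<in>| left_opts G \<Longrightarrow> \<exists>i\<in>I. x \<preceq> pos E c (T \<inter> tg Blue i)"
    and "\<And>j. j \<in> J \<Longrightarrow> \<exists>x |\<in>| right_opts G. pos E c (T \<inter> tg Red j) \<approx> x"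
    and "\<And>x. x |\<in>| right_opts G \<Longrightarrow> \<exists>j\<in>J. pos E c (T \<inter> tg Red j) \<preceq> x"
  shows "pos (ext_arcs E c tg) (ext_colour c) (ext_set T I J (Suc k)) \<approx> G"
  using assms neg_int_le[of G k] le_pos_int[of G k] game_equiv_le game_equiv_ge
  by (intro pos_ext_set) blast+

text \<open>All representatives are subpositions of one pool V with common arcs. A later layer pays
  for V once, and a selector merely cuts V down to \<open>S i\<close>.\<close>

definition realizes where
  "realizes E c V S gs \<longleftrightarrow> finite V \<and> (\<forall>i<length gs. S i \<subseteq> V \<and> pos E c (S i) \<approx> gs ! i)"

text \<open>Every new representative keeps the old pool, the gadget and just the selectors of its
  own options, so all of them again share one pool.\<close>

lemma (in day_system) realizes_Suc:
  assumes "realizes E c V S gs" "\<And>p q. (p, q) \<in> set ps \<Longrightarrow> length p = m \<and> length q = m"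
  shows "realizes (ext_arcs E c (\<lambda>_. S)) (ext_colour c) (ext_set V {..<m} {..<m} (Suc (Suc n)))
      (\<lambda>i. ext_set V {j. j < m \<and> fst (ps ! i) ! j} {j. j < m \<and> snd (ps ! i) ! j} (Suc (Suc n)))
      (map pair_game ps)"
  unfolding realizes_def
proof (intro conjI allI impI)
  have V: "finite V" "\<And>i. i < m \<Longrightarrow> V \<inter> S i = S i" "\<And>i. i < m \<Longrightarrow> pos E c (S i) \<approx> gs ! i"
    using assms(1) by (auto simp: realizes_def)
  show "finite (ext_set V {..<m} {..<m} (Suc (Suc n)))" using V(1) by (intro finite_ext_set) auto
  fix i assume "i < length (map pair_game ps)"
  then have len: "length (fst (ps ! i)) = m" "length (snd (ps ! i)) = m"
    using assms(2)[of "fst (ps ! i)" "snd (ps ! i)"] by auto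
  have "pos (ext_arcs E c (\<lambda>_. S)) (ext_colour c)
     (ext_set V {j. j < m \<and> fst (ps ! i) ! j} {j. j < m \<and> snd (ps ! i) ! j} (Suc (Suc n)))
     \<approx> pair_game (fst (ps ! i), snd (ps ! i))"
  proof (rule pos_ext_set_values)
    show "birthday (pair_game (fst (ps ! i), snd (ps ! i))) \<le> Suc n"
      using birthday_pair_game len by blast
    fix j assume "j \<in> {j. j < m \<and> fst (ps ! i) ! j}"
    then show "\<exists>x |\<in>| left_opts (pair_game (fst (ps ! i), snd (ps ! i))). pos E c (V \<inter> S j) \<approx> x"
      using V len by (intro bexI[of _ "gs ! j"]) (auto simp: pair_game_def in_opts_iff)
  next
    fix j assume "j \<in> {j. j < m \<and> snd (ps ! i) ! j}"
    then show "\<exists>x |\<in>| right_opts (pair_game (fst (ps ! i), snd (ps ! i))). pos E c (V \<inter> S j) \<approx> x"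
      using V len by (intro bexI[of _ "gs ! j"]) (auto simp: pair_game_def in_opts_iff)
  next
    fix x assume "x |\<in>| left_opts (pair_game (fst (ps ! i), snd (ps ! i)))"
    then obtain j where "j < m" "fst (ps ! i) ! j" "x = gs ! j"
      using len by (auto simp: pair_game_def in_opts_iff)
    then show "\<exists>j \<in> {j. j < m \<and> fst (ps ! i) ! j}. x \<preceq> pos E c (V \<inter> S j)"
      using V by (intro bexI[of _ j]) (auto intro: game_equiv_ge)
  next
    fix x assume "x |\<in>| right_opts (pair_game (fst (ps ! i), snd (ps ! i)))"
    then obtain j where "j < m" "snd (ps ! i) ! j" "x = gs ! j"
      using len by (auto simp: pair_game_def in_opts_iff)
    then show "\<exists>j \<in> {j. j < m \<and> snd (ps ! i) ! j}. pos E c (V \<inter> S j) \<preceq> x"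
      using V by (intro bexI[of _ j]) (auto intro: game_equiv_le)
  qed (use V(1) in auto)
  moreover have "map pair_game ps ! i = pair_game (fst (ps ! i), snd (ps ! i))"
    using \<open>i < length (map pair_game ps)\<close> by simp
  ultimately show "pos (ext_arcs E c (\<lambda>_. S)) (ext_colour c)
     (ext_set V {j. j < m \<and> fst (ps ! i) ! j} {j. j < m \<and> snd (ps ! i) ! j} (Suc (Suc n)))
     \<approx> map pair_game ps ! i"
    by simp
qed (rule ext_set_mono; auto)

lemma pos_empty: "pos E c {} = Game {||} {||}"
proof -
  have "left_opts (pos E c {}) = {||}" "right_opts (pos E c {}) = {||}"
    by (rule fset_eqI; simp add: left_opts_pos right_opts_pos)+
  then show ?thesis by (cases "pos E c {}") simp
qed

lemma realizes_day2:
  "\<exists>(E :: (unit ext ext \<times> unit ext ext) set) c V S. realizes E c V S gs2 \<and> card V \<le> 30"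
proof -
  have len: "length p = length gs0 \<and> length q = length gs0" if "(p, q) \<in> set pairs1" for p q
    using that by (auto simp: pairs1_def gs0_def)
  have len': "length p = length gs1 \<and> length q = length gs1" if "(p, q) \<in> set pairs2" for p q
    using that by (auto simp: pairs2_def pairs1_def gs1_def)
  have l: "length gs0 = 1" "length gs1 = 4" by (simp_all add: gs0_def gs1_def pairs1_def)
  let ?c = "\<lambda>_ :: unit. Blue"
  have "realizes {} ?c {} (\<lambda>_. {}) gs0" by (simp add: realizes_def gs0_def pos_empty)
  from day0.realizes_Suc[where ps = pairs1, OF this len, folded gs1_def, unfolded l] obtain E :: "(unit ext \<times> unit ext) set" and c S
    where "realizes E c (ext_set ({} :: unit set) {..<1} {..<1} 2) S gs1"
    by (rule that[unfolded numeral_2_eq_2]) simp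
  from day1.realizes_Suc[where ps = pairs2, OF this len', folded gs2_def, unfolded l] obtain E' :: "(unit ext ext \<times> unit ext ext) set" and c' S'
    where "realizes E' c' (ext_set (ext_set ({} :: unit set) {..<1} {..<1} 2) {..<4} {..<4} 3) S' gs2"
    by (rule that[unfolded numeral_3_eq_3, folded One_nat_def]) simp
  \<comment> \<open>The layer for day 1 has 1 + 1 + 4 * 2 = 10 vertices, and that for day 2 adds 4 +
    4 + 4 * 3 = 20.\<close>
  moreover have "card (ext_set (ext_set ({} :: unit set) {..<1} {..<1} 2) {..<4} {..<4} 3) \<le> 30"
    using card_ext_set_le[of "ext_set ({} :: unit set) {..<1} {..<1} 2" "{..<4}" "{..<4}" 3]
      card_ext_set_le[of "{} :: unit set" "{..<1}" "{..<1}" 2] finite_ext_set[of "{} :: unit set" "{..<1}" "{..<1}" 2]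
    by simp
  ultimately show ?thesis by blast
qed

section \<open>Selecting an option in two moves\<close>

lemma neg_int_le_pos:
  "finite S \<Longrightarrow> card (reds c S) \<le> n \<Longrightarrow> neg_int n \<preceq> pos E c S"
proof (induction n arbitrary: S)
  case 0
  then have "reds c S = {}" by simp
  then show ?case using 0 by (intro game_leI) (auto simp: right_opts_pos reds_def)
next
  case (Suc n)
  show ?case
  proof (rule game_leI)
    fix H assume "H |\<in>| right_opts (pos E c S)"
    then obtain v where v: "v \<in> S" "c v = Red" "H = pos E c (remaining E S v)"
      using Suc.prems by (auto simp: right_opts_pos)
    then have "neg_int n \<preceq> H"
      using Suc.IH[of "remaining E S v"] Suc.prems card_reds_remaining[of S v c E] by simp
    then show "\<not> H \<preceq> neg_int (Suc n)" using game_le_right[of H "neg_int (Suc n)" "neg_int n"] by auto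
  qed simp
qed

lemma pos_le_pos_int:
  "finite S \<Longrightarrow> card (blues c S) \<le> n \<Longrightarrow> pos E c S \<preceq> pos_int n"
proof (induction n arbitrary: S)
  case 0
  then have "blues c S = {}" by simp
  then show ?case using 0 by (intro game_leI) (auto simp: left_opts_pos blues_def)
next
  case (Suc n)
  show ?case
  proof (rule game_leI)
    fix H assume "H |\<in>| left_opts (pos E c S)"
    then obtain v where v: "v \<in> S" "c v = Blue" "H = pos E c (remaining E S v)"
      using Suc.prems by (auto simp: left_opts_pos)
    then have "H \<preceq> pos_int n"
      using Suc.IH[of "remaining E S v"] Suc.prems card_blues_remaining[of S v c E] by simp
    then show "\<not> pos_int (Suc n) \<preceq> H" using game_le_left[of "pos_int (Suc n)" H "pos_int n"] by auto
  qed simp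
qed

text \<open>An untouched gadget group is an integer. The two-stage selection takes such groups of an
  inner layer as its threats instead of adding new vertices.\<close>

lemma pos_gadget_stock:
  "pos (ext_arcs E c tg) (ext_colour c) (Gad Blue b ` {..<k}) \<approx> pos_int k"
  "pos (ext_arcs E c tg) (ext_colour c) (Gad Red b ` {..<k}) \<approx> neg_int k"
proof -
  have card: "card (Gad p b ` {..<k} :: 'a ext set) = k" for p
    by (subst card_image) (auto simp: inj_on_def)
  have mono: "blues (ext_colour c) (Gad Blue b ` {..<k}) = Gad Blue b ` {..<k}"
    "reds (ext_colour c) (Gad Red b ` {..<k}) = Gad Red b ` {..<k}"
    by (auto simp: blues_def reds_def)
  have indep: "(Gad p b i, Gad p b j) \<notin> ext_arcs E c tg" for p i j
    by (cases p) (auto simp: ext_arcs_def)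
  show "pos (ext_arcs E c tg) (ext_colour c) (Gad Blue b ` {..<k}) \<approx> pos_int k"
    by (intro game_equivI pos_le_pos_int pos_independent_blues_ge) (auto simp: mono card indep)
  show "pos (ext_arcs E c tg) (ext_colour c) (Gad Red b ` {..<k}) \<approx> neg_int k"
    by (intro game_equivI neg_int_le_pos pos_independent_reds_le) (auto simp: mono card indep)
qed

text \<open>Left selects an option in two moves: \<open>Game {|pos_int k|} {|Game (A i) {|neg_int k|}|}\<close> forces
  Right to reply, after which Left moves to an element of \<open>A i\<close>. The reply makes the first move reversible.\<close>

lemma two_stage_equiv:
  assumes birthday: "birthday G \<le> k"
    and A: "\<And>i x. i |\<in>| I \<Longrightarrow> x |\<in>| A i \<Longrightarrow> x |\<in>| left_opts G" "\<And>x. x |\<in>| left_opts G \<Longrightarrow> \<exists>i |\<in>| I. x |\<in>| A i"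
    and B: "\<And>i x. i |\<in>| I \<Longrightarrow> x |\<in>| B i \<Longrightarrow> x |\<in>| right_opts G" "\<And>x. x |\<in>| right_opts G \<Longrightarrow> \<exists>i |\<in>| I. x |\<in>| B i"
  shows "Game ((\<lambda>i. Game {|pos_int k|} {|Game (A i) {|neg_int k|}|}) |`| I)
      ((\<lambda>i. Game {|Game {|pos_int k|} (B i)|} {|neg_int k|}) |`| I) \<approx> G"
proof -
  let ?K = "\<lambda>i. Game (A i) {|neg_int k|}" and ?K' = "\<lambda>i. Game {|pos_int k|} (B i)"
  let ?L = "\<lambda>i. Game {|pos_int k|} {|?K i|}" and ?R = "\<lambda>i. Game {|?K' i|} {|neg_int k|}"
  have opt: "birthday x \<le> k" if "x |\<in>| left_opts G \<or> x |\<in>| right_opts G" for x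
    using birthday_option_less[OF that birthday] by simp
  have opt2: "birthday y \<le> k" if "x |\<in>| left_opts G \<or> x |\<in>| right_opts G" "y |\<in>| left_opts x \<or> y |\<in>| right_opts x" for x y
    using birthday_option_less[OF that(2) opt[OF that(1)]] by simp
  \<comment> \<open>The forced reply leads below G, so the first move by itself gains Left
    nothing.\<close>
  have K: "?K i \<preceq> G" if i: "i |\<in>| I" for i
  proof (rule game_leI)
    show "\<not> G \<preceq> x" if "x |\<in>| left_opts (?K i)" for x
      using A(1)[OF i] that left_option_not_ge by auto
    show "\<not> x \<preceq> ?K i" if "x |\<in>| right_opts G" for x
      using neg_int_le[OF opt] that right_option_not_le[of "neg_int k" "?K i"] game_le_trans by auto
  qed
  have K': "G \<preceq> ?K' i" if i: "i |\<in>| I" for i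
  proof (rule game_leI)
    show "\<not> x \<preceq> G" if "x |\<in>| right_opts (?K' i)" for x
      using B(1)[OF i] that right_option_not_le by auto
    show "\<not> ?K' i \<preceq> x" if "x |\<in>| left_opts G" for x
      using le_pos_int[OF opt] that left_option_not_ge[of "pos_int k" "?K' i"] game_le_trans by auto
  qed
  \<comment> \<open>Yet the first move is worth every element of \<open>A i\<close>: the reply
    leaves x available, and the threat dominates all left options of x.\<close>
  have L: "x \<preceq> ?L i" if i: "i |\<in>| I" and x: "x |\<in>| A i" for i x
  proof (rule game_leI)
    show "\<not> ?L i \<preceq> y" if "y |\<in>| left_opts x" for y
      using le_pos_int[OF opt2, of x y] A(1)[OF i x] that left_option_not_ge[of "pos_int k" "?L i"] game_le_trans by auto
    show "\<not> y \<preceq> x" if "y |\<in>| right_opts (?L i)" for y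
      using that x left_option_not_ge[of x "?K i"] by auto
  qed
  have R: "?R i \<preceq> x" if i: "i |\<in>| I" and x: "x |\<in>| B i" for i x
  proof (rule game_leI)
    show "\<not> y \<preceq> ?R i" if "y |\<in>| right_opts x" for y
      using neg_int_le[OF opt2, of x y] B(1)[OF i x] that right_option_not_le[of "neg_int k" "?R i"] game_le_trans by auto
    show "\<not> x \<preceq> y" if "y |\<in>| left_opts (?R i)" for y
      using that x right_option_not_le[of x "?K' i"] by auto
  qed
  let ?G = "Game (?L |`| I) (?R |`| I)"
  show ?thesis
  proof (rule game_equivI)
    show "?G \<preceq> G"
    proof (rule game_leI)
      show "\<not> G \<preceq> x" if "x |\<in>| left_opts ?G" for x
        using that K game_le_right by fastforce
      show "\<not> x \<preceq> ?G" if x: "x |\<in>| right_opts G" for x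
      proof -
        obtain i where "i |\<in>| I" "x |\<in>| B i" using B(2)[OF x] by blast
        then show ?thesis using R[of i x] right_option_not_le[of "?R i" ?G] game_le_trans by auto
      qed
    qed
    show "G \<preceq> ?G"
    proof (rule game_leI)
      show "\<not> x \<preceq> G" if "x |\<in>| right_opts ?G" for x
        using that K' game_le_left by fastforce
      show "\<not> ?G \<preceq> x" if x: "x |\<in>| left_opts G" for x
      proof -
        obtain i where "i |\<in>| I" "x |\<in>| A i" using A(2)[OF x] by blast
        then show ?thesis using L[of i x] left_option_not_ge[of "?L i" ?G] game_le_trans by auto
      qed
    qed
  qed
qed

text \<open>Three layers over V: the outer one chooses i, the middle one holds the threat and its
  reply, and the inner one chooses W j within U i. The outer and the inner layer cost M selectors
  per colour each, which gives 4 * M.\<close>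

lemma two_stage_realized:
  fixes V :: "'a set" and U W :: "nat \<Rightarrow> 'a set"
  assumes V: "finite V" "\<And>i. i < M \<Longrightarrow> U i \<subseteq> V" "\<And>i. i < M \<Longrightarrow> SB \<union> SR \<subseteq> U i"
    and stock: "pos E c SB \<approx> pos_int 5" "pos E c SR \<approx> neg_int 5"
    and birthday: "birthday G \<le> 5"
    and rep: "\<And>x. x |\<in>| left_opts G \<or> x |\<in>| right_opts G \<Longrightarrow> \<exists>i<M. \<exists>j<M. pos E c (U i \<inter> W j) \<approx> x"
  shows "\<exists>n \<le> card V + 4 * M + 102. realized_by G n"
proof -
  define A where "A i = ffilter (\<lambda>x. \<exists>j<M. pos E c (U i \<inter> W j) \<approx> x) (left_opts G)" for i
  define B where "B i = ffilter (\<lambda>x. \<exists>j<M. pos E c (U i \<inter> W j) \<approx> x) (right_opts G)" for i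
  define JA where "JA i = {j. j < M \<and> (\<exists>x |\<in>| A i. pos E c (U i \<inter> W j) \<approx> x)}" for i
  define JB where "JB i = {j. j < M \<and> (\<exists>x |\<in>| B i. pos E c (U i \<inter> W j) \<approx> x)}" for i
  \<comment> \<open>Index M, beyond all W j, is the selector that carries out a threat.\<close>
  define tK where "tK p j = (if j < M then W j else if p = Blue then SB else SR)" for p and j :: nat
  define EK where "EK = ext_arcs E c tK"
  define cK where "cK = ext_colour c"
  define KL where "KL i = ext_set (U i) (JA i) {M} 7" for i
  define KR where "KR i = ext_set (U i) {M} (JB i) 7" for i
  let ?K = "\<lambda>i. Game (A i) {|neg_int 5|}" and ?K' = "\<lambda>i. Game {|pos_int 5|} (B i)"
  have opt: "birthday x \<le> 5" if "x |\<in>| left_opts G \<or> x |\<in>| right_opts G" for x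
    using birthday_option_less[OF that birthday] by simp
  have bK: "birthday (?K i) \<le> 6" "birthday (?K' i) \<le> 6" for i
    using opt birthday_neg_int[of 5] birthday_pos_int[of 5] birthday_le_Suc_iff[of "?K i" 5] birthday_le_Suc_iff[of "?K' i" 5]
    by (auto simp: A_def B_def)
  have finU: "finite (U i)" if "i < M" for i using V that finite_subset by blast
  have finJ: "finite (JA i)" "finite (JB i)" for i by (simp_all add: JA_def JB_def)
  have stock_Int: "U i \<inter> tK Blue M = SB" "U i \<inter> tK Red M = SR" if "i < M" for i
    using V(3)[OF that] by (auto simp: tK_def)
  have tK: "tK p j = W j" if "j < M" for p j using that by (simp add: tK_def)
  have KL: "pos EK cK (KL i) \<approx> ?K i" if i: "i < M" for i
  proof -
    have "pos (ext_arcs E c tK) (ext_colour c) (ext_set (U i) (JA i) {M} (Suc 6)) \<approx> ?K i"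
    proof (rule pos_ext_set_values)
      fix j assume "j \<in> JA i"
      then show "\<exists>x |\<in>| left_opts (?K i). pos E c (U i \<inter> tK Blue j) \<approx> x" by (auto simp: JA_def tK)
    next
      fix x assume x: "x |\<in>| left_opts (?K i)"
      then obtain j where j: "j < M" "pos E c (U i \<inter> W j) \<approx> x" by (auto simp: A_def)
      then have "j \<in> JA i" using x by (auto simp: JA_def)
      then show "\<exists>j\<in>JA i. x \<preceq> pos E c (U i \<inter> tK Blue j)" using j tK[of j] game_equiv_ge by (intro bexI[of _ j]) auto
    qed (use stock_Int[OF i] stock(2) finU[OF i] finJ bK in \<open>auto intro: game_equiv_le\<close>)
    then show ?thesis by (simp add: EK_def cK_def KL_def)
  qed
  have KR: "pos EK cK (KR i) \<approx> ?K' i" if i: "i < M" for i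
  proof -
    have "pos (ext_arcs E c tK) (ext_colour c) (ext_set (U i) {M} (JB i) (Suc 6)) \<approx> ?K' i"
    proof (rule pos_ext_set_values)
      fix j assume "j \<in> JB i"
      then show "\<exists>x |\<in>| right_opts (?K' i). pos E c (U i \<inter> tK Red j) \<approx> x" by (auto simp: JB_def tK)
    next
      fix x assume x: "x |\<in>| right_opts (?K' i)"
      then obtain j where j: "j < M" "pos E c (U i \<inter> W j) \<approx> x" by (auto simp: B_def)
      then have "j \<in> JB i" using x by (auto simp: JB_def)
      then show "\<exists>j\<in>JB i. pos E c (U i \<inter> tK Red j) \<preceq> x" using j tK[of j] game_equiv_le by (intro bexI[of _ j]) auto
    qed (use stock_Int[OF i] stock(1) finU[OF i] finJ bK in \<open>auto intro: game_equiv_ge\<close>)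
    then show ?thesis by (simp add: EK_def cK_def KR_def)
  qed
  \<comment> \<open>In the middle layer blue 0 and red 1 carry out the threats, while red 0 and blue
    1 are the forced replies and keep the whole inner position.\<close>
  define tE where "tE p j = (if (p = Blue) \<noteq> (j = (0 :: nat)) then UNIV else if p = Blue then Old ` SB else Old ` SR)" for p j
  define EE where "EE = ext_arcs EK cK tE"
  define cE where "cE = ext_colour cK"
  define EL where "EL i = ext_set (KL i) {0} {0} 8" for i
  define ER where "ER i = ext_set (KR i) {1} {1} 8" for i
  let ?L = "\<lambda>i. Game {|pos_int 5|} {|?K i|}" and ?R = "\<lambda>i. Game {|?K' i|} {|neg_int 5|}"
  have bL: "birthday (?L i) \<le> 7" "birthday (?R i) \<le> 7" for i
    using bK birthday_neg_int[of 5] birthday_pos_int[of 5] birthday_le_Suc_iff[of "?L i" 6] birthday_le_Suc_iff[of "?R i" 6]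
    by auto
  have finK: "finite (KL i)" "finite (KR i)" if "i < M" for i
    using finU[OF that] finJ by (simp_all add: KL_def KR_def finite_ext_set)
  have stock_K: "KL i \<inter> tE Blue 0 = Old ` SB" "KR i \<inter> tE Red 1 = Old ` SR"
    "KL i \<inter> tE Red 0 = KL i" "KR i \<inter> tE Blue 1 = KR i" if "i < M" for i
    using V(3)[OF that] by (auto simp: tE_def KL_def KR_def)
  have fin_stock: "M > 0 \<Longrightarrow> finite SB" "M > 0 \<Longrightarrow> finite SR"
    using V(3) finU finite_subset by (metis Un_subset_iff)+
  have stock_pos: "pos EK cK (Old ` SB) \<approx> pos_int 5" "pos EK cK (Old ` SR) \<approx> neg_int 5" if "M > 0"
    using stock fin_stock that by (simp_all add: EK_def cK_def pos_Old)
  have EL: "pos EE cE (EL i) \<approx> ?L i" and ER: "pos EE cE (ER i) \<approx> ?R i" if i: "i < M" for i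
  proof -
    have "pos (ext_arcs EK cK tE) (ext_colour cK) (ext_set (KL i) {0} {0} (Suc 7)) \<approx> ?L i"
      using KL[OF i] stock_pos i finK[OF i] bL game_equiv_le game_equiv_ge
      by (intro pos_ext_set_values) (auto simp: stock_K[OF i])
    then show "pos EE cE (EL i) \<approx> ?L i" by (simp add: EE_def cE_def EL_def)
    have "pos (ext_arcs EK cK tE) (ext_colour cK) (ext_set (KR i) {1} {1} (Suc 7)) \<approx> ?R i"
      using KR[OF i] stock_pos i finK[OF i] bL game_equiv_le game_equiv_ge
      by (intro pos_ext_set_values) (auto simp: stock_K[OF i, unfolded One_nat_def])
    then show "pos EE cE (ER i) \<approx> ?R i" by (simp add: EE_def cE_def ER_def)
  qed
  define VK where "VK = ext_set V {..M} {..M} 7"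
  define VE where "VE = ext_set VK {0, 1} {0, 1} 8"
  have sub: "EL i \<subseteq> VE" "ER i \<subseteq> VE" if "i < M" for i
    unfolding EL_def ER_def KL_def KR_def VE_def VK_def using V(2)[OF that]
    by (intro ext_set_mono; auto simp: JA_def JB_def)+
  define tT where "tT p i = (if p = Blue then EL i else ER i)" for p i
  let ?I = "fset_of_list [0..<M]"
  let ?G = "Game (?L |`| ?I) (?R |`| ?I)"
  have finVK: "finite VK" and finVE: "finite VE" using V(1) by (simp_all add: VK_def VE_def finite_ext_set)
  have bG: "birthday ?G \<le> 8"
    using bL birthday_le_Suc_iff[of ?G 7] by auto
  have "pos (ext_arcs EE cE tT) (ext_colour cE) (ext_set VE {..<M} {..<M} (Suc 8)) \<approx> ?G"
  proof (rule pos_ext_set_values)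
    fix i assume i: "i \<in> {..<M}"
    have "VE \<inter> tT Blue i = EL i" "VE \<inter> tT Red i = ER i" using i sub by (auto simp: tT_def)
    then show "\<exists>x |\<in>| left_opts ?G. pos EE cE (VE \<inter> tT Blue i) \<approx> x"
      "\<exists>x |\<in>| right_opts ?G. pos EE cE (VE \<inter> tT Red i) \<approx> x"
      using EL ER i by (auto simp: fset_of_list_elem intro!: bexI[of _ i])
  next
    fix x assume "x |\<in>| left_opts ?G"
    then obtain i where i: "i < M" "x = ?L i" by (auto simp: fset_of_list_elem)
    then have "VE \<inter> tT Blue i = EL i" using sub by (auto simp: tT_def)
    then show "\<exists>i\<in>{..<M}. x \<preceq> pos EE cE (VE \<inter> tT Blue i)" using EL i game_equiv_ge by (intro bexI[of _ i]) auto
  next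
    fix x assume "x |\<in>| right_opts ?G"
    then obtain i where i: "i < M" "x = ?R i" by (auto simp: fset_of_list_elem)
    then have "VE \<inter> tT Red i = ER i" using sub by (auto simp: tT_def)
    then show "\<exists>i\<in>{..<M}. pos EE cE (VE \<inter> tT Red i) \<preceq> x" using ER i game_equiv_le by (intro bexI[of _ i]) auto
  qed (use finVE bG in auto)
  also have "?G \<approx> G"
  proof (rule two_stage_equiv[OF birthday])
    show "\<exists>i |\<in>| ?I. x |\<in>| A i" if "x |\<in>| left_opts G" for x
      using rep[of x] that by (auto simp: A_def fset_of_list_elem)
    show "\<exists>i |\<in>| ?I. x |\<in>| B i" if "x |\<in>| right_opts G" for x
      using rep[of x] that by (auto simp: B_def fset_of_list_elem)
  qed (auto simp: A_def B_def)
  finally have "realized_by G (card (ext_set VE {..<M} {..<M} (Suc 8)))"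
    using finVE by (intro realized_byI[OF finite_ext_set]) auto
  moreover have "card (ext_set VE {..<M} {..<M} (Suc 8)) \<le> card V + 4 * M + 102"
  proof -
    \<comment> \<open>The layers add 2 * (M + 1) + 28, then 4 + 32, then 2 * M + 36
      vertices.\<close>
    have "card VK \<le> card V + 2 * M + 30"
      unfolding VK_def using card_ext_set_le[of V "{..M}" "{..M}" 7] V(1) by simp
    moreover have "card VE \<le> card VK + 36"
      unfolding VE_def using card_ext_set_le[of VK "{0, 1}" "{0, 1}" 8] finVK by simp
    ultimately show ?thesis
      using card_ext_set_le[of VE "{..<M}" "{..<M}" "Suc 8"] finVE by simp
  qed
  ultimately show ?thesis by blast
qed

section \<open>Days 0, 1 and 2\<close>

datatype list_game = LG "list_game list" "list_game list"

fun to_game :: "list_game \<Rightarrow> game" where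
  "to_game (LG xs ys) = Game (fset_of_list (map to_game xs)) (fset_of_list (map to_game ys))"

function list_game_le :: "list_game \<Rightarrow> list_game \<Rightarrow> bool" where
  "list_game_le (LG xs ys) (LG us vs) \<longleftrightarrow>
     list_all (\<lambda>x. \<not> list_game_le (LG us vs) x) xs \<and> list_all (\<lambda>v. \<not> list_game_le v (LG xs ys)) vs"
  by pat_completeness auto
termination
  by (relation "measure (\<lambda>(G, H). size G + size H)") (auto dest!: size_list_estimation'[of _ _ _ size, OF _ order_refl])

lemma list_game_le_iff: "list_game_le x y \<longleftrightarrow> to_game x \<preceq> to_game y"
proof (induction x y rule: list_game_le.induct)
  case (1 xs ys us vs)
  then show ?case
    by (subst game_le.simps) (auto simp: list_all_iff fset_of_list_elem)
qed

text \<open>The first argument is fuel. Every move deletes a vertex, so the length of S is enough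
  and the base case is met only with no vertices left.\<close>

primrec list_pos :: "nat \<Rightarrow> (nat \<times> nat) list \<Rightarrow> nat \<Rightarrow> nat list \<Rightarrow> list_game" where
  "list_pos 0 as b S = LG [] []"
| "list_pos (Suc k) as b S = LG
     (map (\<lambda>v. list_pos k as b (filter (\<lambda>w. w \<noteq> v \<and> (v, w) \<notin> set as) S)) (filter (\<lambda>v. v < b) S))
     (map (\<lambda>v. list_pos k as b (filter (\<lambda>w. w \<noteq> v \<and> (v, w) \<notin> set as) S)) (filter (\<lambda>v. \<not> v < b) S))"

lemma to_game_list_pos:
  "length S \<le> k \<Longrightarrow> to_game (list_pos k as b S) = pos (set as) (\<lambda>v. if v < b then Blue else Red) (set S)"
proof (induction k arbitrary: S)
  case 0
  then show ?case by (simp add: pos_empty)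
next
  case (Suc k)
  let ?c = "\<lambda>v. if v < b then Blue else Red"
  have IH: "to_game (list_pos k as b (filter (\<lambda>w. w \<noteq> v \<and> (v, w) \<notin> set as) S)) = pos (set as) ?c (remaining (set as) (set S) v)"
    if v: "v \<in> set S" for v
  proof -
    have "length (filter (\<lambda>w. w \<noteq> v \<and> (v, w) \<notin> set as) S) < length S"
      using v by (intro length_filter_less) auto
    moreover have "set (filter (\<lambda>w. w \<noteq> v \<and> (v, w) \<notin> set as) S) = remaining (set as) (set S) v"
      by (auto simp: remaining_def)
    ultimately show ?thesis using Suc.IH[of "filter (\<lambda>w. w \<noteq> v \<and> (v, w) \<notin> set as) S"] Suc.prems by simp
  qed
  have "left_opts (to_game (list_pos (Suc k) as b S)) = left_opts (pos (set as) ?c (set S))"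
    by (rule fset_eqI) (auto simp: left_opts_pos fset_of_list_elem image_iff IH)
  moreover have "right_opts (to_game (list_pos (Suc k) as b S)) = right_opts (pos (set as) ?c (set S))"
    by (rule fset_eqI) (auto simp: right_opts_pos fset_of_list_elem image_iff IH)
  ultimately show ?case by (rule game.expand[OF conjI])
qed

definition list_pair :: "list_game list \<Rightarrow> bool list \<times> bool list \<Rightarrow> list_game" where
  "list_pair gs pq = LG (map fst (filter snd (zip gs (fst pq)))) (map fst (filter snd (zip gs (snd pq))))"

lemma (in day_system) to_game_list_pair:
  assumes "map to_game lgs = gs"
  shows "to_game (list_pair lgs pq) = pair_game pq"
proof -
  have "map to_game (map fst (filter snd (zip lgs p))) = map fst (filter snd (zip gs p))" for p
    unfolding assms[symmetric] by (simp add: zip_map1 filter_map o_def case_prod_beta)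
  then show ?thesis by (simp add: list_pair_def pair_game_def opts_def)
qed

definition "list_games1 = map (list_pair [LG [] []]) pairs1"
definition "list_games2 = map (list_pair list_games1) pairs2"

lemma map_to_game_list_games1: "map to_game list_games1 = gs1"
  using day0.to_game_list_pair[of "[LG [] []]"] by (simp add: list_games1_def gs1_def gs0_def)

lemma map_to_game_list_games2: "map to_game list_games2 = gs2"
  using day1.to_game_list_pair[OF map_to_game_list_games1] by (simp add: list_games2_def gs2_def)

text \<open>An entry \<open>(n, b, as)\<close> stands for the digraph on \<open>{..<n}\<close> with arcs \<open>as\<close> whose blue vertices are those below \<open>b\<close>.\<close>

definition realizes_within :: "nat \<Rightarrow> list_game \<Rightarrow> nat \<times> nat \<times> (nat \<times> nat) list \<Rightarrow> bool" where
  "realizes_within k g = (\<lambda>(n, b, as). n \<le> k \<and>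
     list_game_le (list_pos n as b [0..<n]) g \<and> list_game_le g (list_pos n as b [0..<n]))"

lemma realized_by_if_realizes_within:
  assumes "realizes_within k g t"
  shows "\<exists>n \<le> k. realized_by (to_game g) n"
proof -
  obtain n b as where t: "t = (n, b, as)" using prod_cases3 by blast
  have "pos (set as) (\<lambda>v. if v < b then Blue else Red) (set [0..<n]) \<approx> to_game g"
    using assms by (simp add: t realizes_within_def list_game_le_iff to_game_list_pos game_equivI flip: set_upt)
  then have "realized_by (to_game g) (card (set [0..<n]))" by (rule realized_byI[rotated]) simp
  then show ?thesis using assms by (auto simp: t realizes_within_def)
qed

definition digraphs1 :: "(nat \<times> nat \<times> (nat \<times> nat) list) list" where
  "digraphs1 = [(1, 0, []), (0, 0, []), (2, 1, [(0, 1), (1, 0)]), (1, 1, [])]"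

definition digraphs2 :: "(nat \<times> nat \<times> (nat \<times> nat) list) list" where
  "digraphs2 = [
    (2, 0, []),
    (1, 0, []),
    (3, 1, [(0, 1), (1, 0)]),
    (2, 1, [(1, 0)]),
    (4, 2, [(0, 3), (1, 0), (1, 2), (2, 0), (2, 1)]),
    (3, 1, [(0, 1), (0, 2), (1, 0)]),
    (4, 2, [(0, 1), (0, 3), (1, 2), (2, 0), (3, 0)]),
    (3, 1, [(0, 1), (0, 2), (1, 0), (1, 2)]),
    (4, 2, [(0, 1), (0, 2), (0, 3), (1, 3), (2, 0), (2, 1)]),
    (0, 0, []),
    (2, 1, [(0, 1), (1, 0)]),
    (4, 2, [(0, 1), (0, 2), (0, 3), (1, 2), (2, 0), (2, 1), (2, 3), (3, 0)]),
    (4, 2, [(0, 2), (0, 3), (2, 0), (2, 1)]),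
    (4, 2, [(0, 2), (1, 2), (2, 1), (2, 3), (3, 0)]),
    (3, 2, [(0, 1), (0, 2), (2, 0), (2, 1)]),
    (4, 2, [(1, 2), (1, 3), (2, 0), (2, 1), (2, 3), (3, 0)]),
    (2, 1, [(0, 1)]),
    (4, 2, [(0, 2), (0, 3), (1, 2), (2, 1), (3, 0)]),
    (3, 2, [(0, 2), (2, 0), (2, 1)]),
    (1, 1, []),
    (3, 2, [(0, 2), (2, 0)]),
    (2, 2, [])]"

lemma realizes_within_digraphs1: "list_all2 (realizes_within 2) list_games1 digraphs1"
  by code_simp

lemma realizes_within_digraphs2: "list_all2 (realizes_within 4) list_games2 digraphs2"
  by code_simp

lemma realized_by_cong: "realized_by G n \<Longrightarrow> G \<approx> H \<Longrightarrow> realized_by H n"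
  unfolding realized_by_def using game_equiv_trans by blast

lemma (in day_system) placement_F_le_if_realizes_within:
  assumes "list_all2 (realizes_within k) lgs ts" "map to_game lgs = gs"
  shows "placement_F n \<le> k"
proof (rule placement_F_le)
  fix G assume "birthday G \<le> n"
  then obtain i where i: "i < m" "G \<approx> gs ! i" using complete by blast
  moreover have "length lgs = m" using assms(2) by (metis length_map)
  ultimately have "realizes_within k (lgs ! i) (ts ! i)" "gs ! i = to_game (lgs ! i)"
    using assms by (auto simp: list_all2_conv_all_nth)
  then show "\<exists>n\<le>k. realized_by G n"
    using realized_by_if_realizes_within realized_by_cong game_equiv_sym i(2) by metis
qed

lemma birthday_switch: "birthday (Game {|pos_int k|} {|neg_int k|}) \<le> Suc k"
  by (auto simp: birthday_le_Suc_iff birthday_pos_int birthday_neg_int)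

lemma placement_F_ge_switch:
  assumes "\<And>G. birthday G \<le> Suc k \<Longrightarrow> \<exists>n. realized_by G n"
  shows "2 * Suc k \<le> placement_F (Suc k)"
  using assms[OF birthday_switch] placement_F_ge[OF birthday_switch] realized_by_switch_ge by blast

lemma placement_F_0: "placement_F 0 = 0"
proof -
  have "realized_by (Game {||} {||}) 0"
    using realized_byI[of "{} :: nat set" "{}" "\<lambda>_. Blue"] by (simp add: pos_empty)
  moreover have "G = Game {||} {||}" if "birthday G \<le> 0" for G
    using that unfolding birthday_le_0_iff by (cases G) simp
  ultimately show ?thesis using placement_F_le[of 0 0] by auto
qed

section \<open>Upper bounds for days 3, 4 and 5\<close>

text \<open>The \<open>j\<close>-th entry belongs to the profiles \<open>(p, q)\<close> for which \<open>q\<close> is the complement of the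
  \<open>j\<close>-th downset: it partitions their components \<open>p\<close>, given as indices into the list of downsets, into a minimum number of chains.\<close>

definition chain_table :: "nat list list list" where
  "chain_table = [
    [[4, 11, 19, 20, 21, 32, 39, 40, 66, 67, 74, 80, 81, 82, 88, 90], [8, 9, 10, 12, 13, 23, 27, 28, 42, 44, 45, 60, 62, 63, 79, 85, 91, 92], [0, 1, 2, 3, 5, 6, 7, 14, 24, 34, 36, 56, 59, 61, 77, 78, 83, 87, 89, 93], [22, 25, 37, 38, 46, 64, 65, 72, 73, 75, 76, 84, 86, 94], [31, 33, 35, 55, 57, 58, 68, 69, 70, 71, 95], [41, 43, 48, 49, 52, 53, 54, 96], [15, 16, 17, 18, 26, 29, 30, 47, 50, 51, 97]],
    [[4, 11, 19, 20, 21, 32, 39, 40, 66, 67, 74, 80, 81, 82, 88, 90], [8, 9, 10, 12, 13, 23, 27, 28, 42, 44, 45, 60, 62, 63, 79, 85, 91, 92], [0, 1, 2, 3, 5, 6, 7, 14, 24, 34, 36, 56, 59, 61, 77, 78, 83, 87, 89, 93], [22, 25, 37, 38, 46, 64, 65, 72, 73, 75, 76, 84, 86, 94], [31, 33, 35, 55, 57, 58, 68, 69, 70, 71, 95], [41, 43, 48, 49, 52, 53, 54, 96], [15, 16, 17, 18, 26, 29, 30, 47, 50, 51, 97]],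
    [[11, 19, 20, 21, 32, 39, 40, 66, 67, 74, 80, 81, 82, 88, 90], [22, 23, 27, 28, 42, 44, 45, 60, 62, 63, 79, 85, 91, 92], [8, 9, 10, 12, 13, 14, 24, 34, 36, 56, 59, 61, 77, 78, 83, 87, 89, 93], [25, 37, 38, 46, 64, 65, 72, 73, 75, 76, 84, 86, 94], [31, 33, 35, 55, 57, 58, 68, 69, 70, 71, 95], [41, 43, 48, 49, 52, 53, 54, 96], [15, 16, 17, 18, 26, 29, 30, 47, 50, 51, 97]],
    [[21, 32, 35, 36, 56, 59, 60, 62, 63, 79, 85, 91, 92], [55, 57, 58, 61, 77, 78, 83, 87, 89, 93, 94], [66, 67, 74, 80, 81, 82, 88, 90, 95], [39, 40, 64, 65, 72, 73, 75, 76, 84, 86, 96], [68, 69, 70, 71, 97]],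
    [[68, 77, 78, 79, 85, 91, 92], [38, 40, 64, 65, 72, 73, 75, 83, 87, 89, 93, 94], [46, 48, 49, 52, 74, 80, 81, 82, 88, 90, 95], [18, 26, 29, 30, 47, 50, 51, 53, 54, 76, 84, 86, 96], [66, 67, 69, 70, 71, 97]],
    [[77, 78, 79, 85, 91, 92], [83, 87, 89, 93, 94], [66, 67, 74, 80, 81, 82, 88, 90, 95], [40, 64, 65, 72, 73, 75, 76, 84, 86, 96], [68, 69, 70, 71, 97]],
    [[77, 78, 79, 85, 91, 92], [83, 87, 89, 93, 94], [66, 67, 74, 80, 81, 82, 88, 90, 95], [40, 64, 65, 72, 73, 75, 76, 84, 86, 96], [68, 69, 70, 71, 97]],
    [[92, 95, 96], [71, 82, 88, 90, 97]],
    [[34, 36, 56, 59, 60, 62, 63, 79, 85, 91, 92], [61, 77, 78, 83, 87, 89, 93, 94], [65, 72, 74, 80, 81, 82, 88, 90, 95], [42, 44, 45, 51, 73, 75, 76, 84, 86, 96], [7, 14, 24, 28, 30, 47, 50, 52, 53, 54, 97]],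
    [[34, 36, 56, 59, 60, 62, 63, 79, 85, 91, 92], [61, 77, 78, 83, 87, 89, 93, 94], [65, 72, 74, 80, 81, 82, 88, 90, 95], [42, 44, 45, 51, 73, 75, 76, 84, 86, 96], [14, 24, 28, 30, 47, 50, 52, 53, 54, 97]],
    [[77, 78, 83, 87, 89, 93, 94], [61, 62, 63, 79, 85, 91, 92, 95], [65, 72, 74, 80, 81, 82, 88, 90, 96], [36, 56, 59, 60, 73, 75, 76, 84, 86, 97]],
    [[65, 72, 73, 75, 83, 87, 89, 93, 94], [77, 78, 79, 85, 91, 92, 95], [52, 74, 80, 81, 82, 88, 90, 96], [30, 47, 50, 51, 53, 54, 76, 84, 86, 97]],
    [[83, 87, 89, 93, 94], [77, 78, 79, 85, 91, 92, 95], [74, 80, 81, 82, 88, 90, 96], [65, 72, 73, 75, 76, 84, 86, 97]],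
    [[83, 87, 89, 93, 94], [77, 78, 79, 85, 91, 92, 95], [74, 80, 81, 82, 88, 90, 96], [65, 72, 73, 75, 76, 84, 86, 97]],
    [[92, 95, 96], [82, 88, 90, 97]],
    [[34, 36, 56, 59, 60, 62, 63, 79, 85, 91, 92], [61, 77, 78, 83, 87, 89, 93, 94], [65, 72, 74, 80, 81, 82, 88, 90, 95], [42, 44, 45, 51, 73, 75, 76, 84, 86, 96], [14, 24, 28, 30, 47, 50, 52, 53, 54, 97]],
    [[77, 78, 83, 87, 89, 93, 94], [61, 62, 63, 79, 85, 91, 92, 95], [65, 72, 74, 80, 81, 82, 88, 90, 96], [36, 56, 59, 60, 73, 75, 76, 84, 86, 97]],
    [[77, 78, 83, 87, 89, 93, 94], [61, 62, 63, 79, 85, 91, 92, 95], [65, 72, 74, 80, 81, 82, 88, 90, 96], [36, 56, 59, 60, 73, 75, 76, 84, 86, 97]],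
    [[91, 92, 95, 96], [63, 79, 85, 86, 93, 94, 97]],
    [[65, 72, 73, 75, 83, 87, 89, 93, 94], [77, 78, 79, 85, 91, 92, 95], [52, 74, 80, 81, 82, 88, 90, 96], [30, 47, 50, 51, 53, 54, 76, 84, 86, 97]],
    [[65, 72, 73, 75, 83, 87, 89, 93, 94], [77, 78, 79, 85, 91, 92, 95], [52, 74, 80, 81, 82, 88, 90, 96], [30, 47, 50, 51, 53, 54, 76, 84, 86, 97]],
    [[89, 90, 95, 96], [54, 76, 84, 86, 93, 94, 97]],
    [[83, 87, 89, 93, 94], [77, 78, 79, 85, 91, 92, 95], [74, 80, 81, 82, 88, 90, 96], [65, 72, 73, 75, 76, 84, 86, 97]],
    [[83, 87, 89, 93, 94], [77, 78, 79, 85, 91, 92, 95], [74, 80, 81, 82, 88, 90, 96], [65, 72, 73, 75, 76, 84, 86, 97]],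
    [[92, 95, 96], [82, 88, 90, 97]],
    [[83, 87, 89, 93, 94], [77, 78, 79, 85, 91, 92, 95], [74, 80, 81, 82, 88, 90, 96], [65, 72, 73, 75, 76, 84, 86, 97]],
    [[91, 92, 95, 96], [79, 85, 86, 93, 94, 97]],
    [[83, 87, 89, 93, 94], [77, 78, 79, 85, 91, 92, 95], [74, 80, 81, 82, 88, 90, 96], [65, 72, 73, 75, 76, 84, 86, 97]],
    [[92, 95, 96], [82, 88, 90, 97]],
    [[91, 92, 95, 96], [79, 85, 86, 93, 94, 97]],
    [[92, 95, 96, 97]],
    [[83, 87, 89, 93, 94], [77, 78, 79, 85, 91, 92, 95], [74, 80, 81, 82, 88, 90, 96], [65, 72, 73, 75, 76, 84, 86, 97]],
    [[89, 90, 95, 96], [76, 84, 86, 93, 94, 97]],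
    [[83, 87, 89, 93, 94], [77, 78, 79, 85, 91, 92, 95], [74, 80, 81, 82, 88, 90, 96], [65, 72, 73, 75, 76, 84, 86, 97]],
    [[92, 95, 96], [82, 88, 90, 97]],
    [[89, 90, 95, 96], [76, 84, 86, 93, 94, 97]],
    [[90, 95, 96, 97]],
    [[83, 87, 89, 93, 94], [77, 78, 79, 85, 91, 92, 95], [74, 80, 81, 82, 88, 90, 96], [65, 72, 73, 75, 76, 84, 86, 97]],
    [[91, 92, 95, 96], [79, 85, 86, 93, 94, 97]],
    [[89, 90, 95, 96], [76, 84, 86, 93, 94, 97]],
    [[95, 96], [86, 93, 94, 97]],
    [[83, 87, 89, 93, 94], [77, 78, 79, 85, 91, 92, 95], [74, 80, 81, 82, 88, 90, 96], [65, 72, 73, 75, 76, 84, 86, 97]],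
    [[92, 95, 96], [82, 88, 90, 97]],
    [[83, 87, 89, 93, 94], [77, 78, 79, 85, 91, 92, 95], [74, 80, 81, 82, 88, 90, 96], [65, 72, 73, 75, 76, 84, 86, 97]],
    [[92, 95, 96], [82, 88, 90, 97]],
    [[92, 95, 96], [82, 88, 90, 97]],
    [[91, 92, 95, 96], [79, 85, 86, 93, 94, 97]],
    [[92, 95, 96, 97]],
    [[91, 92, 95, 96], [79, 85, 86, 93, 94, 97]],
    [[91, 92, 95, 96], [79, 85, 86, 93, 94, 97]],
    [[92, 95, 96, 97]],
    [[92, 95, 96, 97]],
    [[92, 95, 96, 97]],
    [[92, 95, 96, 97]],
    [[92, 95, 96, 97]],
    [[89, 90, 95, 96], [76, 84, 86, 93, 94, 97]],
    [[90, 95, 96, 97]],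
    [[89, 90, 95, 96], [76, 84, 86, 93, 94, 97]],
    [[89, 90, 95, 96], [76, 84, 86, 93, 94, 97]],
    [[90, 95, 96, 97]],
    [[90, 95, 96, 97]],
    [[90, 95, 96, 97]],
    [[90, 95, 96, 97]],
    [[90, 95, 96, 97]],
    [[95, 96], [86, 93, 94, 97]],
    [[95, 96, 97]],
    [[95, 96], [86, 93, 94, 97]],
    [[95, 96], [86, 93, 94, 97]],
    [[95, 96], [86, 93, 94, 97]],
    [[95, 96], [86, 93, 94, 97]],
    [[95, 96], [86, 93, 94, 97]],
    [[94, 96, 97]],
    [[95, 96, 97]],
    [[95, 96, 97]],
    [[95, 96, 97]],
    [[95, 96, 97]],
    [[95, 96, 97]],
    [[95, 96, 97]],
    [[95, 96, 97]],
    [[95, 96, 97]],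
    [[95, 96, 97]],
    [[95, 96, 97]],
    [[96, 97]],
    [[95, 96, 97]],
    [[95, 96, 97]],
    [[95, 96, 97]],
    [[95, 96, 97]],
    [[95, 96, 97]],
    [[96, 97]],
    [[95, 96, 97]],
    [[96, 97]],
    [[95, 96, 97]],
    [[96, 97]],
    [[95, 96, 97]],
    [[95, 96, 97]],
    [[96, 97]],
    [[96, 97]],
    [[96, 97]]]"

text \<open>For fixed q the closure conditions amount to elements that p must contain: those with a
  right option outside q, and the left options of those outside q. So covering the downsets above
  this list covers all profiles with that q.\<close>

definition forced :: "bool list list \<Rightarrow> bool list list \<Rightarrow> bool list \<Rightarrow> bool list" where
  "forced lo ro q = fold (map2 (\<or>)) (map snd (filter (\<lambda>(b, r). \<not> b) (zip q lo))) (map (\<lambda>r. \<not> r \<sqsubseteq> q) ro)"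

definition covers_above :: "bool list list \<Rightarrow> bool list list list \<Rightarrow> bool list \<Rightarrow> bool" where
  "covers_above ds cs f \<longleftrightarrow> list_all (sorted_wrt (\<sqsubseteq>)) cs \<and>
     list_all (\<lambda>p. f \<sqsubseteq> p \<longrightarrow> list_ex (\<lambda>c. p \<in> set c) cs) ds"

definition chain_cover :: "bool list list \<Rightarrow> bool list list \<Rightarrow> bool list list \<Rightarrow> nat list list list \<Rightarrow> bool" where
  "chain_cover lo ro ds table \<longleftrightarrow>
     list_all2 (\<lambda>d t. covers_above ds (map (map (nth ds)) t) (forced lo ro (map Not d))) ds table"

lemma chain_cover_chain_table: "chain_cover lo2 ro2 (downsets dn2) chain_table"
  by code_simp

lemma lower_triangular_dn2: "lower_triangular dn2"
  by code_simp

lemma length_gs2: "length gs2 = 22"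
  by (simp add: gs2_def pairs2_def)

definition pair_le :: "bool list \<times> bool list \<Rightarrow> bool list \<times> bool list \<Rightarrow> bool" where
  "pair_le s t \<longleftrightarrow> fst s \<sqsubseteq> fst t \<and> snd t \<sqsubseteq> snd s"

lemma implies_list_refl: "p \<sqsubseteq> p"
  by (simp add: implies_list_iff)

lemma length_fold_map2:
  "(\<And>r. r \<in> set rs \<Longrightarrow> length r = length acc) \<Longrightarrow> length (fold (map2 (\<or>)) rs acc) = length acc"
  by (induction rs arbitrary: acc) auto

lemma nth_fold_map2:
  "(\<And>r. r \<in> set rs \<Longrightarrow> length r = length acc) \<Longrightarrow> i < length acc \<Longrightarrow>
     fold (map2 (\<or>)) rs acc ! i \<longleftrightarrow> acc ! i \<or> (\<exists>r\<in>set rs. r ! i)"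
  by (induction rs arbitrary: acc) auto

lemma (in day_system) forced_implies:
  assumes "is_profile p q"
  shows "forced lo ro q \<sqsubseteq> p"
proof -
  let ?rs = "map snd (filter (\<lambda>(b, r). \<not> b) (zip q lo))" and ?acc = "map (\<lambda>r. \<not> r \<sqsubseteq> q) ro"
  have len: "length p = m" "length q = m" using is_profile_length[OF assms] by auto
  have rs: "\<exists>k<m. \<not> q ! k \<and> r = lo ! k" if "r \<in> set ?rs" for r
    using that length_rows len by (auto simp: set_zip)
  then have lenr: "length r = length ?acc" if "r \<in> set ?rs" for r
    using that length_nth_row length_rows by fastforce
  have "p ! i" if i: "i < m" and f: "forced lo ro q ! i" for i
  proof (rule ccontr)
    assume np: "\<not> p ! i"
    have "fold (map2 (\<or>)) ?rs ?acc ! i \<longleftrightarrow> ?acc ! i \<or> (\<exists>r\<in>set ?rs. r ! i)"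
      by (rule nth_fold_map2[OF lenr]) (use i length_rows in auto)
    then have "?acc ! i \<or> (\<exists>r\<in>set ?rs. r ! i)"
      using f unfolding forced_def by blast
    then show False
    proof
      assume "?acc ! i"
      then have "\<not> ro ! i \<sqsubseteq> q" using i length_rows by simp
      then show False
        using is_profile_ro[OF assms i _ np] length_nth_row[OF i] len by (auto simp: implies_list_iff)
    next
      assume "\<exists>r\<in>set ?rs. r ! i"
      then obtain k where "k < m" "\<not> q ! k" "lo ! k ! i" using rs by blast
      then show False using is_profile_lo[OF assms _ i] np by blast
    qed
  qed
  moreover have "length (fold (map2 (\<or>)) ?rs ?acc) = length ?acc"
    by (rule length_fold_map2[OF lenr])
  then have "length (forced lo ro q) = m"
    unfolding forced_def using length_rows by simp
  ultimately show ?thesis using len unfolding implies_list_iff by simp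
qed

text \<open>Along a chain q is fixed and p grows, so the order of games on it is inclusion of first
  components.\<close>

definition chains3 :: "(bool list \<times> bool list) list list" where
  "chains3 = concat (map2 (\<lambda>d t. map (map (\<lambda>k. (downsets dn2 ! k, map Not d))) t) (downsets dn2) chain_table)"

lemma length_downsets_chain_table: "length (downsets dn2) = length chain_table"
  using chain_cover_chain_table by (auto simp: chain_cover_def dest: list_all2_lengthD)

lemma chains3_iff:
  "c \<in> set chains3 \<longleftrightarrow> (\<exists>j < length chain_table. \<exists>t \<in> set (chain_table ! j).
     c = map (\<lambda>k. (downsets dn2 ! k, map Not (downsets dn2 ! j))) t)"
  using length_downsets_chain_table by (fastforce simp: chains3_def set_zip)

lemma covers_above_chain_table:
  "j < length chain_table \<Longrightarrow> covers_above (downsets dn2) (map (map (nth (downsets dn2))) (chain_table ! j))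
     (forced lo2 ro2 (map Not (downsets dn2 ! j)))"
  using chain_cover_chain_table length_downsets_chain_table
  by (simp add: chain_cover_def list_all2_conv_all_nth)

lemma sorted_chains3:
  assumes "c \<in> set chains3"
  shows "sorted_wrt pair_le c"
proof -
  obtain j t where j: "j < length chain_table" "t \<in> set (chain_table ! j)"
    and c: "c = map (\<lambda>k. (downsets dn2 ! k, map Not (downsets dn2 ! j))) t"
    using assms by (auto simp: chains3_iff)
  have "sorted_wrt (\<sqsubseteq>) (map (nth (downsets dn2)) t)"
    using covers_above_chain_table[OF j(1)] j(2) by (auto simp: covers_above_def list_all_iff)
  then show ?thesis by (simp add: c sorted_wrt_map pair_le_def implies_list_refl)
qed

lemma profile_in_chains3:
  assumes "day2.is_profile p q"
  shows "(p, q) \<in> \<Union> (set ` set chains3)"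
proof -
  let ?ds = "downsets dn2"
  have tri: "j \<le> i" if "i < length gs2" "j < length gs2" "dn2 ! i ! j" for i j
    using that lower_triangularD[OF lower_triangular_dn2, of i j] day2.length_rows day2.length_nth_row by simp
  have p: "p \<in> set ?ds" and "map Not q \<in> set ?ds"
    using day2.is_profile_in_downsets[OF tri assms] by blast+
  then obtain j where j: "j < length chain_table" "map Not q = ?ds ! j"
    using length_downsets_chain_table by (auto simp: in_set_conv_nth)
  have q: "q = map Not (?ds ! j)" unfolding j(2)[symmetric] by (simp add: comp_def)
  have "list_ex (\<lambda>c. p \<in> set c) (map (map (nth ?ds)) (chain_table ! j))"
    using covers_above_chain_table[OF j(1)] p day2.forced_implies[OF assms]
    unfolding covers_above_def list_all_iff q by blast
  then obtain t k where "t \<in> set (chain_table ! j)" "k \<in> set t" "p = ?ds ! k"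
    by (auto simp: list_ex_iff)
  moreover from this have "map (\<lambda>k. (?ds ! k, q)) t \<in> set chains3"
    unfolding chains3_iff q using j(1) by blast
  ultimately show ?thesis by force
qed

text \<open>The lengths depend on the table alone, which avoids evaluating the downsets
  again.\<close>

lemma map_length_chains3: "map length chains3 = concat (map (map length) chain_table)"
proof -
  have "map length (concat (map2 (\<lambda>d t. map (map (\<lambda>k. (ds ! k, map Not d))) t) xs ts)) = concat (map (map length) ts)"
    if "length xs = length ts" for ds xs :: "bool list list" and ts :: "nat list list list"
    using that by (induction xs ts rule: list_induct2) (simp_all add: o_def)
  then show ?thesis using length_downsets_chain_table by (simp add: chains3_def)
qed

lemma map_length_chain_table:
  "concat (map (map length) chain_table) =
    [16, 18, 20, 14, 11, 8, 11, 16, 18, 20, 14, 11, 8, 11, 15, 14, 18, 13, 11, 8, 11, 13, 11, 9, 11, 5, 7, 12, 11,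
     13, 6, 6, 5, 9, 10, 5, 6, 5, 9, 10, 5, 3, 5, 11, 8, 9, 10, 11, 11, 8, 9, 10, 10, 7, 8, 9, 10, 9, 7, 8, 10, 5,
     7, 7, 8, 5, 7, 7, 8, 3, 4, 11, 8, 9, 10, 10, 7, 8, 9, 10, 7, 8, 9, 10, 4, 7, 9, 7, 8, 10, 9, 7, 8, 10, 4, 7,
     5, 7, 7, 8, 5, 7, 7, 8, 3, 4, 5, 7, 7, 8, 4, 6, 5, 7, 7, 8, 3, 4, 4, 6, 4, 5, 7, 7, 8, 4, 6, 5, 7, 7, 8, 3, 4,
     4, 6, 4, 5, 7, 7, 8, 4, 6, 4, 6, 2, 4, 5, 7, 7, 8, 3, 4, 5, 7, 7, 8, 3, 4, 3, 4, 4, 6, 4, 4, 6, 4, 6, 4, 4, 4,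
     4, 4, 4, 6, 4, 4, 6, 4, 6, 4, 4, 4, 4, 4, 2, 4, 3, 2, 4, 2, 4, 2, 4, 2, 4, 2, 4, 3, 3, 3, 3, 3, 3, 3, 3, 3, 3,
     3, 2, 3, 3, 3, 3, 3, 2, 3, 2, 3, 2, 3, 3, 2, 2, 2]"
  by code_simp

lemma length_concat_chains3: "length (concat chains3) = 1474"
  unfolding length_concat map_length_chains3 map_length_chain_table by simp

text \<open>The exponent 622 bounds the product, over all chains, of length plus one: each chain
  contributes one of its entries or none.\<close>

lemma card_choices_chains3: "card (choices chains3) \<le> 2 ^ 622"
proof -
  have "card (choices chains3) \<le> prod_list (map Suc (map length chains3))"
    using card_choices_le[of chains3] by (simp add: o_def)
  also have "\<dots> \<le> 2 ^ 622"
    unfolding map_length_chains3 map_length_chain_table by simp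
  finally show ?thesis .
qed

section \<open>Upper bound for day 3\<close>

definition chains2 :: "nat list list" where
  "chains2 = [[5, 7, 10, 14, 18], [2, 4, 8, 11, 13, 16, 19], [12, 15, 17, 20], [0, 1, 3, 6, 9, 21]]"

lemma sorted_chains2: "c \<in> set chains2 \<Longrightarrow> sorted_wrt (\<lambda>i j. up2 ! i ! j) c"
proof -
  have "list_all (sorted_wrt (\<lambda>i j. up2 ! i ! j)) chains2" by code_simp
  then show "c \<in> set chains2 \<Longrightarrow> sorted_wrt (\<lambda>i j. up2 ! i ! j) c" by (simp add: list_all_iff)
qed

lemma set_chains2: "\<Union> (set ` set chains2) = {..<22}"
  by (auto simp: chains2_def) presburger

lemma placement_F_3_le: "placement_F 3 \<le> 74"
proof (rule placement_F_le)
  fix G assume G: "birthday G \<le> 3"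
  obtain E :: "(unit ext ext \<times> unit ext ext) set" and c V S where real: "realizes E c V S gs2" "card V \<le> 30"
    using realizes_day2 by blast
  have V: "finite V" "\<And>i. i < 22 \<Longrightarrow> V \<inter> S i = S i" "\<And>i. i < 22 \<Longrightarrow> pos E c (S i) \<approx> gs2 ! i"
    using real(1) by (auto simp: realizes_def length_gs2)
  \<comment> \<open>The guard makes the relation reflexive on all natural numbers, as
    \<open>chain_maxima\<close> requires.\<close>
  let ?le = "\<lambda>i j. (i < 22 \<and> j < 22 \<longrightarrow> gs2 ! i \<preceq> gs2 ! j)"
  have sorted: "sorted_wrt ?le ch" if "ch \<in> set chains2" for ch
    using sorted_chains2[OF that] by (rule sorted_wrt_mono_rel[rotated]) (auto simp: day2.up length_gs2)
  have rep: "\<exists>i<22. x \<approx> gs2 ! i" if "x |\<in>| left_opts G \<or> x |\<in>| right_opts G" for x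
    using birthday_option_less[OF that G] day2.complete[of x] by (simp add: length_gs2)
  let ?P = "{i. i < 22 \<and> (\<exists>x |\<in>| left_opts G. x \<approx> gs2 ! i)}" and ?Q = "{i. i < 22 \<and> (\<exists>x |\<in>| right_opts G. x \<approx> gs2 ! i)}"
  \<comment> \<open>Four chains cover day 2, so four selectors per colour are enough.\<close>
  have "\<exists>I\<in>choices chains2. I \<subseteq> ?P \<and> (\<forall>x\<in>?P. \<exists>y\<in>I. ?le x y)"
    by (rule chain_maxima) (use sorted set_chains2 in auto)
  then obtain I where I: "I \<in> choices chains2" "I \<subseteq> ?P" "\<forall>x\<in>?P. \<exists>y\<in>I. ?le x y" by blast
  have "\<exists>J\<in>choices chains2. J \<subseteq> ?Q \<and> (\<forall>x\<in>?Q. \<exists>y\<in>J. ?le y x)"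
    by (rule chain_minima) (use sorted set_chains2 in auto)
  then obtain J where J: "J \<in> choices chains2" "J \<subseteq> ?Q" "\<forall>x\<in>?Q. \<exists>y\<in>J. ?le y x" by blast
  have fin: "finite I" "finite J" using I(1) J(1) finite_in_choices by blast+
  have card: "card I \<le> 4" "card J \<le> 4"
    using card_in_choices_le[OF I(1)] card_in_choices_le[OF J(1)] by (simp_all add: chains2_def)
  have "pos (ext_arcs E c (\<lambda>_. S)) (ext_colour c) (ext_set V I J (Suc 3)) \<approx> G"
  proof (rule pos_ext_set_values[OF V(1) fin G])
    fix i assume "i \<in> I"
    then obtain x where "i < 22" "x |\<in>| left_opts G" "x \<approx> gs2 ! i" using I(2) by blast
    then show "\<exists>x |\<in>| left_opts G. pos E c (V \<inter> S i) \<approx> x"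
      using V(2,3) game_equiv_trans game_equiv_sym by metis
  next
    fix i assume "i \<in> J"
    then obtain x where "i < 22" "x |\<in>| right_opts G" "x \<approx> gs2 ! i" using J(2) by blast
    then show "\<exists>x |\<in>| right_opts G. pos E c (V \<inter> S i) \<approx> x"
      using V(2,3) game_equiv_trans game_equiv_sym by metis
  next
    fix x assume x: "x |\<in>| left_opts G"
    then obtain i where i: "i < 22" "x \<approx> gs2 ! i" using rep by blast
    then obtain j where j: "j \<in> I" "?le i j" using x I(3) by blast
    then have "j < 22" using I(2) by blast
    then have "x \<preceq> pos E c (V \<inter> S j)"
      using i j V(2,3)[of j] game_le_trans[OF game_equiv_le game_le_trans] game_equiv_ge by auto
    then show "\<exists>i\<in>I. x \<preceq> pos E c (V \<inter> S i)" using j(1) by blast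
  next
    fix x assume x: "x |\<in>| right_opts G"
    then obtain i where i: "i < 22" "x \<approx> gs2 ! i" using rep by blast
    then obtain j where j: "j \<in> J" "?le j i" using x J(3) by blast
    then have "j < 22" using J(2) by blast
    then have "pos E c (V \<inter> S j) \<preceq> x"
      using i j V(2,3)[of j] game_le_trans[OF game_equiv_le game_le_trans] game_equiv_ge by auto
    then show "\<exists>i\<in>J. pos E c (V \<inter> S i) \<preceq> x" using j(1) by blast
  qed
  then have "realized_by G (card (ext_set V I J (Suc 3)))"
    using V(1) fin by (intro realized_byI[OF finite_ext_set])
  \<comment> \<open>The count is 30 + 4 + 4 + 4 * 4 = 54.\<close>
  moreover have "card (ext_set V I J (Suc 3)) \<le> 74"
    using card_ext_set_le[OF V(1) fin, of "Suc 3"] card real(2) by simp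
  ultimately show "\<exists>n\<le>74. realized_by G n" by blast
qed

text \<open>The filter yields the length condition of \<open>realizes_Suc\<close> at once, without
  checking the 1474 entries.\<close>

definition reps3 :: "(bool list \<times> bool list) list" where
  "reps3 = filter (\<lambda>(p, q). length p = length gs2 \<and> length q = length gs2) (concat chains3)"

lemma length_reps3: "length reps3 \<le> 1474"
  using length_filter_le[of _ "concat chains3"] by (simp add: reps3_def length_concat_chains3)

lemma profile_in_reps3: "day2.is_profile p q \<Longrightarrow> (p, q) \<in> set reps3"
  using profile_in_chains3[of p q] day2.is_profile_length[of p q] by (auto simp: reps3_def)

lemma realizes_day3:
  "\<exists>(E :: (unit ext ext ext \<times> unit ext ext ext) set) c V S. realizes E c V S (map day2.pair_game reps3) \<and> card V \<le> 90"
proof -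
  obtain E :: "(unit ext ext \<times> unit ext ext) set" and c V S where real: "realizes E c V S gs2" "card V \<le> 30"
    using realizes_day2 by blast
  have "length p = length gs2 \<and> length q = length gs2" if "(p, q) \<in> set reps3" for p q
    using that by (simp add: reps3_def)
  from day2.realizes_Suc[where ps = reps3, OF real(1) this, unfolded length_gs2]
  obtain E' :: "(unit ext ext ext \<times> unit ext ext ext) set" and c' S'
    where "realizes E' c' (ext_set V {..<22} {..<22} (Suc (Suc 2))) S' (map day2.pair_game reps3)"
    by (rule that) simp
  moreover have "card (ext_set V {..<22} {..<22} (Suc (Suc 2))) \<le> 90"
    using card_ext_set_le[of V "{..<22}" "{..<22}" "Suc (Suc 2)"] real by (simp add: realizes_def)
  ultimately show ?thesis by blast
qed

text \<open>The chain cover is applied to the profiles of the options: the last one on each chain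
  for Left and the first one for Right lose nothing up to domination.\<close>

lemma choices_for_opts:
  assumes "birthday G \<le> 4"
  shows "\<exists>X \<in> choices chains3. X \<subseteq> set reps3 \<and>
      (\<forall>s\<in>X. \<exists>x |\<in>| left_opts G. x \<approx> day2.pair_game s) \<and> (\<forall>x |\<in>| left_opts G. \<exists>s\<in>X. x \<preceq> day2.pair_game s)" (is ?l)
    and "\<exists>X \<in> choices chains3. X \<subseteq> set reps3 \<and>
      (\<forall>s\<in>X. \<exists>x |\<in>| right_opts G. x \<approx> day2.pair_game s) \<and> (\<forall>x |\<in>| right_opts G. \<exists>s\<in>X. day2.pair_game s \<preceq> x)" (is ?r)
proof -
  have prof: "day2.is_profile (fst (day2.profile x)) (snd (day2.profile x))" "x \<approx> day2.pair_game (day2.profile x)"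
    if "x |\<in>| left_opts G \<or> x |\<in>| right_opts G" for x
    using birthday_option_less[OF that assms] day2.is_profile_profile[of x] day2.equiv_pair_game_profile[of x] by simp_all
  have refl: "pair_le s s" for s by (simp add: pair_le_def implies_list_refl)
  have le: "day2.pair_game (day2.profile x) \<preceq> day2.pair_game (day2.profile y)"
    if "pair_le (day2.profile x) (day2.profile y)"
      "x |\<in>| left_opts G \<or> x |\<in>| right_opts G" "y |\<in>| left_opts G \<or> y |\<in>| right_opts G" for x y
    using day2.pair_game_le_iff[OF prof(1)[OF that(2)] prof(1)[OF that(3)]] that(1) by (simp add: pair_le_def)
  have mem: "day2.profile x \<in> set reps3" "day2.profile x \<in> \<Union> (set ` set chains3)"
    if "x |\<in>| left_opts G \<or> x |\<in>| right_opts G" for x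
    using profile_in_reps3[OF prof(1)[OF that]] profile_in_chains3[OF prof(1)[OF that]] by simp_all
  have subl: "day2.profile ` fset (left_opts G) \<subseteq> set reps3" "day2.profile ` fset (left_opts G) \<subseteq> \<Union> (set ` set chains3)"
    and subr: "day2.profile ` fset (right_opts G) \<subseteq> set reps3" "day2.profile ` fset (right_opts G) \<subseteq> \<Union> (set ` set chains3)"
    by (rule image_subsetI, rule mem, simp)+
  have "\<exists>X\<in>choices chains3. X \<subseteq> day2.profile ` fset (left_opts G) \<and>
      (\<forall>x\<in>day2.profile ` fset (left_opts G). \<exists>y\<in>X. pair_le x y)"
    by (rule chain_maxima[OF sorted_chains3 refl subl(2)])
  then obtain X where X: "X \<in> choices chains3" "X \<subseteq> day2.profile ` fset (left_opts G)"
    "\<forall>x\<in>day2.profile ` fset (left_opts G). \<exists>y\<in>X. pair_le x y"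
    by (elim bexE conjE)
  have "\<exists>s\<in>X. x \<preceq> day2.pair_game s" if x: "x |\<in>| left_opts G" for x
  proof -
    obtain y where y: "y |\<in>| left_opts G" "day2.profile y \<in> X" "pair_le (day2.profile x) (day2.profile y)"
      using X x by blast
    then show ?thesis using le[OF y(3)] x prof(2)[of x] game_le_trans game_equiv_le by blast
  qed
  moreover have "\<exists>x |\<in>| left_opts G. x \<approx> day2.pair_game s" if "s \<in> X" for s
    using X(2) that prof(2) by blast
  ultimately show ?l
    by (intro bexI[OF _ X(1)] conjI ballI subset_trans[OF X(2) subl(1)])
  have "\<exists>Y\<in>choices chains3. Y \<subseteq> day2.profile ` fset (right_opts G) \<and>
      (\<forall>x\<in>day2.profile ` fset (right_opts G). \<exists>y\<in>Y. pair_le y x)"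
    by (rule chain_minima[OF sorted_chains3 refl subr(2)])
  then obtain Y where Y: "Y \<in> choices chains3" "Y \<subseteq> day2.profile ` fset (right_opts G)"
    "\<forall>x\<in>day2.profile ` fset (right_opts G). \<exists>y\<in>Y. pair_le y x"
    by (elim bexE conjE)
  have "\<exists>s\<in>Y. day2.pair_game s \<preceq> x" if x: "x |\<in>| right_opts G" for x
  proof -
    obtain y where y: "y |\<in>| right_opts G" "day2.profile y \<in> Y" "pair_le (day2.profile y) (day2.profile x)"
      using Y x by blast
    then show ?thesis using le[OF y(3)] x prof(2)[of x] game_le_trans game_equiv_ge by blast
  qed
  moreover have "\<exists>x |\<in>| right_opts G. x \<approx> day2.pair_game s" if "s \<in> Y" for s
    using Y(2) that prof(2) by blast
  ultimately show ?r
    by (intro bexI[OF _ Y(1)] conjI ballI subset_trans[OF Y(2) subr(1)])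
qed

definition indices :: "(bool list \<times> bool list) set \<Rightarrow> nat set" where
  "indices X = {i. i < length reps3 \<and> reps3 ! i \<in> X}"

text \<open>Arcs and colours are independent of G; only the sets of selectors kept vary with it. Day
  5 depends on this, since positions in one common digraph can be intersected.\<close>

lemma realized_day4:
  assumes "realizes E c V S (map day2.pair_game reps3)" "birthday G \<le> 4"
  shows "\<exists>X \<in> choices chains3. \<exists>Y \<in> choices chains3.
     pos (ext_arcs E c (\<lambda>_. S)) (ext_colour c) (ext_set V (indices X) (indices Y) 5) \<approx> G"
proof -
  have V: "finite V" "\<And>i. i < length reps3 \<Longrightarrow> V \<inter> S i = S i"
    "\<And>i. i < length reps3 \<Longrightarrow> pos E c (S i) \<approx> day2.pair_game (reps3 ! i)"
    using assms(1) by (auto simp: realizes_def)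
  obtain X where X: "X \<in> choices chains3" "X \<subseteq> set reps3"
    "\<And>s. s \<in> X \<Longrightarrow> \<exists>x |\<in>| left_opts G. x \<approx> day2.pair_game s"
    "\<And>x. x |\<in>| left_opts G \<Longrightarrow> \<exists>s\<in>X. x \<preceq> day2.pair_game s"
    using choices_for_opts(1)[OF assms(2)] by blast
  obtain Y where Y: "Y \<in> choices chains3" "Y \<subseteq> set reps3"
    "\<And>s. s \<in> Y \<Longrightarrow> \<exists>x |\<in>| right_opts G. x \<approx> day2.pair_game s"
    "\<And>x. x |\<in>| right_opts G \<Longrightarrow> \<exists>s\<in>Y. day2.pair_game s \<preceq> x"
    using choices_for_opts(2)[OF assms(2)] by blast
  have "pos (ext_arcs E c (\<lambda>_. S)) (ext_colour c) (ext_set V (indices X) (indices Y) (Suc 4)) \<approx> G"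
  proof (rule pos_ext_set_values[OF V(1) _ _ assms(2)])
    fix i assume "i \<in> indices X"
    then have i: "i < length reps3" "reps3 ! i \<in> X" by (auto simp: indices_def)
    then obtain x where "x |\<in>| left_opts G" "x \<approx> day2.pair_game (reps3 ! i)" using X(3) by blast
    moreover from this have "pos E c (V \<inter> S i) \<approx> x"
      unfolding V(2)[OF i(1)] using V(3)[OF i(1)] game_equiv_trans game_equiv_sym by blast
    ultimately show "\<exists>x |\<in>| left_opts G. pos E c (V \<inter> S i) \<approx> x" by blast
  next
    fix i assume "i \<in> indices Y"
    then have i: "i < length reps3" "reps3 ! i \<in> Y" by (auto simp: indices_def)
    then obtain x where "x |\<in>| right_opts G" "x \<approx> day2.pair_game (reps3 ! i)" using Y(3) by blast
    moreover from this have "pos E c (V \<inter> S i) \<approx> x"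
      unfolding V(2)[OF i(1)] using V(3)[OF i(1)] game_equiv_trans game_equiv_sym by blast
    ultimately show "\<exists>x |\<in>| right_opts G. pos E c (V \<inter> S i) \<approx> x" by blast
  next
    fix x assume "x |\<in>| left_opts G"
    then obtain i where i: "i < length reps3" "reps3 ! i \<in> X" "x \<preceq> day2.pair_game (reps3 ! i)"
      using X(2) X(4)[of x] by (fastforce simp: in_set_conv_nth)
    then have "x \<preceq> pos E c (V \<inter> S i)"
      using game_le_trans[OF i(3) game_equiv_ge[OF V(3)[OF i(1)]]] V(2)[OF i(1)] by simp
    then show "\<exists>i\<in>indices X. x \<preceq> pos E c (V \<inter> S i)" using i by (auto simp: indices_def)
  next
    fix x assume "x |\<in>| right_opts G"
    then obtain i where i: "i < length reps3" "reps3 ! i \<in> Y" "day2.pair_game (reps3 ! i) \<preceq> x"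
      using Y(2) Y(4)[of x] by (fastforce simp: in_set_conv_nth)
    then have "pos E c (V \<inter> S i) \<preceq> x"
      using game_le_trans[OF game_equiv_le[OF V(3)[OF i(1)]] i(3)] V(2)[OF i(1)] by simp
    then show "\<exists>i\<in>indices Y. pos E c (V \<inter> S i) \<preceq> x" using i by (auto simp: indices_def)
  qed (simp_all add: indices_def)
  then show ?thesis using X(1) Y(1) by auto
qed

lemma finite_indices: "finite (indices X)" and indices_subset: "indices X \<subseteq> {..<length reps3}"
  by (auto simp: indices_def)

lemma placement_F_4_le: "placement_F 4 \<le> 13439"
proof (rule placement_F_le)
  fix G assume G: "birthday G \<le> 4"
  obtain E :: "(unit ext ext ext \<times> unit ext ext ext) set" and c V S
    where real: "realizes E c V S (map day2.pair_game reps3)" "card V \<le> 90"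
    using realizes_day3 by blast
  then have V: "finite V" by (simp add: realizes_def)
  obtain X Y where "pos (ext_arcs E c (\<lambda>_. S)) (ext_colour c) (ext_set V (indices X) (indices Y) 5) \<approx> G"
    using realized_day4[OF real(1) G] by blast
  then have "realized_by G (card (ext_set V (indices X) (indices Y) 5))"
    using V finite_indices by (intro realized_byI[OF finite_ext_set])
  moreover have indices: "card (indices Z) \<le> 1474" for Z
    using card_mono[OF _ indices_subset, of Z] length_reps3 by simp
  \<comment> \<open>The count is 90 + 1474 + 1474 + 4 * 5 = 3058.\<close>
  have "card (ext_set V (indices X) (indices Y) 5) \<le> 13439"
    using card_ext_set_le[OF V finite_indices finite_indices, of X Y 5] real(2) indices[of X] indices[of Y]
    by linarith
  ultimately show "\<exists>n\<le>13439. realized_by G n" by blast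
qed

section \<open>Upper bound for day 5\<close>

lemma realized_day5:
  assumes "birthday G \<le> 5"
  shows "\<exists>n \<le> 4 * card (choices chains3) + 3160. realized_by G n"
proof -
  obtain E :: "(unit ext ext ext \<times> unit ext ext ext) set" and c V S
    where real: "realizes E c V S (map day2.pair_game reps3)" "card V \<le> 90"
    using realizes_day3 by blast
  then have V: "finite V" by (simp add: realizes_def)
  let ?E = "ext_arcs E c (\<lambda>_. S)" and ?c = "ext_colour c" and ?L = "{..<length reps3}"
  let ?M = "card (choices chains3)" and ?V = "ext_set V ?L ?L 5"
  obtain f where f: "bij_betw f {..<?M} (choices chains3)"
    using ex_bij_betw_nat_finite[OF finite_choices[of chains3]] by (auto simp: lessThan_atLeast0)
  \<comment> \<open>?U fixes Left's selectors and ?W fixes Right's, each keeping all selectors of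
    the other player; their intersection fixes both.\<close>
  let ?U = "\<lambda>i. ext_set V (indices (f i)) ?L 5" and ?W = "\<lambda>j. ext_set V ?L (indices (f j)) 5"
  have "\<exists>n \<le> card ?V + 4 * ?M + 102. realized_by G n"
  proof (rule two_stage_realized[where U = ?U and W = ?W and E = ?E and c = ?c])
    show "finite ?V" using V by (simp add: finite_ext_set)
    show "?U i \<subseteq> ?V" for i using indices_subset by (intro ext_set_mono) auto
    \<comment> \<open>Every ?U i contains the whole gadget, whose groups of five are integers large
      enough as threats for a game born by day 5.\<close>
    show "Gad Blue False ` {..<5} \<union> Gad Red False ` {..<5} \<subseteq> ?U i" for i by auto
    show "pos ?E ?c (Gad Blue False ` {..<5}) \<approx> pos_int 5" "pos ?E ?c (Gad Red False ` {..<5}) \<approx> neg_int 5"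
      by (rule pos_gadget_stock)+
    show "birthday G \<le> 5" by (rule assms)
    fix x assume "x |\<in>| left_opts G \<or> x |\<in>| right_opts G"
    then have "birthday x \<le> 4" using birthday_option_less[of x G 5] assms by simp
    then obtain X Y where XY: "X \<in> choices chains3" "Y \<in> choices chains3"
      "pos ?E ?c (ext_set V (indices X) (indices Y) 5) \<approx> x"
      using realized_day4[OF real(1)] by blast
    obtain i where i: "i < ?M" "X = f i" using XY(1) f by (auto simp: bij_betw_def)
    obtain j where j: "j < ?M" "Y = f j" using XY(2) f by (auto simp: bij_betw_def)
    have "?U i \<inter> ?W j = ext_set V (indices X) (indices Y) 5"
      using indices_subset[of X] indices_subset[of Y] i j by (simp add: ext_set_Int Int_absorb1 Int_absorb2)
    then show "\<exists>i<?M. \<exists>j<?M. pos ?E ?c (?U i \<inter> ?W j) \<approx> x" using i j XY(3) by (intro exI[of _ i] exI[of _ j] conjI) simp_all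
  qed
  then obtain n where n: "n \<le> card ?V + 4 * ?M + 102" "realized_by G n" by blast
  have "card ?V \<le> 3058"
    using card_ext_set_le[OF V, of ?L ?L 5] length_reps3 real(2) by simp
  then have "n \<le> 4 * ?M + 3160" using n(1) by linarith
  then show ?thesis using n(2) by blast
qed

lemma placement_F_5_le: "real (placement_F 5) \<le> 1.08 * 10 ^ 189"
proof -
  have "placement_F 5 \<le> 4 * card (choices chains3) + 3160"
    by (rule placement_F_le) (rule realized_day5)
  also have "\<dots> \<le> 4 * 2 ^ 622 + 3160" using card_choices_chains3 by simp
  finally have "real (placement_F 5) \<le> real (4 * 2 ^ 622 + 3160)" by (simp only: of_nat_le_iff)
  also have "\<dots> \<le> 1.08 * 10 ^ 189" by simp
  finally show ?thesis .
qed

section \<open>Lower bounds for days 4 and 5\<close>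

text \<open>Elements of S are not reversible, so each must be dominated by an element of S', which
  in an antichain can only be itself.\<close>

lemma (in hot_game) hot_le_hot:
  assumes "\<And>x y. x |\<in>| A \<Longrightarrow> y |\<in>| A \<Longrightarrow> x \<preceq> y \<Longrightarrow> x = y"
    and "S |\<subseteq>| A" "S' |\<subseteq>| A" "Game S {|neg_int n|} \<preceq> Game S' {|neg_int n|}"
  shows "S |\<subseteq>| S'"
proof
  interpret S': hot_game n S' by unfold_locales (use assms birthday_A in blast)
  fix x assume x: "x |\<in>| S"
  then have "\<not> S'.hot \<preceq> x" using game_le_left[OF assms(4)] by (simp add: S'.hot_def)
  then obtain y where "y |\<in>| S'" "x \<preceq> y" using S'.not_hot_le_iff birthday_A x assms(2) by blast
  then show "x |\<in>| S'" using assms(1)[of x y] x assms(2,3) by blast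
qed

lemma (in hot_game) birthday_le_Suc_if_subset: "S |\<subseteq>| A \<Longrightarrow> birthday (Game S {|neg_int n|}) \<le> Suc n"
  using birthday_A birthday_neg_int by (auto simp: birthday_le_Suc_iff)

section \<open>An antichain of 66 games born by day 3\<close>

definition trues :: "bool list \<Rightarrow> nat" where
  "trues p = length (filter (\<lambda>b. b) p)"

lemma trues_Cons [simp]: "trues (b # p) = of_bool b + trues p" and trues_Nil [simp]: "trues [] = 0"
  by (simp_all add: trues_def)

lemma trues_mono: "p \<sqsubseteq> q \<Longrightarrow> trues p \<le> trues q"
  and implies_list_trues_eq: "p \<sqsubseteq> q \<Longrightarrow> trues p = trues q \<Longrightarrow> p = q"
proof -
  have "list_all2 (\<longrightarrow>) p q \<Longrightarrow> trues p \<le> trues q \<and> (trues p = trues q \<longrightarrow> p = q)"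
    by (induction rule: list_all2_induct) auto
  then show "p \<sqsubseteq> q \<Longrightarrow> trues p \<le> trues q" "p \<sqsubseteq> q \<Longrightarrow> trues p = trues q \<Longrightarrow> p = q"
    by (auto simp: implies_list_def)
qed

definition antichain_table :: "(nat \<times> nat) list" where
  "antichain_table = [
    (97, 1), (96, 2), (94, 3), (95, 3), (94, 4), (95, 4), (90, 5), (92, 5),
    (93, 5), (86, 6), (88, 6), (89, 6), (91, 6), (82, 7), (96, 8), (94, 9),
    (95, 9), (90, 10), (92, 10), (93, 10), (90, 11), (92, 11), (93, 11), (86, 12),
    (88, 12), (89, 12), (91, 12), (84, 13), (85, 13), (87, 13), (90, 15), (92, 15),
    (93, 15), (86, 16), (88, 16), (89, 16), (91, 16), (84, 17), (85, 17), (87, 17),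
    (86, 19), (88, 19), (89, 19), (91, 19), (84, 20), (85, 20), (87, 20), (84, 22),
    (85, 22), (87, 22), (76, 23), (79, 23), (83, 23), (76, 25), (79, 25), (83, 25),
    (75, 27), (78, 27), (76, 31), (79, 31), (83, 31), (75, 33), (78, 33), (75, 37),
    (78, 37), (73, 41)]"

text \<open>An entry \<open>(i, j)\<close> stands for the pair of the \<open>i\<close>-th downset and the complement of the \<open>j\<close>-th.\<close>

definition nth_pair :: "bool list list \<Rightarrow> nat \<times> nat \<Rightarrow> bool list \<times> bool list" where
  "nth_pair ds = (\<lambda>(i, j). (ds ! i, map Not (ds ! j)))"

definition antichain_pairs :: "(bool list \<times> bool list) list" where
  "antichain_pairs = map (nth_pair (downsets dn2)) antichain_table"

text \<open>The representative \<open>gs2 ! 19\<close> is the integer 1.\<close>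

definition good_pairs where
  "good_pairs dn up lo ro ps \<longleftrightarrow> distinct ps \<and> list_all (\<lambda>(p, q). closed_pair dn up lo ro p q \<and> trues p = Suc (trues q) \<and>
     list_ex (\<lambda>(b, l, r). b \<and> l ! 19 \<and> r \<sqsubseteq> q) (zip p (zip lo ro))) ps"

lemma good_pairs_antichain_pairs: "good_pairs dn2 up2 lo2 ro2 antichain_pairs"
  by code_simp

lemma length_antichain_pairs: "length antichain_pairs = 66"
  by (simp add: antichain_pairs_def antichain_table_def)

definition antichain_games :: "game fset" where
  "antichain_games = fset_of_list (map day2.pair_game antichain_pairs)"

lemma in_antichain_gamesE:
  assumes "x |\<in>| antichain_games"
  obtains p q i where "(p, q) \<in> set antichain_pairs" "x = day2.pair_game (p, q)" "day2.is_profile p q"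
    "trues p = Suc (trues q)" "i < length gs2" "p ! i" "lo2 ! i ! 19" "ro2 ! i \<sqsubseteq> q"
proof -
  obtain p q where pq: "(p, q) \<in> set antichain_pairs" "x = day2.pair_game (p, q)"
    using assms by (auto simp: antichain_games_def fset_of_list_elem)
  then have *: "day2.is_profile p q" "trues p = Suc (trues q)"
    "list_ex (\<lambda>(b, l, r). b \<and> l ! 19 \<and> r \<sqsubseteq> q) (zip p (zip lo2 ro2))"
    using good_pairs_antichain_pairs by (auto simp: good_pairs_def list_all_iff)
  then obtain i where "i < length gs2" "p ! i" "lo2 ! i ! 19" "ro2 ! i \<sqsubseteq> q"
    using day2.is_profile_length[OF *(1)] day2.length_rows by (auto simp: list_ex_length)
  then show ?thesis using that pq * by blast
qed

text \<open>The difference \<open>trues p - trues q\<close> is a rank that increases strictly with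
  the game, and all pairs of the table have rank 1.\<close>

lemma antichain_games_le:
  assumes "(p, q) \<in> set antichain_pairs" "(p', q') \<in> set antichain_pairs"
    "day2.pair_game (p, q) \<preceq> day2.pair_game (p', q')"
  shows "(p, q) = (p', q')"
proof -
  have *: "day2.is_profile p q" "trues p = Suc (trues q)" "day2.is_profile p' q'" "trues p' = Suc (trues q')"
    using assms(1,2) good_pairs_antichain_pairs by (auto simp: good_pairs_def list_all_iff)
  then have "p \<sqsubseteq> p'" "q' \<sqsubseteq> q" using assms(3) day2.pair_game_le_iff by blast+
  moreover from this have "trues p \<le> trues p'" "trues q' \<le> trues q" using trues_mono by blast+
  ultimately show ?thesis using * implies_list_trues_eq by fastforce
qed

lemma fcard_antichain_games: "fcard antichain_games = 66"
proof -
  have "inj_on day2.pair_game (set antichain_pairs)"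
    by (rule inj_onI) (metis antichain_games_le game_le_refl prod.collapse)
  then have "card (day2.pair_game ` set antichain_pairs) = length antichain_pairs"
    using good_pairs_antichain_pairs by (simp add: card_image good_pairs_def distinct_card)
  then show ?thesis by (simp add: antichain_games_def fcard.rep_eq fset_of_list.rep_eq length_antichain_pairs)
qed

lemma gs2_19: "gs2 ! 19 \<approx> pos_int 1"
proof -
  have "list_game_le (list_games2 ! 19) (LG [LG [] []] []) \<and> list_game_le (LG [LG [] []] []) (list_games2 ! 19)"
    by code_simp
  moreover have "to_game (list_games2 ! 19) = gs2 ! 19"
    unfolding map_to_game_list_games2[symmetric]
    by (rule nth_map[symmetric]) (simp add: list_games2_def pairs2_def)
  moreover have "to_game (LG [LG [] []] []) = pos_int 1"
    by (simp add: One_nat_def[symmetric] del: One_nat_def) (simp add: One_nat_def)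
  ultimately show ?thesis by (simp add: list_game_le_iff game_equiv_def)
qed

interpretation day3_antichain: hot_antichain antichain_games
proof
  show "birthday a \<le> 3" if "a |\<in>| antichain_games" for a
    using that by (rule in_antichain_gamesE)
      (use day2.birthday_pair_game day2.is_profile_length in \<open>auto simp: numeral_3_eq_3 numeral_2_eq_2\<close>)
  show "a = a'" if "a |\<in>| antichain_games" "a' |\<in>| antichain_games" "a \<preceq> a'" for a a'
    using in_antichain_gamesE[OF that(1)] in_antichain_gamesE[OF that(2)] antichain_games_le that(3) by metis
qed

text \<open>The game has a left option \<open>gs2 ! i\<close> which Right cannot reverse, as all its
  right options are right options of the game itself, and which in turn has 1 as a left option. Two
  blue moves thus lead to a position worth at least 1, and this contains a third blue
  vertex.\<close>

lemma three_blues: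
  assumes "a |\<in>| antichain_games" "finite T" "pos E c T \<approx> a"
  shows "3 \<le> card (blues c T)"
proof -
  obtain p q i where pq: "(p, q) \<in> set antichain_pairs" "a = day2.pair_game (p, q)" "day2.is_profile p q"
    and i: "i < length gs2" "p ! i" "lo2 ! i ! 19" "ro2 ! i \<sqsubseteq> q"
    using assms(1) by (rule in_antichain_gamesE)
  have len: "length p = length gs2" "length q = length gs2" using day2.is_profile_length[OF pq(3)] by auto
  have 19: "19 < length gs2" by (simp add: gs2_def pairs2_def)
  have "gs2 ! i |\<in>| left_opts a" using i len by (auto simp: pq(2) day2.pair_game_def day2.in_opts_iff)
  then have "\<not> pos E c T \<preceq> gs2 ! i"
    using game_le_left[OF game_equiv_ge[OF assms(3)]] by blast
  then obtain v where v: "v \<in> T" "c v = Blue" "gs2 ! i \<preceq> pos E c (remaining E T v)"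
  proof (cases rule: not_game_leE)
    case (1 G)
    then show ?thesis using that assms(2) by (auto simp: left_opts_pos)
  next
    case (2 x)
    obtain k where k: "k < length gs2" "x \<approx> gs2 ! k" using day2.option_rep[OF i(1)] 2(1) by blast
    then have "ro2 ! i ! k" using day2.ro[OF i(1) k(1)] 2(1) by blast
    then have "q ! k" using i(4) k(1) day2.length_nth_row[OF i(1)] by (auto simp: implies_list_iff)
    then have "gs2 ! k |\<in>| right_opts a" using k len by (auto simp: pq(2) day2.pair_game_def day2.in_opts_iff)
    moreover have "gs2 ! k \<preceq> a" using k 2(2) assms(3) game_le_trans game_equiv_le game_equiv_ge by blast
    ultimately show ?thesis using right_option_not_le by blast
  qed
  obtain x where x: "x |\<in>| left_opts (gs2 ! i)" "x \<approx> gs2 ! 19"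
    using day2.lo[OF i(1) 19] i(3) by blast
  have "\<not> pos E c (remaining E T v) \<preceq> pos_int 1"
    using game_le_left[OF v(3) x(1)] x(2) gs2_19 game_le_trans game_equiv_ge by meson
  then obtain u where u: "u \<in> remaining E T v" "c u = Blue" "pos_int 1 \<preceq> pos E c (remaining E (remaining E T v) u)"
    by (rule not_game_leE) (use assms(2) in \<open>auto simp: left_opts_pos\<close>)
  then show ?thesis
    using pos_int_le_pos[of "remaining E (remaining E T v) u" 1 E c] card_blues_remaining[of T v c E]
      card_blues_remaining[of "remaining E T v" u c E] v assms(2) by simp
qed

lemma placement_F_4_ge:
  assumes "\<And>G. birthday G \<le> 4 \<Longrightarrow> \<exists>n. realized_by G n"
  shows "16 \<le> placement_F 4"
proof -
  have birth: "birthday day3_antichain.hot \<le> 4" using day3_antichain.birthday_hot by simp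
  then obtain n where "realized_by day3_antichain.hot n" using assms by blast
  moreover have "16 \<le> n" if realized: "realized_by day3_antichain.hot n" for n
  proof (rule ccontr)
    assume "\<not> 16 \<le> n"
    then obtain E :: "(nat \<times> nat) set" and c S where "finite S" "card S \<le> 15" "pos E c S \<approx> day3_antichain.hot"
      using realized unfolding realized_by_def by force
    then show False
      using day3_antichain.card_le_if_equiv_hot[of E c S] three_blues fcard_antichain_games by fastforce
  qed
  ultimately show ?thesis using placement_F_ge[OF birth] by blast
qed

text \<open>Loops do not affect play, so the diagonal of R is free to record the colours. A coloured
  digraph on n vertices is thus encoded by one relation, of which there are only 2 ^ (n *
  n).\<close>

lemma realized_by_code:
  assumes "realized_by G n"
  shows "\<exists>R \<subseteq> {..<n} \<times> {..<n}. pos R (\<lambda>v. if (v, v) \<in> R then Blue else Red) {..<n} \<approx> G"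
proof -
  obtain E :: "(nat \<times> nat) set" and c S where S: "finite S" "card S = n" "pos E c S \<approx> G"
    using assms unfolding realized_by_def by blast
  then obtain f where f: "bij_betw f S {..<n}"
    using ex_bij_betw_finite_nat[of S] by (auto simp: lessThan_atLeast0)
  define R where "R = {(f v, f w) | v w. v \<in> S \<and> w \<in> S \<and> (if v = w then c v = Blue else (v, w) \<in> E)}"
  have inR: "(f v, f w) \<in> R \<longleftrightarrow> (if v = w then c v = Blue else (v, w) \<in> E)" if "v \<in> S" "w \<in> S" for v w
    using that bij_betw_imp_inj_on[OF f] by (auto simp: R_def inj_on_eq_iff)
  have "pos R (\<lambda>v. if (v, v) \<in> R then Blue else Red) (f ` S) = pos E c S"
  proof (rule pos_map[OF S(1) bij_betw_imp_inj_on[OF f]])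
    show "(if (f v, f v) \<in> R then Blue else Red) = c v" if "v \<in> S" for v
      using inR[OF that that] by (cases "c v") auto
    show "(f v, f w) \<in> R \<longleftrightarrow> (v, w) \<in> E" if "v \<in> S" "w \<in> S" "v \<noteq> w" for v w
      using inR[OF that(1,2)] that(3) by simp
  qed
  moreover have "f ` S = {..<n}" using f by (simp add: bij_betw_def)
  moreover have "R \<subseteq> {..<n} \<times> {..<n}" using f by (auto simp: R_def bij_betw_def)
  ultimately show ?thesis using S(3) by (intro exI[of _ R]) simp
qed

lemma card_realized_le:
  fixes Gs :: "game set"
  assumes "\<And>G. G \<in> Gs \<Longrightarrow> \<exists>n\<le>N. realized_by G n" "\<And>G H. G \<in> Gs \<Longrightarrow> H \<in> Gs \<Longrightarrow> G \<approx> H \<Longrightarrow> G = H"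
  shows "card Gs \<le> Suc N * 2 ^ (N * N)"
proof -
  define code where "code t = pos (snd t) (\<lambda>v. if (v, v) \<in> snd t then Blue else Red) {..<fst t}" for t :: "nat \<times> (nat \<times> nat) set"
  let ?codes = "{..N} \<times> Pow ({..<N} \<times> {..<N})"
  have "\<exists>t \<in> ?codes. code t \<approx> G" if G: "G \<in> Gs" for G
  proof -
    obtain n where n: "n \<le> N" "realized_by G n" using assms(1)[OF G] by blast
    then obtain R where R: "R \<subseteq> {..<n} \<times> {..<n}" "code (n, R) \<approx> G" using realized_by_code[OF n(2)] by (auto simp: code_def)
    then have "(n, R) \<in> ?codes" using n(1) by auto
    then show ?thesis using R(2) by blast
  qed
  then obtain t where t: "\<And>G. G \<in> Gs \<Longrightarrow> t G \<in> ?codes \<and> code (t G) \<approx> G" by metis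
  have "inj_on t Gs"
  proof (rule inj_onI)
    fix G H assume "G \<in> Gs" "H \<in> Gs" "t G = t H"
    then show "G = H" using t[of G] t[of H] assms(2)[of G H] game_equiv_sym game_equiv_trans by metis
  qed
  then have "card Gs \<le> card ?codes" using t by (intro card_inj_on_le[of t]) blast+
  also have "\<dots> = Suc N * 2 ^ (N * N)" by (simp add: card_cartesian_product card_Pow)
  finally show ?thesis .
qed

lemma fset_Abs_fset: "finite B \<Longrightarrow> fset (Abs_fset B) = B"
  by (simp add: Abs_fset_inverse)

lemma bij_betw_fset:
  "bij_betw fset {S. S |\<subseteq>| A \<and> P (fset S)} {B. B \<subseteq> fset A \<and> P B}"
proof (rule bij_betwI[where g = Abs_fset])
  have inv: "fset (Abs_fset B) = B" if "B \<subseteq> fset A" for B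
    using that finite_subset fset_Abs_fset by (metis finite_fset)
  show "Abs_fset \<in> {B. B \<subseteq> fset A \<and> P B} \<rightarrow> {S. S |\<subseteq>| A \<and> P (fset S)}"
    using inv by (auto simp: less_eq_fset.rep_eq)
  show "fset (Abs_fset B) = B" if "B \<in> {B. B \<subseteq> fset A \<and> P B}" for B using inv that by blast
qed (auto simp: less_eq_fset.rep_eq fset_inverse)

lemma card_fset_subsets: "card {S. S |\<subseteq>| A} = 2 ^ fcard A"
  using bij_betw_same_card[OF bij_betw_fset[of A "\<lambda>_. True"]] by (simp add: fcard.rep_eq flip: card_Pow Pow_def)

lemma card_fset_subsets_fcard: "card {S. S |\<subseteq>| A \<and> fcard S = k} = fcard A choose k"
  using bij_betw_same_card[OF bij_betw_fset[of A "\<lambda>B. card B = k"]] n_subsets[of "fset A" k]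
  by (simp add: fcard.rep_eq)

lemma exponent_le_if_power_le:
  assumes "(2 :: nat) ^ k \<le> Suc 255 * 2 ^ l"
  shows "k \<le> 8 + l"
proof -
  have "Suc 255 * 2 ^ l = (2 :: nat) ^ (8 + l)" by (simp add: power_add)
  then show ?thesis using assms by (metis one_less_numeral_iff power_le_imp_le_exp semiring_norm(76))
qed

lemma placement_F_5_ge:
  assumes "\<And>G. birthday G \<le> 5 \<Longrightarrow> \<exists>n. realized_by G n"
  shows "256 \<le> placement_F 5"
proof (rule ccontr)
  assume small: "\<not> 256 \<le> placement_F 5"
  \<comment> \<open>19 choose 9 = 92378 exceeds 8 + 255 * 255 = 65033, the binary logarithm of the
    bound on the number of codes; 18 choose 9 = 48620 would not.\<close>
  obtain A where A: "A |\<subseteq>| antichain_games" "fcard A = 19"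
  proof -
    obtain B where B: "B \<subseteq> fset antichain_games" "card B = 19" "finite B"
      using obtain_subset_with_card_n[of 19 "fset antichain_games"] fcard_antichain_games by (auto simp: fcard.rep_eq)
    then show ?thesis using that[of "Abs_fset B"] by (simp add: less_eq_fset.rep_eq fcard.rep_eq fset_Abs_fset)
  qed
  define game3 where "game3 S = Game S {|neg_int 3|}" for S
  define game4 where "game4 S = Game S {|neg_int 4|}" for S
  \<comment> \<open>Sets of equal size are incomparable, so \<open>hot_le_hot\<close> turns the
    9-subsets into an antichain born by day 4. Applied again, it keeps apart the games on day 5 made
    from all subsets of that antichain.\<close>
  define \<F> where "\<F> = {S. S |\<subseteq>| A \<and> fcard S = 9}"
  define T where "T = Abs_fset (game3 ` \<F>)"
  have inj: "inj game3" "inj game4" by (auto simp: inj_on_def game3_def game4_def)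
  have "finite \<F>" unfolding \<F>_def by (rule finite_subset[of _ "fset (fPow A)"]) auto
  then have fset_T: "fset T = game3 ` \<F>" by (simp add: T_def fset_Abs_fset)
  have hot_A: "hot_game 3 A" by unfold_locales (use A(1) day3_antichain.birthday_A in blast)
  have anti_A: "x = y" if "x |\<in>| A" "y |\<in>| A" "x \<preceq> y" for x y
    using that A(1) day3_antichain.antichain by blast
  have hot_T: "hot_game 4 T"
  proof
    fix x assume "x |\<in>| T"
    then obtain S where "S \<in> \<F>" "x = game3 S" by (auto simp: fset_T)
    then show "birthday x \<le> 4"
      using hot_game.birthday_le_Suc_if_subset[OF hot_A, of S] by (simp add: \<F>_def game3_def)
  qed
  have anti_T: "x = y" if xy: "x |\<in>| T" "y |\<in>| T" "x \<preceq> y" for x y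
  proof -
    obtain S where S: "S |\<subseteq>| A" "fcard S = 9" "x = game3 S" using xy(1) by (auto simp: fset_T \<F>_def)
    obtain S' where S': "S' |\<subseteq>| A" "fcard S' = 9" "y = game3 S'" using xy(2) by (auto simp: fset_T \<F>_def)
    have sub: "S |\<subseteq>| S'"
      by (rule hot_game.hot_le_hot[OF hot_A anti_A S(1) S'(1)]) (use xy(3) S(3) S'(3) in \<open>simp_all add: game3_def\<close>)
    then have "S = S'" by (rule fcard_seteq) (simp add: S(2) S'(2))
    then show ?thesis using S S' by simp
  qed
  have "fcard T = card \<F>"
    using card_image[OF inj_on_subset[OF inj(1)], of \<F>] by (simp add: fcard.rep_eq fset_T)
  also have "\<dots> = 19 choose 9" by (simp add: \<F>_def card_fset_subsets_fcard A(2))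
  finally have card_T: "fcard T = 92378" by (simp add: binomial_fact' fact_numeral)
  let ?Gs = "game4 ` {S. S |\<subseteq>| T}"
  have "card ?Gs \<le> Suc 255 * 2 ^ (255 * 255)"
  proof (rule card_realized_le)
    fix G assume "G \<in> ?Gs"
    then have birth: "birthday G \<le> 5"
      using hot_game.birthday_le_Suc_if_subset[OF hot_T] by (auto simp: game4_def)
    show "\<exists>n\<le>255. realized_by G n"
    proof (rule ccontr)
      assume *: "\<not> (\<exists>n\<le>255. realized_by G n)"
      have "256 \<le> n" if "realized_by G n" for n
      proof (rule ccontr)
        assume "\<not> 256 \<le> n"
        then have "n \<le> 255" by simp
        then show False using * that by blast
      qed
      then show False using placement_F_ge[OF birth] assms[OF birth] small by blast
    qed
  next
    fix G H assume "G \<in> ?Gs" "H \<in> ?Gs" and equiv: "G \<approx> H"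
    then obtain S S' where S: "S |\<subseteq>| T" "G = game4 S" "S' |\<subseteq>| T" "H = game4 S'" by blast
    have "S |\<subseteq>| S'" "S' |\<subseteq>| S"
      using hot_game.hot_le_hot[OF hot_T anti_T S(1,3)] hot_game.hot_le_hot[OF hot_T anti_T S(3,1)] equiv S(2,4)
      by (simp_all add: game_equiv_def game4_def)
    then show "G = H" using S(2,4) by (simp add: fsubset_antisym)
  qed
  moreover have "card ?Gs = 2 ^ fcard T"
    using card_image[OF inj_on_subset[OF inj(2)], of "{S. S |\<subseteq>| T}"] by (simp add: card_fset_subsets)
  ultimately have "2 ^ fcard T \<le> Suc 255 * 2 ^ (255 * 255)" by (simp only:)
  then have "fcard T \<le> 8 + 255 * 255" by (rule exponent_le_if_power_le)
  then show False using card_T by simp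
qed

text \<open>This provides the realization that every lower bound presupposes.\<close>

lemma realized_if_birthday_le_5: "birthday G \<le> 5 \<Longrightarrow> \<exists>n. realized_by G n"
  using realized_day5 by blast

theorem theorem13:
  shows "placement_F 0 = 0 \<and> placement_F 1 = 2 \<and> placement_F 2 = 4 \<and>
    5 \<le> placement_F 3 \<and> placement_F 3 \<le> 74 \<and>
    16 \<le> placement_F 4 \<and> placement_F 4 \<le> 13439 \<and>
    256 \<le> placement_F 5 \<and> real (placement_F 5) \<le> 1.08 * 10 ^ 189"
proof -
  \<comment> \<open>For days 1, 2 and 3 the switch gives the lower bounds 2, 4 and 6.\<close>
  have switch: "2 * Suc k \<le> placement_F (Suc k)" if "Suc k \<le> 5" for k
    using that by (intro placement_F_ge_switch realized_if_birthday_le_5) simp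
  have "placement_F 1 = 2"
    using day1.placement_F_le_if_realizes_within[OF realizes_within_digraphs1 map_to_game_list_games1] switch[of 0]
    by simp
  moreover have "placement_F 2 = 4"
    using day2.placement_F_le_if_realizes_within[OF realizes_within_digraphs2 map_to_game_list_games2] switch[of 1]
    by (simp add: numeral_2_eq_2)
  moreover have "5 \<le> placement_F 3"
    using switch[of 2] by (simp add: numeral_3_eq_3 numeral_2_eq_2)
  moreover have "16 \<le> placement_F 4"
    by (rule placement_F_4_ge) (rule realized_if_birthday_le_5, simp)
  moreover have "256 \<le> placement_F 5"
    by (rule placement_F_5_ge) (rule realized_if_birthday_le_5)
  ultimately show ?thesis
    using placement_F_0 placement_F_3_le placement_F_4_le placement_F_5_le by blast
qed

end
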